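(* Let $1<p<\infty$. Then $\{T(t)\}_{t\ge0}$ can be extrapolated to a $C_0$-semigroup $\{T_p(t)\}_{t\ge0}$ on $L^p(\mathbb{R}^d;\mathbb{C}^m)$. Moreover, if $(A_p,D(A_p))$ denotes its generator, then $C_c^\infty(\mathbb{R}^d;\mathbb{C}^m)\subset D(A_p)$ and $A_pu=\mathcal{A}u$ for all $u\in C_c^\infty(\mathbb{R}^d;\mathbb{C}^m)$.
   Context: Let $d,m\ge1$. Standing assumptions: (a) $Q=(q_{ij}):\mathbb{R}^d\to\mathbb{R}^{d\times d}$ is such that $q_{ij}=q_{ji}$ is bounded and continuously differentiable with bounded derivatives, and there are $\eta_1,\eta_2>0$ with $\eta_1|\xi|^2\le\langle Q(x)\xi,\xi\rangle\le\eta_2|\xi|^2$ for all $x,\xi\in\mathbb{R}^d$; (b) $V=(v_{ij}):\mathbb{R}^d\to\mathbb{R}^{m\times m}$ has entries $v_{ij}\in L^\infty_{\mathrm{loc}}(\mathbb{R}^d)$ and $\mathrm{Re}\langle V(x)\xi,\xi\rangle\ge0$ for all $x\in\mathbb{R}^d$, $\xi\in\mathbb{C}^m$. $\mathcal{A}u=\Delta_Q u-Vu$, where $\Delta_Q u=\mathrm{div}(Q\nabla u)$ acts componentwise on $u=(u_1,\dots,u_m)$ in the sense of distributions. $A$ is the operator on $L^2(\mathbb{R}^d;\mathbb{C}^m)$ given by $Au=\mathcal{A}u$ with $D(A)=\{u\in H^1(\mathbb{R}^d;\mathbb{C}^m):\mathcal{A}u\in L^2(\mathbb{R}^d;\mathbb{C}^m)\}$;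 it generates a $C_0$-semigroup of contractions $\{T(t)\}_{t\ge0}$ on $L^2(\mathbb{R}^d;\mathbb{C}^m)$. $L^p(\mathbb{R}^d;\mathbb{C}^m)$ carries the norm $\|f\|_p=(\int_{\mathbb{R}^d}|f(x)|^p\,dx)^{1/p}$ with $|\cdot|$ the Euclidean norm on $\mathbb{C}^m$. "Extrapolated" means that $T_p(t)f=T(t)f$ for all $t\ge0$ and $f\in L^2(\mathbb{R}^d;\mathbb{C}^m)\cap L^p(\mathbb{R}^d;\mathbb{C}^m)$. *)

theory Defs
  imports "HOL-Analysis.Analysis"
begin

section \<open>Smooth functions with compact support\<close>

definition partial :: "'d::finite \<Rightarrow> (real^'d \<Rightarrow> 'b::real_normed_vector) \<Rightarrow> real^'d \<Rightarrow> 'b" where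
  "partial i f x = frechet_derivative f (at x) (axis i 1)"

text \<open>Every iterated partial derivative is (Frechet) differentiable, hence continuous; this is
  the usual class of infinitely differentiable functions.\<close>

definition smooth :: "(real^'d::finite \<Rightarrow> 'b::real_normed_vector) \<Rightarrow> bool" where
  "smooth f \<longleftrightarrow> (\<forall>is. foldr partial is f differentiable_on UNIV)"

definition Cc_infty :: "(real^'d::finite \<Rightarrow> 'b::real_normed_vector) set" where
  "Cc_infty = {f. smooth f \<and> compact (closure {x. f x \<noteq> 0})}"

definition bounded_C1 :: "(real^'d::finite \<Rightarrow> real) \<Rightarrow> bool" where
  "bounded_C1 q \<longleftrightarrow>
     bounded (range q) \<and> q differentiable_on UNIV \<and>
     (\<forall>k. continuous_on UNIV (partial k q) \<and> bounded (range (partial k q)))"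


section \<open>Lebesgue spaces\<close>

text \<open>Elements of the Lebesgue spaces are represented by functions; all identities between them
  are stated almost everywhere. On \<^typ>\<open>complex^'m\<close> the library norm is the Euclidean norm.\<close>

definition Linf_loc :: "(real^'d::finite \<Rightarrow> real) \<Rightarrow> bool" where
  "Linf_loc v \<longleftrightarrow> v \<in> borel_measurable lebesgue \<and>
     (\<forall>K. compact K \<longrightarrow> (\<exists>C. AE x in lebesgue. x \<in> K \<longrightarrow> \<bar>v x\<bar> \<le> C))"

definition Lp :: "real \<Rightarrow> (real^'d::finite \<Rightarrow> complex^'m::finite) set" where
  "Lp p = {f \<in> borel_measurable lebesgue. integrable lebesgue (\<lambda>x. norm (f x) powr p)}"

definition Lp_norm :: "real \<Rightarrow> (real^'d::finite \<Rightarrow> complex^'m::finite) \<Rightarrow> real" where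
  "Lp_norm p f = (LINT x|lebesgue. norm (f x) powr p) powr (1 / p)"


section \<open>Strongly continuous semigroups on Lebesgue spaces\<close>

definition bounded_operator ::
    "real \<Rightarrow> ((real^'d::finite \<Rightarrow> complex^'m::finite) \<Rightarrow> (real^'d \<Rightarrow> complex^'m)) \<Rightarrow> bool" where
  "bounded_operator p S \<longleftrightarrow>
     (\<forall>f\<in>Lp p. S f \<in> Lp p) \<and>
     (\<forall>f\<in>Lp p. \<forall>g\<in>Lp p. \<forall>c::complex.
        AE x in lebesgue. S (\<lambda>y. c *s f y + g y) x = c *s S f x + S g x) \<and>
     (\<exists>M. \<forall>f\<in>Lp p. Lp_norm p (S f) \<le> M * Lp_norm p f)"

definition C0_semigroup ::
    "real \<Rightarrow> (real \<Rightarrow> (real^'d::finite \<Rightarrow> complex^'m::finite) \<Rightarrow> (real^'d \<Rightarrow> complex^'m)) \<Rightarrow> bool" where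
  "C0_semigroup p T \<longleftrightarrow>
     (\<forall>t\<ge>0. bounded_operator p (T t)) \<and>
     (\<forall>f\<in>Lp p. AE x in lebesgue. T 0 f x = f x) \<and>
     (\<forall>s\<ge>0. \<forall>t\<ge>0. \<forall>f\<in>Lp p. AE x in lebesgue. T (s + t) f x = T s (T t f) x) \<and>
     (\<forall>f\<in>Lp p. ((\<lambda>t. Lp_norm p (\<lambda>x. T t f x - f x)) \<longlongrightarrow> 0) (at_right 0))"

definition contractions ::
    "real \<Rightarrow> (real \<Rightarrow> (real^'d::finite \<Rightarrow> complex^'m::finite) \<Rightarrow> (real^'d \<Rightarrow> complex^'m)) \<Rightarrow> bool" where
  "contractions p T \<longleftrightarrow> (\<forall>t\<ge>0. \<forall>f\<in>Lp p. Lp_norm p (T t f) \<le> Lp_norm p f)"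

text \<open>The generator as a graph; its domain is \<^const>\<open>Domain\<close> of the graph. The graph contains
  all representatives of a given pair of classes.\<close>

definition generator ::
    "real \<Rightarrow> (real \<Rightarrow> (real^'d::finite \<Rightarrow> complex^'m::finite) \<Rightarrow> (real^'d \<Rightarrow> complex^'m)) \<Rightarrow>
     ((real^'d \<Rightarrow> complex^'m) \<times> (real^'d \<Rightarrow> complex^'m)) set" where
  "generator p T = {(f, g). f \<in> Lp p \<and> g \<in> Lp p \<and>
     ((\<lambda>h. Lp_norm p (\<lambda>x. (1 / h) *\<^sub>R (T h f x - f x) - g x)) \<longlongrightarrow> 0) (at_right 0)}"

definition extrapolates ::
    "real \<Rightarrow> (real \<Rightarrow> (real^'d::finite \<Rightarrow> complex^'m::finite) \<Rightarrow> (real^'d \<Rightarrow> complex^'m)) \<Rightarrow>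
     (real \<Rightarrow> (real^'d \<Rightarrow> complex^'m) \<Rightarrow> (real^'d \<Rightarrow> complex^'m)) \<Rightarrow> bool" where
  "extrapolates p T Tp \<longleftrightarrow>
     (\<forall>t\<ge>0. \<forall>f \<in> Lp 2 \<inter> Lp p. AE x in lebesgue. Tp t f x = T t f x)"


section \<open>Distributions\<close>

text \<open>A distribution is a functional on real test functions; being componentwise, it takes values in
  \<^typ>\<open>complex^'m\<close>. Only its values on \<^const>\<open>Cc_infty\<close> matter, see \<open>distr_eq\<close>.\<close>

type_synonym ('d, 'm) distr = "(real^'d \<Rightarrow> real) \<Rightarrow> complex^'m"

definition distr_eq :: "('d::finite, 'm::finite) distr \<Rightarrow> ('d, 'm) distr \<Rightarrow> bool" where
  "distr_eq S S' \<longleftrightarrow> (\<forall>\<phi>\<in>Cc_infty. S \<phi> = S' \<phi>)"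

definition distr_of :: "(real^'d::finite \<Rightarrow> complex^'m::finite) \<Rightarrow> ('d, 'm) distr" where
  "distr_of f = (\<lambda>\<phi>. LINT x|lebesgue. \<phi> x *\<^sub>R f x)"

definition distr_partial :: "'d::finite \<Rightarrow> ('d, 'm::finite) distr \<Rightarrow> ('d, 'm) distr" where
  "distr_partial i S = (\<lambda>\<phi>. - S (partial i \<phi>))"

definition distr_mult :: "(real^'d::finite \<Rightarrow> real) \<Rightarrow> ('d, 'm::finite) distr \<Rightarrow> ('d, 'm) distr" where
  "distr_mult q S = (\<lambda>\<phi>. S (\<lambda>x. q x * \<phi> x))"

text \<open>\<open>div (Q \<nabla> u)\<close>. The entries of \<open>Q\<close> are only continuously differentiable, so the distribution
  \<open>\<partial>\<^sub>j u\<close> is evaluated at \<open>q\<^sub>i\<^sub>j \<partial>\<^sub>i \<phi>\<close>, a continuously differentiable function with compact support;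
  as \<open>\<partial>\<^sub>j u\<close> has order at most one for locally integrable \<open>u\<close>, this is meaningful.\<close>

definition Delta_Q ::
    "(real^'d::finite \<Rightarrow> real^'d^'d) \<Rightarrow> (real^'d \<Rightarrow> complex^'m::finite) \<Rightarrow> ('d, 'm) distr" where
  "Delta_Q Q u = (\<lambda>\<phi>. \<Sum>i\<in>UNIV. distr_partial i (\<lambda>\<psi>. \<Sum>j\<in>UNIV.
     distr_mult (\<lambda>x. Q x $ i $ j) (distr_partial j (distr_of u)) \<psi>) \<phi>)"

definition cmatrix :: "real^'n::finite^'m::finite \<Rightarrow> complex^'n^'m" where
  "cmatrix M = (\<chi> i j. complex_of_real (M $ i $ j))"

definition calA ::
    "(real^'d::finite \<Rightarrow> real^'d^'d) \<Rightarrow> (real^'d \<Rightarrow> real^'m^'m) \<Rightarrow>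
     (real^'d \<Rightarrow> complex^'m::finite) \<Rightarrow> ('d, 'm) distr" where
  "calA Q V u = (\<lambda>\<phi>. Delta_Q Q u \<phi> - distr_of (\<lambda>x. cmatrix (V x) *v u x) \<phi>)"


section \<open>The operator on the space of square integrable functions\<close>

definition H1 :: "(real^'d::finite \<Rightarrow> complex^'m::finite) set" where
  "H1 = {u \<in> Lp 2. \<forall>j. \<exists>w\<in>Lp 2. distr_eq (distr_partial j (distr_of u)) (distr_of w)}"

definition op_A ::
    "(real^'d::finite \<Rightarrow> real^'d^'d) \<Rightarrow> (real^'d \<Rightarrow> real^'m^'m) \<Rightarrow>
     ((real^'d \<Rightarrow> complex^'m::finite) \<times> (real^'d \<Rightarrow> complex^'m)) set" where
  "op_A Q V = {(u, g). u \<in> H1 \<and> g \<in> Lp 2 \<and> distr_eq (calA Q V u) (distr_of g)}"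

end

theory Submission
  imports Defs
begin

text \<open>
  The heart of the matter is that \<open>\<integral> F(|T(t) f|\<^sup>2) dx\<close> decreases in \<open>t\<close> for every smooth function \<open>F\<close>
  such that \<open>z \<mapsto> F(|z|\<^sup>2)\<close> is convex and has a bounded second derivative. Formally, its time
  derivative is twice the integral of \<open>G(u) \<bullet> A u\<close>, where \<open>G(z) = F'(|z|\<^sup>2) z\<close>. Integrating by parts
  turns it into minus the integral of \<open>\<Sum>\<^sub>i\<^sub>j q\<^sub>i\<^sub>j DG(u)[\<partial>\<^sub>i u] \<bullet> \<partial>\<^sub>j u + F'(|u|\<^sup>2) V u \<bullet> u\<close>. The first term is
  nonnegative because \<open>Q\<close> and the Hessian \<open>DG\<close> are, the second because \<open>V\<close> is accretive; here it is
  essential that the principal part acts on all components in the same way. The rigorous version is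
  lemma \<open>dissipative\<close>. Since \<open>V\<close> is only locally bounded and \<open>u\<close> is only in \<open>H\<^sup>1\<close>, it tests the equation
  for \<open>A u\<close> with \<open>\<zeta> G(v)\<close>, where \<open>\<zeta>\<close> is a cut-off function and \<open>v\<close> a mollification of \<open>u\<close>, and then
  removes both regularizations.

  The passage from \<open>dissipative\<close> to the semigroup (\<open>energy_decreasing\<close>) does not differentiate in
  time: convexity bounds the increment over a step \<open>h\<close> by the dissipative term at the end of the step
  plus an error \<open>o(h)\<close> which is uniform in time, so that the sum over \<open>t/h\<close> steps gives the claim for
  initial values in \<open>D(A)\<close>. Test functions belong to \<open>D(A)\<close> and are dense in \<open>L\<^sup>2\<close>, which gives it for
  all \<open>f\<close> in \<open>L\<^sup>2\<close>. Letting \<open>F(s)\<close> tend to \<open>s\<^bsup>p/2\<^esup>\<close> yields \<open>\<parallel>T(t) f\<parallel>\<^sub>p \<le> \<parallel>f\<parallel>\<^sub>p\<close> (\<open>Lp_contractive\<close>).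

  As \<open>1 < p < \<infinity>\<close> is arbitrary, contractivity is available for an exponent \<open>q\<close> such that \<open>p\<close> lies
  strictly between \<open>2\<close> and \<open>q\<close> (or \<open>p = 2\<close>). Hence convergence in \<open>L\<^sup>2\<close> together with boundedness in \<open>L\<^sup>q\<close>
  gives convergence in \<open>L\<^sup>p\<close>. This is how strong continuity of the extended semigroup is obtained, and
  also the assertion on the generator: for a test function \<open>u\<close> the difference quotients converge to
  \<open>A u\<close> in \<open>L\<^sup>2\<close>, and they are bounded in \<open>L\<^sup>q\<close> because \<open>T(h) u - u = \<integral>\<^sub>0\<^sup>h T(s) A u ds\<close> and \<open>A u\<close> is in \<open>L\<^sup>q\<close>.
\<close>

section \<open>Powers of sums and complex vectors\<close>

lemma powr_add_le:
  fixes a b p :: real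
  assumes "a \<ge> 0" "b \<ge> 0" "p \<ge> 0"
  shows "(a + b) powr p \<le> 2 powr p * (a powr p + b powr p)"
proof -
  have "(a + b) powr p \<le> (2 * max a b) powr p"
    using assms by (intro powr_mono2) auto
  also have "\<dots> = 2 powr p * max a b powr p"
    using assms by (simp add: powr_mult)
  also have "\<dots> \<le> 2 powr p * (a powr p + b powr p)"
    by (intro mult_left_mono) (auto simp: max_def)
  finally show ?thesis .
qed

lemma powr_convex_combination:
  fixes x y l p :: real
  assumes "x \<ge> 0" "y \<ge> 0" "p \<ge> 1" "0 < l" "l < 1"
  shows "(l * x + (1 - l) * y) powr p \<le> l * x powr p + (1 - l) * y powr p"
proof -
  have small: "(c * z) powr p \<le> c * z powr p" if "0 < c" "c < 1" "z \<ge> 0" for c z :: real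
  proof -
    have "c powr p \<le> c powr 1" using that assms by (intro powr_mono') auto
    then show ?thesis using that by (simp add: powr_mult mult_right_mono)
  qed
  consider "x = 0" | "y = 0" | "x > 0" "y > 0" using assms by fastforce
  then show ?thesis
  proof cases
    case 1 then show ?thesis using small[of "1 - l" y] assms by simp
  next
    case 2 then show ?thesis using small[of l x] assms by simp
  next
    case 3
    then show ?thesis
      using convex_onD[OF powr_convex[OF \<open>p \<ge> 1\<close>], of "1 - l" x y] assms
      by (simp add: algebra_simps)
  qed
qed

lemma norm_vector_smult: "norm (c *s v) = cmod c * norm v" for v :: "complex^'n::finite"
  by (simp add: norm_vec_def L2_set_def vector_scalar_mult_def norm_mult power_mult_distrib
      real_sqrt_mult flip: sum_distrib_left)

lemma smult_of_real: "complex_of_real r *s v = r *\<^sub>R v" for v :: "complex^'n::finite"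
  by (simp add: vec_eq_iff vector_scalar_mult_def) (simp add: scaleR_conv_of_real)

lemma measurable_smult[measurable]:
  fixes f :: "'a \<Rightarrow> complex^'n::finite"
  assumes "f \<in> borel_measurable M"
  shows "(\<lambda>x. c *s f x) \<in> borel_measurable M"
proof -
  have "linear (\<lambda>v::complex^'n. c *s v)"
    by (rule linearI) (simp_all add: vec_eq_iff vector_scalar_mult_def algebra_simps)
  then have "continuous_on UNIV (\<lambda>v::complex^'n. c *s v)" by (rule linear_continuous_on[OF linear_conv_bounded_linear[THEN iffD1]])
  from borel_measurable_continuous_on[OF this assms] show ?thesis .
qed

section \<open>The Lebesgue spaces\<close>

lemma LpD:
  assumes "f \<in> Lp p"
  shows Lp_measurable: "f \<in> borel_measurable lebesgue"
    and Lp_integrable: "integrable lebesgue (\<lambda>x. norm (f x) powr p)"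
  using assms by (auto simp: Lp_def)

lemma Lp_dominated:
  assumes f: "f \<in> borel_measurable lebesgue" and g: "integrable lebesgue g"
    and le: "AE x in lebesgue. norm (f x) powr p \<le> g x"
  shows "f \<in> Lp p"
proof -
  have "integrable lebesgue (\<lambda>x. norm (f x) powr p)"
  proof (rule Bochner_Integration.integrable_bound[OF g])
    show "(\<lambda>x. norm (f x) powr p) \<in> borel_measurable lebesgue" using f by measurable
    show "AE x in lebesgue. norm (norm (f x) powr p) \<le> norm (g x)"
      using le by eventually_elim simp
  qed
  with f show ?thesis by (simp add: Lp_def)
qed

lemma Lp_norm_nonneg[simp]: "Lp_norm p f \<ge> 0"
  by (simp add: Lp_norm_def)

lemma Lp_norm_powr:
  assumes "p > 0"
  shows "Lp_norm p f powr p = (LINT x|lebesgue. norm (f x) powr p)"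
  using assms by (simp add: Lp_norm_def powr_powr integral_nonneg_AE)

lemma Lp_norm_le_iff:
  assumes "p > 0" "c \<ge> 0"
  shows "Lp_norm p f \<le> c \<longleftrightarrow> (LINT x|lebesgue. norm (f x) powr p) \<le> c powr p"
  unfolding Lp_norm_powr[OF assms(1), symmetric]
  using assms powr_mono2[of p "Lp_norm p f" c] powr_less_mono2[of p c "Lp_norm p f"]
  by force

lemma Lp_norm_cong_AE:
  assumes "f \<in> borel_measurable lebesgue" "AE x in lebesgue. f x = g x"
  shows "Lp_norm p f = Lp_norm p g"
proof -
  have [measurable]: "f \<in> borel_measurable lebesgue" "g \<in> borel_measurable lebesgue"
    using borel_measurable_AE[OF assms] assms(1) by auto
  show ?thesis unfolding Lp_norm_def
    by (rule arg_cong[where f="\<lambda>t. t powr (1/p)"], rule integral_cong_AE) (use assms(2) in auto)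
qed

lemma Lp_zero[simp]: "(\<lambda>x. 0) \<in> Lp p"
  by (simp add: Lp_def)

lemma Lp_norm_zero[simp]: "Lp_norm p (\<lambda>x. 0) = 0"
  by (simp add: Lp_norm_def)

lemma Lp_smult:
  assumes "f \<in> Lp p"
  shows "(\<lambda>x. c *s f x) \<in> Lp p"
  using assms by (auto simp: Lp_def norm_vector_smult powr_mult)

lemma Lp_norm_smult:
  assumes "p > 0"
  shows "Lp_norm p (\<lambda>x. c *s f x) = cmod c * Lp_norm p f"
  using assms by (simp add: Lp_norm_def norm_vector_smult powr_mult powr_powr)

lemma Lp_scaleR: "f \<in> Lp p \<Longrightarrow> (\<lambda>x. c *\<^sub>R f x) \<in> Lp p"
  using Lp_smult[of f p "of_real c"] by (simp add: smult_of_real)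

lemma Lp_norm_scaleR: "p > 0 \<Longrightarrow> Lp_norm p (\<lambda>x. c *\<^sub>R f x) = \<bar>c\<bar> * Lp_norm p f"
  using Lp_norm_smult[of p "of_real c" f] by (simp add: smult_of_real)

lemma Lp_add:
  assumes "f \<in> Lp p" "g \<in> Lp p" "p > 0"
  shows "(\<lambda>x. f x + g x) \<in> Lp p"
proof (rule Lp_dominated)
  note [measurable] = Lp_measurable[OF assms(1)] Lp_measurable[OF assms(2)]
  show "(\<lambda>x. f x + g x) \<in> borel_measurable lebesgue" by measurable
  show "integrable lebesgue (\<lambda>x. 2 powr p * (norm (f x) powr p + norm (g x) powr p))"
    using assms by (simp add: Lp_integrable)
  show "AE x in lebesgue. norm (f x + g x) powr p
      \<le> 2 powr p * (norm (f x) powr p + norm (g x) powr p)"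
  proof (rule AE_I2)
    fix x
    have "norm (f x + g x) powr p \<le> (norm (f x) + norm (g x)) powr p"
      using assms by (intro powr_mono2 norm_triangle_ineq) auto
    then show "norm (f x + g x) powr p \<le> 2 powr p * (norm (f x) powr p + norm (g x) powr p)"
      using powr_add_le[of "norm (f x)" "norm (g x)" p] assms by simp
  qed
qed

lemma Lp_minus: "f \<in> Lp p \<Longrightarrow> (\<lambda>x. - f x) \<in> Lp p"
  using Lp_scaleR[of f p "-1"] by simp

lemma Lp_diff: "f \<in> Lp p \<Longrightarrow> g \<in> Lp p \<Longrightarrow> p > 0 \<Longrightarrow> (\<lambda>x. f x - g x) \<in> Lp p"
  using Lp_add[of f p "\<lambda>x. - g x"] Lp_minus[of g p] by simp

lemma Lp_norm_eq_0_iff: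
  assumes "f \<in> Lp p" "p > 0"
  shows "Lp_norm p f = 0 \<longleftrightarrow> (AE x in lebesgue. f x = 0)"
proof -
  have "Lp_norm p f = 0 \<longleftrightarrow> (LINT x|lebesgue. norm (f x) powr p) = 0"
    using assms by (auto simp: Lp_norm_def)
  also have "\<dots> \<longleftrightarrow> (AE x in lebesgue. norm (f x) powr p = 0)"
    by (rule integral_nonneg_eq_0_iff_AE[OF Lp_integrable[OF assms(1)]]) auto
  finally show ?thesis using assms by simp
qed

text \<open>Minkowski's inequality is the convexity of \<open>r \<mapsto> r\<^sup>p\<close>, integrated with the weights
  \<open>\<parallel>f\<parallel>/(\<parallel>f\<parallel> + \<parallel>g\<parallel>)\<close> and \<open>\<parallel>g\<parallel>/(\<parallel>f\<parallel> + \<parallel>g\<parallel>)\<close>.\<close>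

lemma Lp_norm_triangle:
  assumes f: "f \<in> Lp p" and g: "g \<in> Lp p" and p: "p \<ge> 1"
  shows "Lp_norm p (\<lambda>x. f x + g x) \<le> Lp_norm p f + Lp_norm p g"
proof -
  note [measurable] = Lp_measurable[OF f] Lp_measurable[OF g]
  let ?A = "Lp_norm p f" and ?B = "Lp_norm p g"
  consider "?A = 0" | "?B = 0" | "?A > 0" "?B > 0"
    using Lp_norm_nonneg by (metis order_le_less)
  then show ?thesis
  proof cases
    case 1
    then have "AE x in lebesgue. g x = f x + g x"
      using f p by (auto simp: Lp_norm_eq_0_iff)
    from Lp_norm_cong_AE[OF _ this, of p] show ?thesis by simp
  next
    case 2
    then have "AE x in lebesgue. f x = f x + g x"
      using g p by (auto simp: Lp_norm_eq_0_iff)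
    from Lp_norm_cong_AE[OF _ this, of p] show ?thesis by simp
  next
    case 3
    define l where "l = ?A / (?A + ?B)"
    have l: "0 < l" "l < 1" using 3 by (auto simp: l_def field_simps)
    have l': "1 - l = ?B / (?A + ?B)" using 3 by (simp add: l_def field_simps)
    have Ap: "?A powr p > 0" "?B powr p > 0" using 3 by auto
    have pw: "norm (f x + g x) powr p \<le> (?A + ?B) powr p *
        (l / ?A powr p * norm (f x) powr p + (1 - l) / ?B powr p * norm (g x) powr p)" for x
    proof -
      have "norm (f x + g x) powr p \<le> (norm (f x) + norm (g x)) powr p"
        using p by (intro powr_mono2 norm_triangle_ineq) auto
      also have "norm (f x) + norm (g x)
          = (?A + ?B) * (l * (norm (f x) / ?A) + (1 - l) * (norm (g x) / ?B))"
      proof -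
        have "(?A + ?B) * (l * (norm (f x) / ?A)) = norm (f x)"
          unfolding l_def using 3 by simp
        moreover have "(?A + ?B) * ((1 - l) * (norm (g x) / ?B)) = norm (g x)"
          unfolding l' using 3 by simp
        ultimately show ?thesis by (simp add: distrib_left)
      qed
      also have "\<dots> powr p = (?A + ?B) powr p
          * (l * (norm (f x) / ?A) + (1 - l) * (norm (g x) / ?B)) powr p"
        by (rule powr_mult)
      also have "\<dots> \<le> (?A + ?B) powr p
          * (l * (norm (f x) / ?A) powr p + (1 - l) * (norm (g x) / ?B) powr p)"
        using l 3 p by (intro mult_left_mono powr_convex_combination) auto
      finally show ?thesis using 3 by (simp add: powr_divide)
    qed
    have int: "integrable lebesgue (\<lambda>x. (?A + ?B) powr p *
        (l / ?A powr p * norm (f x) powr p + (1 - l) / ?B powr p * norm (g x) powr p))"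
      by (intro integrable_mult_right Bochner_Integration.integrable_add Lp_integrable f g)
    have "(LINT x|lebesgue. norm (f x + g x) powr p) \<le> (LINT x|lebesgue. (?A + ?B) powr p *
        (l / ?A powr p * norm (f x) powr p + (1 - l) / ?B powr p * norm (g x) powr p))"
      by (intro integral_mono int pw Lp_integrable Lp_add f g) (use p in auto)
    also have "\<dots> = (?A + ?B) powr p *
        (l / ?A powr p * ?A powr p + (1 - l) / ?B powr p * ?B powr p)"
      using f g p by (simp add: Lp_integrable Lp_norm_powr)
    also have "\<dots> = (?A + ?B) powr p" using Ap by simp
    finally show ?thesis using p 3 by (subst Lp_norm_le_iff) auto
  qed
qed

lemma Lp_norm_minus: "Lp_norm p (\<lambda>x. - f x) = Lp_norm p f"
  by (simp add: Lp_norm_def)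

lemma Lp_norm_minus_commute: "Lp_norm p (\<lambda>x. f x - g x) = Lp_norm p (\<lambda>x. g x - f x)"
  by (simp add: Lp_norm_def norm_minus_commute)

lemma Lp_norm_triangle_diff:
  assumes "f \<in> Lp p" "g \<in> Lp p" "h \<in> Lp p" "p \<ge> 1"
  shows "Lp_norm p (\<lambda>x. f x - h x) \<le> Lp_norm p (\<lambda>x. f x - g x) + Lp_norm p (\<lambda>x. g x - h x)"
  using Lp_norm_triangle[of "\<lambda>x. f x - g x" p "\<lambda>x. g x - h x"] assms by (simp add: Lp_diff)

lemma Lp_norm_diff_le:
  assumes "f \<in> Lp p" "g \<in> Lp p" "p \<ge> 1"
  shows "Lp_norm p (\<lambda>x. f x - g x) \<le> Lp_norm p f + Lp_norm p g"
  using Lp_norm_triangle[of f p "\<lambda>x. - g x"] assms by (simp add: Lp_minus Lp_norm_minus)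

lemma Lp_norm_le_add_diff:
  assumes "f \<in> Lp p" "g \<in> Lp p" "p \<ge> 1"
  shows "Lp_norm p f \<le> Lp_norm p g + Lp_norm p (\<lambda>x. f x - g x)"
  using Lp_norm_triangle[of g p "\<lambda>x. f x - g x"] assms by (simp add: Lp_diff)

lemma Lp_tendsto_iff:
  assumes "p > 0"
  shows "((\<lambda>n. Lp_norm p (f n)) \<longlongrightarrow> 0) F \<longleftrightarrow>
    ((\<lambda>n. LINT x|lebesgue. norm (f n x) powr p) \<longlongrightarrow> 0) F"
proof
  assume "((\<lambda>n. Lp_norm p (f n)) \<longlongrightarrow> 0) F"
  then have "((\<lambda>n. Lp_norm p (f n) powr p) \<longlongrightarrow> 0) F"
    using assms by (intro tendsto_zero_powrI[where b=p]) auto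
  then show "((\<lambda>n. LINT x|lebesgue. norm (f n x) powr p) \<longlongrightarrow> 0) F"
    using assms by (simp add: Lp_norm_powr)
next
  assume "((\<lambda>n. LINT x|lebesgue. norm (f n x) powr p) \<longlongrightarrow> 0) F"
  then show "((\<lambda>n. Lp_norm p (f n)) \<longlongrightarrow> 0) F"
    unfolding Lp_norm_def
    using assms by (intro tendsto_zero_powrI[where b="1/p"]) (auto simp: integral_nonneg_AE)
qed

lemma Lp_dominated_convergence:
  assumes [measurable]: "\<And>n. f n \<in> borel_measurable lebesgue"
    and g: "integrable lebesgue g" and p: "p > 0"
    and le: "\<And>n x. norm (f n x) powr p \<le> g x"
    and lim: "AE x in lebesgue. (\<lambda>n. f n x) \<longlonglongrightarrow> 0"
  shows "(\<lambda>n. Lp_norm p (f n)) \<longlonglongrightarrow> 0"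
proof -
  have "(\<lambda>n. LINT x|lebesgue. norm (f n x) powr p) \<longlonglongrightarrow> (LINT x|(lebesgue :: (real^'a) measure). 0)"
  proof (rule integral_dominated_convergence[OF _ _ g])
    show "AE x in lebesgue. (\<lambda>n. norm (f n x) powr p) \<longlonglongrightarrow> 0"
      using lim by eventually_elim (use p in \<open>auto intro!: tendsto_zero_powrI[where b=p] tendsto_norm_zero\<close>)
  qed (use le in auto)
  then show ?thesis using p by (simp add: Lp_tendsto_iff)
qed

lemma Lp_fatou_AE:
  assumes f: "\<And>n. f n \<in> Lp p" and g: "g \<in> borel_measurable lebesgue" and p: "p > 0" and C: "C \<ge> 0"
    and le: "\<And>n. Lp_norm p (f n) \<le> C"
    and lim: "AE x in lebesgue. (\<lambda>n. f n x) \<longlonglongrightarrow> g x"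
  shows "g \<in> Lp p" "Lp_norm p g \<le> C"
proof -
  note [measurable] = Lp_measurable[OF f] g
  have "(\<integral>\<^sup>+x. ennreal (norm (g x) powr p) \<partial>lebesgue)
      = (\<integral>\<^sup>+x. liminf (\<lambda>n. ennreal (norm (f n x) powr p)) \<partial>lebesgue)"
  proof (rule nn_integral_cong_AE)
    show "AE x in lebesgue. ennreal (norm (g x) powr p) = liminf (\<lambda>n. ennreal (norm (f n x) powr p))"
      using lim
    proof eventually_elim
      case (elim x)
      then have "(\<lambda>n. ennreal (norm (f n x) powr p)) \<longlonglongrightarrow> ennreal (norm (g x) powr p)"
        using p by (intro tendsto_ennrealI tendsto_powr' tendsto_norm tendsto_const) auto
      from lim_imp_Liminf[OF _ this] show ?case by simp
    qed
  qed
  also have "\<dots> \<le> liminf (\<lambda>n. \<integral>\<^sup>+x. ennreal (norm (f n x) powr p) \<partial>lebesgue)"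
    by (rule nn_integral_liminf) measurable
  also have "\<dots> \<le> ennreal (C powr p)"
  proof (rule order_trans[OF Liminf_le_Limsup[OF sequentially_bot] Limsup_bounded], rule always_eventually, rule allI)
    fix n
    have "(\<integral>\<^sup>+x. ennreal (norm (f n x) powr p) \<partial>lebesgue) = ennreal (LINT x|lebesgue. norm (f n x) powr p)"
      by (intro nn_integral_eq_integral Lp_integrable f) auto
    also have "\<dots> \<le> ennreal (C powr p)"
      using le[of n] p C by (simp add: Lp_norm_le_iff ennreal_leI)
    finally show "(\<integral>\<^sup>+x. ennreal (norm (f n x) powr p) \<partial>lebesgue) \<le> ennreal (C powr p)" .
  qed
  finally have *: "(\<integral>\<^sup>+x. ennreal (norm (g x) powr p) \<partial>lebesgue) \<le> ennreal (C powr p)" .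
  have int: "integrable lebesgue (\<lambda>x. norm (g x) powr p)"
    by (intro integrableI_bounded) (use * in \<open>auto simp: le_less_trans\<close>)
  show "g \<in> Lp p" using g int by (simp add: Lp_def)
  have "(LINT x|lebesgue. norm (g x) powr p) \<le> C powr p"
    using * nn_integral_eq_integral[OF int] by (simp add: ennreal_le_iff)
  then show "Lp_norm p g \<le> C" using p C by (simp add: Lp_norm_le_iff)
qed

lemma Lp_AE_subseq:
  assumes f: "\<And>n. f n \<in> Lp p" and g: "g \<in> Lp p" and p: "p > 0"
    and lim: "(\<lambda>n. Lp_norm p (\<lambda>x. f n x - g x)) \<longlonglongrightarrow> 0"
  obtains r where "strict_mono r" "AE x in lebesgue. (\<lambda>n. f (r n) x) \<longlonglongrightarrow> g x"
proof -
  have "\<exists>r::nat\<Rightarrow>nat. strict_mono r \<and> (AE x in lebesgue. (\<lambda>n. norm (f (r n) x - g x) powr p) \<longlonglongrightarrow> 0)"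
  proof (rule tendsto_L1_AE_subseq)
    show "integrable lebesgue (\<lambda>x. norm (f n x - g x) powr p)" for n
      using Lp_diff[OF f g p] by (rule Lp_integrable)
    show "(\<lambda>n. LINT x|lebesgue. norm (norm (f n x - g x) powr p)) \<longlonglongrightarrow> 0"
      using lim p by (simp add: Lp_tendsto_iff)
  qed
  then obtain r :: "nat \<Rightarrow> nat" where r: "strict_mono r"
      "AE x in lebesgue. (\<lambda>n. norm (f (r n) x - g x) powr p) \<longlonglongrightarrow> 0" by blast
  have "AE x in lebesgue. (\<lambda>n. f (r n) x) \<longlonglongrightarrow> g x"
    using r(2)
  proof eventually_elim
    case (elim x)
    then have "(\<lambda>n. (norm (f (r n) x - g x) powr p) powr (1/p)) \<longlonglongrightarrow> 0"
      by (rule tendsto_zero_powrI[OF _ tendsto_const]) (use p in auto)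
    then show ?case using p by (simp add: powr_powr LIM_zero_iff tendsto_norm_zero_iff)
  qed
  with r(1) show ?thesis by (rule that)
qed

text \<open>Bounds in one Lebesgue space survive convergence in another one.\<close>

lemma Lp_fatou:
  assumes f: "\<And>n. f n \<in> Lp p" "\<And>n. f n \<in> Lp r" and g: "g \<in> Lp r" and p: "p > 0" "r > 0"
    and C: "C \<ge> 0" and le: "\<And>n. Lp_norm p (f n) \<le> C"
    and lim: "(\<lambda>n. Lp_norm r (\<lambda>x. f n x - g x)) \<longlonglongrightarrow> 0"
  shows "g \<in> Lp p" "Lp_norm p g \<le> C"
proof -
  obtain s where "strict_mono s" and s: "AE x in lebesgue. (\<lambda>n. f (s n) x) \<longlonglongrightarrow> g x"
    using Lp_AE_subseq[OF f(2) g p(2) lim] .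
  from Lp_fatou_AE[OF f(1) Lp_measurable[OF g] p(1) C le s]
  show "g \<in> Lp p" "Lp_norm p g \<le> C" .
qed

lemma Lp_sum:
  assumes "finite A" "\<And>i. i \<in> A \<Longrightarrow> f i \<in> Lp p" "p \<ge> 1"
  shows "(\<lambda>x. \<Sum>i\<in>A. f i x) \<in> Lp p" "Lp_norm p (\<lambda>x. \<Sum>i\<in>A. f i x) \<le> (\<Sum>i\<in>A. Lp_norm p (f i))"
proof -
  have "(\<lambda>x. \<Sum>i\<in>A. f i x) \<in> Lp p \<and> Lp_norm p (\<lambda>x. \<Sum>i\<in>A. f i x) \<le> (\<Sum>i\<in>A. Lp_norm p (f i))"
    using assms(1,2)
  proof (induction A rule: finite_induct)
    case (insert a A)
    then show ?case
      using Lp_norm_triangle[of "f a" p "\<lambda>x. \<Sum>i\<in>A. f i x"] assms(3)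
      by (auto intro!: Lp_add)
  qed auto
  then show "(\<lambda>x. \<Sum>i\<in>A. f i x) \<in> Lp p" "Lp_norm p (\<lambda>x. \<Sum>i\<in>A. f i x) \<le> (\<Sum>i\<in>A. Lp_norm p (f i))"
    by auto
qed

lemma sum_half_powers_le: "(\<Sum>n<N. (1/2) ^ n) \<le> (2::real)"
proof -
  have "(\<Sum>n<N. (1/2) ^ n) = (2::real) - 2 * (1/2) ^ N" by (induction N) auto
  then show ?thesis by simp
qed

text \<open>For a rapidly converging sequence the sum of the increments \<open>|f\<^sub>n\<^sub>+\<^sub>1 - f\<^sub>n|\<close> has finite norm, hence is
  finite almost everywhere, and the sequence converges there. The increments are multiplied by a
  fixed unit vector so that Minkowski's inequality for vector-valued functions applies to them.\<close>

lemma Lp_complete: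
  fixes f :: "nat \<Rightarrow> real^'d::finite \<Rightarrow> complex^'m::finite"
  assumes f: "\<And>n. f n \<in> Lp p" and p: "p \<ge> 1"
    and fast: "\<And>n. Lp_norm p (\<lambda>x. f (Suc n) x - f n x) \<le> (1/2) ^ n"
  obtains g where "g \<in> Lp p" "(\<lambda>n. Lp_norm p (\<lambda>x. f n x - g x)) \<longlonglongrightarrow> 0"
proof -
  note [measurable] = Lp_measurable[OF f]
  obtain e :: "complex^'m" where e: "norm e = 1" using vector_choose_size[of 1] by auto
  define h :: "nat \<Rightarrow> real^'d \<Rightarrow> complex^'m"
    where "h n x = norm (f (Suc n) x - f n x) *\<^sub>R e" for n x
  have [measurable]: "h n \<in> borel_measurable lebesgue" for n unfolding h_def by measurable
  have h: "h n \<in> Lp p" for n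
    using Lp_diff[OF f[of "Suc n"] f[of n]] p by (auto simp: Lp_def h_def e)
  have hn: "Lp_norm p (h n) \<le> (1/2) ^ n" for n
    using fast[of n] by (simp add: Lp_norm_def h_def e)
  define S where "S N x = (\<Sum>n<N. h n x)" for N x
  have S: "S N \<in> Lp p" for N unfolding S_def using Lp_sum(1)[of "{..<N}" h p] h p by auto
  have SN: "Lp_norm p (S N) \<le> 2" for N
  proof -
    have "Lp_norm p (S N) \<le> (\<Sum>n<N. Lp_norm p (h n))"
      unfolding S_def using Lp_sum(2)[of "{..<N}" h p] h p by auto
    also have "\<dots> \<le> (\<Sum>n<N. (1/2) ^ n)" by (intro sum_mono hn)
    also have "\<dots> \<le> 2" by (rule sum_half_powers_le)
    finally show ?thesis .
  qed
  note [measurable] = Lp_measurable[OF S]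
  have nS: "norm (S N x) = (\<Sum>n<N. norm (f (Suc n) x - f n x))" for N x
    by (simp add: S_def h_def e sum_nonneg flip: scaleR_sum_left)
  have "(\<integral>\<^sup>+x. liminf (\<lambda>N. ennreal (norm (S N x) powr p)) \<partial>lebesgue)
      \<le> liminf (\<lambda>N. \<integral>\<^sup>+x. ennreal (norm (S N x) powr p) \<partial>lebesgue)"
    by (rule nn_integral_liminf) measurable
  also have "\<dots> \<le> ennreal (2 powr p)"
  proof (rule order_trans[OF Liminf_le_Limsup[OF sequentially_bot] Limsup_bounded],
      rule always_eventually, rule allI)
    fix N
    have "(\<integral>\<^sup>+x. ennreal (norm (S N x) powr p) \<partial>lebesgue) = ennreal (LINT x|lebesgue. norm (S N x) powr p)"
      by (intro nn_integral_eq_integral Lp_integrable S) auto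
    also have "\<dots> \<le> ennreal (2 powr p)"
      using SN[of N] p by (simp add: Lp_norm_le_iff ennreal_leI)
    finally show "(\<integral>\<^sup>+x. ennreal (norm (S N x) powr p) \<partial>lebesgue) \<le> ennreal (2 powr p)" .
  qed
  finally have fin: "(\<integral>\<^sup>+x. liminf (\<lambda>N. ennreal (norm (S N x) powr p)) \<partial>lebesgue) < \<infinity>"
    by (simp add: le_less_trans)
  have "AE x in lebesgue. liminf (\<lambda>N. ennreal (norm (S N x) powr p)) \<noteq> \<infinity>"
    by (rule nn_integral_noteq_infinite) (use fin in auto)
  then have conv: "AE x in lebesgue. convergent (\<lambda>n. f n x)"
  proof eventually_elim
    case (elim x)
    then obtain B where B: "B \<ge> 0" "liminf (\<lambda>N. ennreal (norm (S N x) powr p)) = ennreal B"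
      by (metis ennreal_cases infinity_ennreal_def)
    have "frequently (\<lambda>N. ennreal (norm (S N x) powr p) < ennreal (B + 1)) sequentially"
    proof (rule ccontr)
      assume "\<not> ?thesis"
      then have "\<forall>\<^sub>F N in sequentially. ennreal (B + 1) \<le> ennreal (norm (S N x) powr p)"
        by (simp add: not_frequently not_less)
      then have "ennreal (B + 1) \<le> liminf (\<lambda>N. ennreal (norm (S N x) powr p))"
        by (rule Liminf_bounded)
      then show False using B by simp
    qed
    have bd: "norm (S N x) powr p \<le> B + 1" for N
    proof -
      obtain M where M: "M \<ge> N" "ennreal (norm (S M x) powr p) < ennreal (B + 1)"
        using \<open>frequently _ _\<close> unfolding frequently_sequentially by blast
      have "norm (S N x) \<le> norm (S M x)"
        unfolding nS using M by (intro sum_mono2) auto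
      then have "norm (S N x) powr p \<le> norm (S M x) powr p" using p by (intro powr_mono2) auto
      also have "\<dots> \<le> B + 1" using M(2) B(1) by (simp add: ennreal_less_iff del: ennreal_plus)
      finally show ?thesis .
    qed
    have "norm (S N x) \<le> (B + 1) powr (1/p)" for N
      using powr_mono2[OF _ _ bd, of "1/p"] p by (simp add: powr_powr)
    then have "summable (\<lambda>n. norm (f (Suc n) x - f n x))"
      unfolding nS by (intro bounded_imp_summable[where B="(B + 1) powr (1/p)"])
        (auto simp: lessThan_Suc_atMost[symmetric] simp del: sum.lessThan_Suc)
    then have "summable (\<lambda>n. f (Suc n) x - f n x)" by (rule summable_norm_cancel)
    then have "convergent (\<lambda>N. \<Sum>n<N. f (Suc n) x - f n x)" by (simp add: summable_iff_convergent)
    then have "convergent (\<lambda>N. f N x - f 0 x)" by (simp add: sum_lessThan_telescope[of "\<lambda>n. f n x"])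
    then show ?case by (simp add: convergent_diff_const_right_iff)
  qed
  define g where "g x = lim (\<lambda>n. f n x)" for x
  have [measurable]: "g \<in> borel_measurable lebesgue"
    unfolding g_def by (rule borel_measurable_lim_metric) measurable
  have tail: "Lp_norm p (\<lambda>x. f (n + m) x - f n x) \<le> 2 * (1/2) ^ n" for n m
  proof -
    have "Lp_norm p (\<lambda>x. f (n + m) x - f n x) \<le> (1/2) ^ n * (\<Sum>k<m. (1/2) ^ k)"
    proof (induction m)
      case (Suc m)
      have "Lp_norm p (\<lambda>x. f (n + Suc m) x - f n x)
          \<le> Lp_norm p (\<lambda>x. f (n + Suc m) x - f (n + m) x) + Lp_norm p (\<lambda>x. f (n + m) x - f n x)"
        using f p by (intro Lp_norm_triangle_diff)
      then show ?case using Suc fast[of "n + m"] by (simp add: power_add algebra_simps)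
    qed simp
    also have "\<dots> \<le> (1/2) ^ n * 2"
      by (intro mult_left_mono sum_half_powers_le) simp
    finally show ?thesis by (simp add: mult.commute)
  qed
  have diff: "(\<lambda>x. g x - f n x) \<in> Lp p \<and> Lp_norm p (\<lambda>x. g x - f n x) \<le> 2 * (1/2) ^ n" for n
  proof -
    have lim: "AE x in lebesgue. (\<lambda>m. f (n + m) x - f n x) \<longlonglongrightarrow> g x - f n x"
      using conv
    proof eventually_elim
      case (elim x)
      then have "(\<lambda>m. f m x) \<longlonglongrightarrow> g x" unfolding g_def by (simp add: convergent_LIMSEQ_iff)
      then have "(\<lambda>m. f (n + m) x) \<longlonglongrightarrow> g x" using LIMSEQ_ignore_initial_segment[of _ _ n] by (simp add: add.commute)
      then show ?case by (intro tendsto_diff tendsto_const)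
    qed
    have mem: "(\<lambda>x. f (n + m) x - f n x) \<in> Lp p" for m using f p by (intro Lp_diff) auto
    show ?thesis
      using Lp_fatou_AE[OF mem _ _ _ tail lim] p by auto
  qed
  have "g \<in> Lp p" using Lp_add[OF conjunct1[OF diff[of 0]] f[of 0]] p by simp
  moreover have "(\<lambda>n. Lp_norm p (\<lambda>x. f n x - g x)) \<longlonglongrightarrow> 0"
  proof (rule Lim_null_comparison[OF always_eventually, rule_format])
    show "norm (Lp_norm p (\<lambda>x. f n x - g x)) \<le> 2 * (1/2) ^ n" for n
      using diff[of n] Lp_norm_minus_commute[of p "f n" g] by simp
    show "(\<lambda>n. 2 * (1/2) ^ n) \<longlonglongrightarrow> (0::real)"
      by (intro tendsto_mult_right_zero LIMSEQ_power_zero) auto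
  qed
  ultimately show ?thesis by (rule that)
qed

section \<open>Interpolation between exponents\<close>

text \<open>An exponent strictly beyond \<open>p\<close>, as seen from \<open>2\<close>, allows interpolation: \<open>r\<^sup>p\<close> is
  at most a small multiple of \<open>r\<^sup>q\<close> on one side of a threshold, and at most a multiple of
  \<open>r\<^sup>2\<close> on the other side.\<close>

lemma powr_interpolation:
  fixes p :: real
  assumes "1 < p"
  obtains q where "1 < q"
    "\<And>\<delta>. \<delta> > 0 \<Longrightarrow> \<exists>K\<ge>0. \<forall>r\<ge>0. r powr p \<le> K * r powr 2 + \<delta> * r powr q"
proof -
  consider "p < 2" | "p = 2" | "p > 2" by linarith
  then show ?thesis
  proof cases
    case 2
    show ?thesis
    proof (rule that[of 2])
      show "\<exists>K\<ge>0. \<forall>r\<ge>0. r powr p \<le> K * r powr 2 + \<delta> * r powr 2" if "\<delta> > 0" for \<delta> :: real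
        using that 2 by (intro exI[of _ 1]) auto
    qed simp
  next
    case 1
    define q where "q = (1 + p) / 2"
    have q: "1 < q" "q < p" using assms by (auto simp: q_def)
    show ?thesis
    proof (rule that[OF q(1)])
      fix \<delta> :: real assume d: "\<delta> > 0"
      define a where "a = \<delta> powr (1 / (p - q))"
      have a: "a > 0" "a powr (p - q) = \<delta>" using d q by (auto simp: a_def powr_powr)
      have "r powr p \<le> a powr (p - 2) * r powr 2 + \<delta> * r powr q" if "r \<ge> 0" for r
      proof (cases "r \<le> a")
        case True
        have "r powr p = r powr (p - q) * r powr q" by (simp flip: powr_add)
        also have "\<dots> \<le> a powr (p - q) * r powr q"
          using True that q by (intro mult_right_mono powr_mono2) auto
        finally show ?thesis using a by (simp add: add_increasing)
      next
        case False
        have "r powr p = r powr (p - 2) * r powr 2" by (simp flip: powr_add)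
        also have "\<dots> \<le> a powr (p - 2) * r powr 2"
          using False that 1 a by (intro mult_right_mono powr_mono2') auto
        finally show ?thesis using d by (simp add: add_increasing2)
      qed
      then show "\<exists>K\<ge>0. \<forall>r\<ge>0. r powr p \<le> K * r powr 2 + \<delta> * r powr q"
        by (intro exI[of _ "a powr (p - 2)"]) auto
    qed
  next
    case 3
    define q where "q = p + 1"
    have q: "1 < q" "p < q" using assms by (auto simp: q_def)
    show ?thesis
    proof (rule that[OF q(1)])
      fix \<delta> :: real assume d: "\<delta> > 0"
      define a where "a = 1 / \<delta>"
      have a: "a > 0" "a powr (p - q) = \<delta>" using d by (auto simp: a_def q_def powr_minus_divide)
      have "r powr p \<le> a powr (p - 2) * r powr 2 + \<delta> * r powr q" if "r \<ge> 0" for r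
      proof (cases "r \<le> a")
        case True
        have "r powr p = r powr (p - 2) * r powr 2" by (simp flip: powr_add)
        also have "\<dots> \<le> a powr (p - 2) * r powr 2"
          using True that 3 by (intro mult_right_mono powr_mono2) auto
        finally show ?thesis using d by (simp add: add_increasing2)
      next
        case False
        have "r powr p = r powr (p - q) * r powr q" by (simp flip: powr_add)
        also have "\<dots> \<le> a powr (p - q) * r powr q"
          using False that a q by (intro mult_right_mono powr_mono2') auto
        finally show ?thesis using a by (simp add: add_increasing)
      qed
      then show "\<exists>K\<ge>0. \<forall>r\<ge>0. r powr p \<le> K * r powr 2 + \<delta> * r powr q"
        by (intro exI[of _ "a powr (p - 2)"]) auto
    qed
  qed
qed

lemma Lp_interpolated_mem:
  fixes f :: "real^'d::finite \<Rightarrow> complex^'m::finite"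
  assumes q: "\<And>\<delta>. \<delta> > 0 \<Longrightarrow> \<exists>K\<ge>0. \<forall>r\<ge>0. r powr p \<le> K * r powr 2 + \<delta> * r powr q"
    and f: "f \<in> Lp 2" "f \<in> Lp q"
  shows "f \<in> Lp p"
proof -
  obtain K where K: "\<And>r. r \<ge> 0 \<Longrightarrow> r powr p \<le> K * r powr 2 + 1 * r powr q"
    using q[of 1] by auto
  show ?thesis
    by (rule Lp_dominated[of _ "\<lambda>x. K * norm (f x) powr 2 + 1 * norm (f x) powr q"])
      (use f K in \<open>auto intro!: Lp_measurable Bochner_Integration.integrable_add integrable_mult_right Lp_integrable simp del: powr_numeral\<close>)
qed

lemma Lp_interpolated_convergence:
  fixes f :: "'i \<Rightarrow> real^'d::finite \<Rightarrow> complex^'m::finite"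
  assumes q: "\<And>\<delta>. \<delta> > 0 \<Longrightarrow> \<exists>K\<ge>0. \<forall>r\<ge>0. r powr p \<le> K * r powr 2 + \<delta> * r powr q"
    and pq: "p > 0" "q > 0"
    and f: "\<forall>\<^sub>F i in F. f i \<in> Lp 2 \<inter> Lp q \<and> Lp_norm q (f i) \<le> C"
    and lim: "((\<lambda>i. Lp_norm 2 (f i)) \<longlongrightarrow> 0) F"
  shows "((\<lambda>i. Lp_norm p (f i)) \<longlongrightarrow> 0) F"
proof (rule Lp_tendsto_iff[OF pq(1), THEN iffD2], rule tendstoI)
  fix e :: real assume e: "e > 0"
  have "e / (2 * (\<bar>C\<bar> powr q + 1)) > 0" using e by (intro divide_pos_pos) (auto intro: add_nonneg_pos)
  then obtain K where K: "K \<ge> 0" "\<And>r. r \<ge> 0 \<Longrightarrow> r powr p \<le> K * r powr 2 + e / (2 * (\<bar>C\<bar> powr q + 1)) * r powr q"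
    using q by blast
  let ?d = "e / (2 * (\<bar>C\<bar> powr q + 1))"
  have "((\<lambda>i. LINT x|lebesgue. norm (f i x) powr 2) \<longlongrightarrow> 0) F"
    using lim Lp_tendsto_iff[of 2 f F] by simp
  then have "((\<lambda>i. K * (LINT x|lebesgue. norm (f i x) powr 2)) \<longlongrightarrow> 0) F"
    by (rule tendsto_mult_right_zero)
  then have "\<forall>\<^sub>F i in F. K * (LINT x|lebesgue. norm (f i x) powr 2) < e / 2"
    using e by (intro order_tendstoD) auto
  with f show "\<forall>\<^sub>F i in F. dist (LINT x|lebesgue. norm (f i x) powr p) 0 < e"
  proof eventually_elim
    case (elim i)
    have i2: "integrable lebesgue (\<lambda>x. norm (f i x) powr 2)"
      and iq: "integrable lebesgue (\<lambda>x. norm (f i x) powr q)" using elim(1) Lp_integrable by blast+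
    have "(LINT x|lebesgue. norm (f i x) powr p)
        \<le> (LINT x|lebesgue. K * norm (f i x) powr 2 + ?d * norm (f i x) powr q)"
      using Lp_interpolated_mem[OF q, of "f i"] elim(1)
      by (intro integral_mono[OF Lp_integrable Bochner_Integration.integrable_add[OF
            integrable_mult_right[OF i2] integrable_mult_right[OF iq]]] K) auto
    also have "\<dots> = K * (LINT x|lebesgue. norm (f i x) powr 2) + ?d * (LINT x|lebesgue. norm (f i x) powr q)"
      using i2 iq by (simp del: powr_numeral)
    also have "\<dots> \<le> K * (LINT x|lebesgue. norm (f i x) powr 2) + ?d * \<bar>C\<bar> powr q"
    proof -
      have "(LINT x|lebesgue. norm (f i x) powr q) \<le> \<bar>C\<bar> powr q"
        using elim(1) pq Lp_norm_le_iff[of q "\<bar>C\<bar>" "f i"] by auto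
      then show ?thesis
        using e by (intro add_left_mono mult_left_mono) (auto intro!: divide_nonneg_nonneg)
    qed
    also have "?d * \<bar>C\<bar> powr q \<le> e / 2"
    proof -
      have "\<bar>C\<bar> powr q + 1 > 0" by (intro add_nonneg_pos) auto
      then show ?thesis using e by (simp add: field_simps)
    qed
    finally have "(LINT x|lebesgue. norm (f i x) powr p) < e" using elim(2) by simp
    then show ?case by (simp add: dist_real_def integral_nonneg_AE)
  qed
qed

section \<open>Partial derivatives and continuously differentiable functions\<close>

definition C1 :: "(real^'d::finite \<Rightarrow> 'b::euclidean_space) set" where
  "C1 = {f. (\<forall>x. f differentiable at x) \<and> (\<forall>i. continuous_on UNIV (partial i f))}"

definition C1c :: "(real^'d::finite \<Rightarrow> 'b::euclidean_space) set" where
  "C1c = {f \<in> C1. \<exists>R. \<forall>x. norm x > R \<longrightarrow> f x = 0}"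

lemma partial_eqI: "(f has_derivative D) (at x) \<Longrightarrow> partial i f x = D (axis i 1)"
  unfolding partial_def by (metis frechet_derivative_at)

lemma has_derivative_partial:
  fixes f :: "real^'d::finite \<Rightarrow> 'b::real_normed_vector"
  assumes "f differentiable at x"
  shows "(f has_derivative (\<lambda>h. \<Sum>i\<in>UNIV. (h $ i) *\<^sub>R partial i f x)) (at x)"
proof -
  let ?D = "frechet_derivative f (at x)"
  have D: "(f has_derivative ?D) (at x)" using assms by (simp add: frechet_derivative_works)
  have "?D h = (\<Sum>i\<in>UNIV. (h $ i) *\<^sub>R partial i f x)" for h
  proof -
    interpret D: bounded_linear ?D using D by (rule has_derivative_bounded_linear)
    have "h = (\<Sum>i\<in>UNIV. (h $ i) *\<^sub>R axis i 1)"
      by (simp add: vec_eq_iff axis_def if_distrib[where f="\<lambda>t. _ * t"] cong: if_cong)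
    then have "?D h = ?D (\<Sum>i\<in>UNIV. (h $ i) *\<^sub>R axis i 1)" by simp
    then show ?thesis by (simp add: D.sum D.scale partial_def)
  qed
  then have "?D = (\<lambda>h. \<Sum>i\<in>UNIV. (h $ i) *\<^sub>R partial i f x)" by blast
  with D show ?thesis by simp
qed

lemma C1D:
  assumes "f \<in> C1"
  shows C1_differentiable: "f differentiable at x"
    and C1_partial_continuous: "continuous_on UNIV (partial i f)"
    and C1_continuous: "continuous_on UNIV f"
  using assms by (auto simp: C1_def intro!: continuous_at_imp_continuous_on differentiable_imp_continuous_within)

lemma C1cD:
  assumes "f \<in> C1c"
  shows C1c_C1: "f \<in> C1"
    and C1c_support: "\<exists>R. \<forall>x. norm x > R \<longrightarrow> f x = 0"
  using assms by (auto simp: C1c_def)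

lemmas C1c_differentiable = C1_differentiable[OF C1c_C1]
  and C1c_partial_continuous = C1_partial_continuous[OF C1c_C1]
  and C1c_continuous = C1_continuous[OF C1c_C1]

lemma C1I:
  assumes "\<And>x. (f has_derivative (\<lambda>h. \<Sum>i\<in>UNIV. (h $ i) *\<^sub>R g i x)) (at x)"
    and "\<And>i. continuous_on UNIV (g i)"
  shows "f \<in> C1" "partial i f = g i"
proof -
  have *: "partial i f = g i" for i
    using partial_eqI[OF assms(1)]
    by (auto simp: axis_def if_distrib[where f="\<lambda>t. t *\<^sub>R _"] cong: if_cong)
  show "partial i f = g i" by (rule *)
  show "f \<in> C1" unfolding C1_def using assms * by (auto intro: differentiableI)
qed

lemma C1_scaleR:
  fixes f :: "real^'d::finite \<Rightarrow> real" and g :: "real^'d \<Rightarrow> 'b::euclidean_space"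
  assumes f: "f \<in> C1" and g: "g \<in> C1"
  shows "(\<lambda>x. f x *\<^sub>R g x) \<in> C1"
    and "partial i (\<lambda>x. f x *\<^sub>R g x) = (\<lambda>x. partial i f x *\<^sub>R g x + f x *\<^sub>R partial i g x)"
proof -
  let ?p = "\<lambda>i x. partial i f x *\<^sub>R g x + f x *\<^sub>R partial i g x"
  have d: "((\<lambda>x. f x *\<^sub>R g x) has_derivative (\<lambda>h. \<Sum>i\<in>UNIV. (h $ i) *\<^sub>R ?p i x)) (at x)" for x
    using has_derivative_scaleR[OF has_derivative_partial has_derivative_partial, OF C1_differentiable[OF f] C1_differentiable[OF g], of x]
    by (simp add: scaleR_sum_left scaleR_sum_right scaleR_add_right sum.distrib add.commute mult.commute)
  have c: "continuous_on UNIV (?p i)" for i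
    by (intro continuous_intros C1_partial_continuous C1_continuous f g)
  show "(\<lambda>x. f x *\<^sub>R g x) \<in> C1" by (rule C1I(1)[OF d c])
  show "partial i (\<lambda>x. f x *\<^sub>R g x) = ?p i" by (rule C1I(2)[OF d c])
qed

lemma C1_inner:
  fixes g :: "real^'d::finite \<Rightarrow> 'b::euclidean_space"
  assumes g: "g \<in> C1"
  shows "(\<lambda>x. g x \<bullet> b) \<in> C1"
    and "partial i (\<lambda>x. g x \<bullet> b) = (\<lambda>x. partial i g x \<bullet> b)"
proof -
  let ?p = "\<lambda>i x. partial i g x \<bullet> b"
  have d: "((\<lambda>x. g x \<bullet> b) has_derivative (\<lambda>h. \<Sum>i\<in>UNIV. (h $ i) *\<^sub>R ?p i x)) (at x)" for x
    using has_derivative_inner_left[OF has_derivative_partial, OF C1_differentiable[OF g], of b x]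
    by (simp add: inner_sum_left)
  have c: "continuous_on UNIV (?p i)" for i
    by (intro continuous_intros C1_partial_continuous g)
  show "(\<lambda>x. g x \<bullet> b) \<in> C1" by (rule C1I(1)[OF d c])
  show "partial i (\<lambda>x. g x \<bullet> b) = ?p i" by (rule C1I(2)[OF d c])
qed

lemma C1c_scaleR:
  fixes f :: "real^'d::finite \<Rightarrow> real" and g :: "real^'d \<Rightarrow> 'b::euclidean_space"
  assumes "f \<in> C1" "g \<in> C1" "f \<in> C1c \<or> g \<in> C1c"
  shows "(\<lambda>x. f x *\<^sub>R g x) \<in> C1c"
  using assms C1_scaleR(1)[OF assms(1,2)] C1c_support[of f] C1c_support[of g] unfolding C1c_def
  by fastforce

lemma C1c_inner: "g \<in> C1c \<Longrightarrow> (\<lambda>x. g x \<bullet> b) \<in> C1c"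
  using C1_inner(1)[of g b] unfolding C1c_def by fastforce

lemma partial_vanishes:
  fixes f :: "real^'d::finite \<Rightarrow> 'b::real_normed_vector"
  assumes "\<forall>x. norm x > R \<longrightarrow> f x = 0"
  shows "\<forall>x. norm x > R \<longrightarrow> partial i f x = 0"
proof (intro allI impI)
  fix x :: "real^'d" assume x: "norm x > R"
  have "((\<lambda>x. 0) has_derivative (\<lambda>h. 0)) (at x)" by simp
  then have "(f has_derivative (\<lambda>h. 0)) (at x)"
  proof (rule has_derivative_transform_within_open)
    show "open {x :: real^'d. norm x > R}" by (intro open_Collect_less continuous_intros)
  qed (use assms x in auto)
  then show "partial i f x = 0" by (simp add: partial_eqI)
qed

lemma compact_support_iff:
  fixes f :: "real^'d::finite \<Rightarrow> 'b::real_normed_vector"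
  shows "compact (closure {x. f x \<noteq> 0}) \<longleftrightarrow> (\<exists>R. \<forall>x. norm x > R \<longrightarrow> f x = 0)"
proof -
  have "compact (closure {x. f x \<noteq> 0}) \<longleftrightarrow> bounded {x. f x \<noteq> 0}" by simp
  also have "\<dots> \<longleftrightarrow> (\<exists>R. \<forall>x. norm x > R \<longrightarrow> f x = 0)"
    unfolding bounded_iff by (metis (mono_tags) mem_Collect_eq not_le)
  finally show ?thesis .
qed

lemma smooth_differentiable: "smooth f \<Longrightarrow> f differentiable at x"
  unfolding smooth_def by (metis UNIV_I differentiable_on_def foldr_Nil id_apply)

lemma smooth_partial: "smooth f \<Longrightarrow> smooth (partial i f)"
  unfolding smooth_def
proof
  fix "is" assume "\<forall>is. foldr partial is f differentiable_on UNIV"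
  then have "foldr partial (is @ [i]) f differentiable_on UNIV" by blast
  then show "foldr partial is (partial i f) differentiable_on UNIV" by simp
qed

lemma Cc_infty_iff: "f \<in> Cc_infty \<longleftrightarrow> smooth f \<and> (\<exists>R. \<forall>x. norm x > R \<longrightarrow> f x = 0)"
  unfolding Cc_infty_def compact_support_iff by blast

lemma Cc_infty_partial: "f \<in> Cc_infty \<Longrightarrow> partial i f \<in> Cc_infty"
  unfolding Cc_infty_iff using partial_vanishes smooth_partial by blast

lemma Cc_infty_C1c: "f \<in> Cc_infty \<Longrightarrow> f \<in> C1c"
  unfolding Cc_infty_iff C1c_def C1_def
  by (auto intro!: smooth_differentiable continuous_at_imp_continuous_on
      differentiable_imp_continuous_within smooth_partial)

lemma compact_support_bounded:
  fixes f :: "real^'d::finite \<Rightarrow> 'b::real_normed_vector"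
  assumes c: "continuous_on UNIV f" and s: "\<forall>x. norm x > R \<longrightarrow> f x = 0"
  obtains B where "B > 0" "\<And>x. norm (f x) \<le> B"
proof -
  have "compact (f ` cball 0 R)"
    using c by (intro compact_continuous_image continuous_on_subset[OF c]) auto
  then obtain B where B: "B > 0" "\<And>x. x \<in> cball 0 R \<Longrightarrow> norm (f x) \<le> B"
    using compact_imp_bounded bounded_pos[of "f ` cball 0 R"] by auto
  have "norm (f x) \<le> B" for x
    using B s by (cases "norm x \<le> R") auto
  with B(1) show ?thesis by (rule that)
qed

lemma compact_support_uniformly_continuous:
  fixes f :: "real^'d::finite \<Rightarrow> 'b::real_normed_vector"
  assumes c: "continuous_on UNIV f" and s: "\<forall>x. norm x > R \<longrightarrow> f x = 0" and e: "e > 0"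
  obtains d where "d > 0" "\<And>x y. norm (x - y) < d \<Longrightarrow> norm (f x - f y) < e"
proof -
  have "uniformly_continuous_on (cball 0 (R + 1)) f"
    by (intro compact_uniformly_continuous continuous_on_subset[OF c]) auto
  then obtain d where d: "d > 0"
    "\<And>x y. x \<in> cball 0 (R + 1) \<Longrightarrow> y \<in> cball 0 (R + 1) \<Longrightarrow> dist y x < d \<Longrightarrow> dist (f y) (f x) < e"
    using e unfolding uniformly_continuous_on_def by metis
  have "norm (f x - f y) < e" if "norm (x - y) < min d 1" for x y
  proof (cases "norm x \<le> R + 1 \<and> norm y \<le> R + 1")
    case True
    then show ?thesis using d(2)[of y x] that by (simp add: dist_norm)
  next
    case False
    have "norm x \<le> norm y + norm (x - y)" by norm
    moreover have "norm y \<le> norm x + norm (x - y)" by norm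
    ultimately have "norm x > R" "norm y > R" using False that by auto
    then show ?thesis using s e by simp
  qed
  then show ?thesis using that[of "min d 1"] d(1) by simp
qed

section \<open>Convolution\<close>

definition locally_integrable :: "(real^'d::finite \<Rightarrow> 'b::euclidean_space) \<Rightarrow> bool" where
  "locally_integrable u \<longleftrightarrow> u \<in> borel_measurable lebesgue \<and>
    (\<forall>R. integrable lebesgue (\<lambda>x. indicator (cball 0 R) x *\<^sub>R u x))"

definition conv :: "(real^'d::finite \<Rightarrow> real) \<Rightarrow> (real^'d \<Rightarrow> 'b::euclidean_space) \<Rightarrow> real^'d \<Rightarrow> 'b" where
  "conv k u x = (LINT y|lebesgue. k (x - y) *\<^sub>R u y)"

lemma continuous_measurable_lebesgue:
  "continuous_on UNIV f \<Longrightarrow> f \<in> borel_measurable (lebesgue :: (real^'d::finite) measure)"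
  by (intro measurable_completion) (simp add: borel_measurable_continuous_onI)

lemma locally_integrable_mult:
  fixes u :: "real^'d::finite \<Rightarrow> 'b::euclidean_space"
  assumes u: "locally_integrable u" and c: "c \<in> borel_measurable lebesgue"
    and b: "\<And>y. \<bar>c y\<bar> \<le> B" and s: "\<And>y. norm y > R \<Longrightarrow> c y = 0"
  shows "integrable lebesgue (\<lambda>y. c y *\<^sub>R u y)"
    and "norm (LINT y|lebesgue. c y *\<^sub>R u y) \<le> B * (LINT y|lebesgue. norm (indicator (cball 0 R) y *\<^sub>R u y))"
proof -
  have int: "integrable lebesgue (\<lambda>x. indicator (cball 0 R) x *\<^sub>R u x)"
    using u by (simp add: locally_integrable_def)
  have [measurable]: "u \<in> borel_measurable lebesgue" using u by (simp add: locally_integrable_def)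
  have B: "B \<ge> 0" using b[of 0] by linarith
  have le: "norm (c y *\<^sub>R u y) \<le> B * norm (indicator (cball 0 R) y *\<^sub>R u y)" for y
    using b[of y] s[of y] B by (cases "norm y \<le> R") (auto intro: mult_right_mono)
  have intB: "integrable lebesgue (\<lambda>y. B * norm (indicator (cball 0 R) y *\<^sub>R u y))"
    using int by (intro integrable_mult_right integrable_norm)
  show i: "integrable lebesgue (\<lambda>y. c y *\<^sub>R u y)"
  proof (rule Bochner_Integration.integrable_bound[OF intB])
    show "(\<lambda>y. c y *\<^sub>R u y) \<in> borel_measurable lebesgue" using c by measurable
    show "AE y in lebesgue. norm (c y *\<^sub>R u y) \<le> norm (B * norm (indicator (cball 0 R) y *\<^sub>R u y))"
      using le B by auto
  qed
  have "norm (LINT y|lebesgue. c y *\<^sub>R u y) \<le> (LINT y|lebesgue. norm (c y *\<^sub>R u y))"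
    by (rule integral_norm_bound)
  also have "\<dots> \<le> (LINT y|lebesgue. B * norm (indicator (cball 0 R) y *\<^sub>R u y))"
    by (intro integral_mono integrable_norm i intB le)
  finally show "norm (LINT y|lebesgue. c y *\<^sub>R u y) \<le> B * (LINT y|lebesgue. norm (indicator (cball 0 R) y *\<^sub>R u y))"
    by simp
qed

lemma conv_integrable:
  fixes u :: "real^'d::finite \<Rightarrow> 'b::euclidean_space"
  assumes k: "continuous_on UNIV k" "\<forall>x. norm x > R \<longrightarrow> k x = 0" and u: "locally_integrable u"
  shows "integrable lebesgue (\<lambda>y. k (x - y) *\<^sub>R u y)"
proof -
  obtain B where B: "\<And>x. norm (k x) \<le> B" using compact_support_bounded[OF k] by metis
  have c: "continuous_on UNIV (\<lambda>y. k (x - y))"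
    by (rule continuous_on_compose2[OF k(1)]) (auto intro!: continuous_intros)
  show ?thesis
  proof (rule locally_integrable_mult(1)[OF u continuous_measurable_lebesgue[OF c]])
    show "\<bar>k (x - y)\<bar> \<le> B" for y using B[of "x - y"] by simp
    show "k (x - y) = 0" if "norm y > R + norm x" for y
    proof -
      have "norm y \<le> norm x + norm (x - y)" by norm
      then show ?thesis using that k(2) by simp
    qed
  qed
qed

text \<open>The partial derivatives of the kernel are uniformly continuous, so its linearization error is
  uniformly \<open>o(h)\<close> and supported in a fixed ball, on which \<open>u\<close> is integrable.\<close>

lemma conv_has_derivative:
  fixes u :: "real^'d::finite \<Rightarrow> 'b::euclidean_space"
  assumes k: "k \<in> C1c" and u: "locally_integrable u"
  shows "(conv k u has_derivative (\<lambda>h. \<Sum>i\<in>UNIV. (h $ i) *\<^sub>R conv (partial i k) u x)) (at x)"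
  unfolding has_derivative_at_alt
proof (intro conjI allI impI)
  show "bounded_linear (\<lambda>h. \<Sum>i\<in>UNIV. (h $ i) *\<^sub>R conv (partial i k) u x)"
    by (intro bounded_linear_sum bounded_linear_scaleR_const bounded_linear_vec_nth)
  fix e :: real assume e: "e > 0"
  obtain R where R: "\<forall>x. norm x > R \<longrightarrow> k x = 0" using C1c_support[OF k] by blast
  have pR: "\<forall>x. norm x > R \<longrightarrow> partial i k x = 0" for i using partial_vanishes[OF R] .
  define I where "I = (LINT y|lebesgue. norm (indicator (cball 0 (R + 1 + norm x)) y *\<^sub>R u y))"
  have I: "I \<ge> 0" unfolding I_def by (intro integral_nonneg_AE) auto
  define e' where "e' = e / ((I + 1) * CARD('d))"
  have e': "e' > 0" using e I by (auto simp: e'_def intro!: divide_pos_pos mult_pos_pos)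
  have "\<forall>i. \<exists>d>0. \<forall>x y. norm (x - y) < d \<longrightarrow> norm (partial i k x - partial i k y) < e'"
    using compact_support_uniformly_continuous[OF C1c_partial_continuous[OF k] pR e'] by metis
  then obtain d where d: "\<And>i. d i > 0"
    "\<And>i x y. norm (x - y) < d i \<Longrightarrow> norm (partial i k x - partial i k y) < e'" by metis
  define \<delta> where "\<delta> = min 1 (Min (range d))"
  have \<delta>: "\<delta> > 0" "\<delta> \<le> 1" "\<And>i. \<delta> \<le> d i" using d(1) by (auto simp: \<delta>_def min.coboundedI2)
  let ?D = "\<lambda>z h. \<Sum>i\<in>UNIV. (h $ i) *\<^sub>R partial i k z"
  have lin: "\<bar>k b - k a - ?D a (b - a)\<bar> \<le> norm (b - a) * (e' * CARD('d))" if ab: "norm (b - a) < \<delta>" for a b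
  proof -
    have "norm (k b - k a - ?D a (b - a)) \<le> norm (b - a) * (e' * CARD('d))"
    proof (rule differentiable_bound_linearization[where S="ball a \<delta>"])
      fix t :: real assume "t \<in> {0..1}"
      then have "norm (t *\<^sub>R (b - a)) \<le> norm (b - a)" by (auto intro: mult_left_le_one_le)
      then show "a + t *\<^sub>R (b - a) \<in> ball a \<delta>" using ab by (simp add: dist_norm)
    next
      fix z assume z: "z \<in> ball a \<delta>"
      show "(k has_derivative ?D z) (at z within ball a \<delta>)"
        using has_derivative_at_withinI[OF has_derivative_partial[OF C1c_differentiable[OF k]]] .
      show "onorm (?D z - ?D a) \<le> e' * CARD('d)"
      proof (rule onorm_bound)
        show "0 \<le> e' * CARD('d)" using e' by simp
        fix h :: "real^'d"
        have "norm ((?D z - ?D a) h) = norm (\<Sum>i\<in>UNIV. (h $ i) * (partial i k z - partial i k a))"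
          by (simp add: fun_diff_def sum_subtractf right_diff_distrib)
        also have "\<dots> \<le> (\<Sum>i::'d\<in>UNIV. norm h * e')"
        proof (rule sum_norm_le)
          fix i :: 'd
          have "norm (partial i k z - partial i k a) \<le> e'"
            using z \<delta>(3)[of i] d(2)[of z a i] by (simp add: dist_norm norm_minus_commute)
          then show "norm ((h $ i) * (partial i k z - partial i k a)) \<le> norm h * e'"
            unfolding norm_mult using component_le_norm_cart[of h i] by (intro mult_mono) auto
        qed
        finally show "norm ((?D z - ?D a) h) \<le> e' * CARD('d) * norm h" by (simp add: mult_ac)
      qed
    qed (use \<delta> in auto)
    then show ?thesis by simp
  qed
  have int: "integrable lebesgue (\<lambda>y. k (x - y) *\<^sub>R u y)" for x
    by (rule conv_integrable[OF C1c_continuous[OF k] R u])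
  have intp: "integrable lebesgue (\<lambda>y. partial i k (x - y) *\<^sub>R u y)" for x i
    by (rule conv_integrable[OF C1c_partial_continuous[OF k] pR u])
  have cont: "continuous_on UNIV (\<lambda>y. f (x - y))" if "continuous_on UNIV f" for f :: "real^'d \<Rightarrow> real" and x
    by (rule continuous_on_compose2[OF that]) (auto intro!: continuous_intros)
  show "\<exists>d>0. \<forall>z. norm (z - x) < d \<longrightarrow> norm (conv k u z - conv k u x
      - (\<Sum>i\<in>UNIV. ((z - x) $ i) *\<^sub>R conv (partial i k) u x)) \<le> e * norm (z - x)"
  proof (intro exI[of _ \<delta>] conjI allI impI \<delta>)
    fix z assume z: "norm (z - x) < \<delta>"
    define c where "c y = k (z - y) - k (x - y) - ?D (x - y) (z - x)" for y
    have "conv k u z - conv k u x - (\<Sum>i\<in>UNIV. ((z - x) $ i) *\<^sub>R conv (partial i k) u x)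
        = (LINT y|lebesgue. c y *\<^sub>R u y)"
      unfolding conv_def c_def scaleR_diff_left scaleR_sum_left real_scaleR_def
        scaleR_scaleR[symmetric]
      by (simp add: int intp Bochner_Integration.integral_diff Bochner_Integration.integrable_diff
          Bochner_Integration.integrable_sum del: scaleR_scaleR)
    moreover have "norm (LINT y|lebesgue. c y *\<^sub>R u y) \<le> (norm (z - x) * (e' * CARD('d))) * I"
      unfolding I_def
    proof (rule locally_integrable_mult(2)[OF u])
      have "continuous_on UNIV c" unfolding c_def
        by (intro continuous_intros cont C1c_continuous[OF k] C1c_partial_continuous[OF k])
      then show "c \<in> borel_measurable lebesgue" by (rule continuous_measurable_lebesgue)
      show "\<bar>c y\<bar> \<le> norm (z - x) * (e' * CARD('d))" for y
        using lin[of "z - y" "x - y"] z by (simp add: c_def)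
      show "c y = 0" if y: "norm y > R + 1 + norm x" for y
      proof -
        have "norm y \<le> norm x + norm (x - y)" by norm
        then have 1: "norm (x - y) > R + 1" using y by simp
        have "norm (x - y) \<le> norm (z - y) + norm (z - x)" by norm
        then have "norm (z - y) > R" using 1 z \<delta> by simp
        then show ?thesis using 1 R pR by (simp add: c_def)
      qed
    qed
    moreover have "(norm (z - x) * (e' * CARD('d))) * I \<le> e * norm (z - x)"
    proof -
      have "e' * CARD('d) = e / (I + 1)" by (simp add: e'_def)
      moreover have "e / (I + 1) * I \<le> e" using e I by (simp add: field_simps)
      ultimately have "e' * CARD('d) * I \<le> e" by simp
      then have "norm (z - x) * (e' * CARD('d) * I) \<le> norm (z - x) * e" by (intro mult_left_mono) auto
      then show ?thesis by (simp add: algebra_simps)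
    qed
    ultimately show "norm (conv k u z - conv k u x
      - (\<Sum>i\<in>UNIV. ((z - x) $ i) *\<^sub>R conv (partial i k) u x)) \<le> e * norm (z - x)" by simp
  qed
qed

lemma conv_partial:
  assumes "k \<in> C1c" "locally_integrable u"
  shows "partial i (conv k u) x = conv (partial i k) u x"
  unfolding partial_eqI[OF conv_has_derivative[OF assms]]
  by (simp add: axis_def if_distrib[where f="\<lambda>t. t *\<^sub>R _"] cong: if_cong)

lemma conv_differentiable: "k \<in> C1c \<Longrightarrow> locally_integrable u \<Longrightarrow> conv k u differentiable at x"
  using conv_has_derivative differentiable_def by blast

lemma conv_smooth:
  assumes k: "k \<in> Cc_infty" and u: "locally_integrable u"
  shows "smooth (conv k u)"
proof -
  have *: "foldr partial is k \<in> Cc_infty \<and> foldr partial is (conv k u) = conv (foldr partial is k) u" for "is"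
  proof (induction "is")
    case (Cons i "is")
    then show ?case using Cc_infty_partial Cc_infty_C1c conv_partial[OF _ u] by fastforce
  qed (use k in auto)
  show ?thesis unfolding smooth_def
    using * conv_differentiable[OF Cc_infty_C1c u] by (auto simp: differentiable_on_def)
qed

lemma conv_vanishes:
  fixes k :: "real^'d::finite \<Rightarrow> real"
  assumes "\<forall>x. norm x > R \<longrightarrow> k x = 0" "\<forall>x. norm x > S \<longrightarrow> u x = 0"
  shows "\<forall>x. norm x > R + S \<longrightarrow> conv k u x = 0"
proof (intro allI impI)
  fix x :: "real^'d" assume x: "norm x > R + S"
  have "k (x - y) *\<^sub>R u y = 0" for y
  proof (cases "norm y > S")
    case False
    have "norm x \<le> norm (x - y) + norm y" by norm
    then show ?thesis using x False assms by simp
  qed (use assms in simp)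
  then have "(\<lambda>y. k (x - y) *\<^sub>R u y) = (\<lambda>y. 0)" by blast
  then show "conv k u x = 0" unfolding conv_def by simp
qed

lemma conv_Cc_infty:
  assumes "k \<in> Cc_infty" "locally_integrable u" "\<forall>x. norm x > S \<longrightarrow> u x = 0"
  shows "conv k u \<in> Cc_infty"
  using conv_smooth[OF assms(1,2)] conv_vanishes[OF _ assms(3)] assms(1)
  unfolding Cc_infty_iff by blast

lemma continuous_locally_integrable:
  fixes u :: "real^'d::finite \<Rightarrow> 'b::euclidean_space"
  assumes "continuous_on UNIV u" shows "locally_integrable u"
  unfolding locally_integrable_def
proof (intro conjI allI)
  show "u \<in> borel_measurable lebesgue" by (rule continuous_measurable_lebesgue[OF assms])
  fix R
  have "integrable lborel (\<lambda>x. indicator (cball 0 R) x *\<^sub>R u x)"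
    using borel_integrable_compact[of "cball 0 R" u] continuous_on_subset[OF assms] by auto
  then show "integrable lebesgue (\<lambda>x. indicator (cball 0 R) x *\<^sub>R u x)"
    by (simp add: integrable_completion borel_measurable_integrable)
qed

section \<open>Smooth bump functions\<close>

text \<open>The flat functions \<open>t\<^sup>-\<^sup>k exp(-1/t)\<close> on the positive half-line; each derivative is a combination
  of two further ones.\<close>

definition flat :: "nat \<Rightarrow> real \<Rightarrow> real" where
  "flat k t = (if t > 0 then exp (- (1 / t)) / t ^ k else 0)"

lemma flat_nonneg: "flat k t \<ge> 0"
  by (simp add: flat_def)

lemma flat_tendsto_0: "(flat k \<longlongrightarrow> 0) (at 0)"
proof -
  have "((\<lambda>s. s ^ k / exp s) \<longlongrightarrow> (0::real)) at_top" by (rule tendsto_power_div_exp_0)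
  then have "((\<lambda>t. (inverse t) ^ k / exp (inverse t)) \<longlongrightarrow> (0::real)) (at_right 0)"
    by (rule filterlim_compose) (rule filterlim_inverse_at_top_right)
  then have "(flat k \<longlongrightarrow> 0) (at_right 0)"
  proof (rule Lim_transform_eventually)
    show "\<forall>\<^sub>F t in at_right 0. inverse t ^ k / exp (inverse t) = flat k t"
      unfolding eventually_at_right_field
      by (intro exI[of _ 1]) (auto simp: flat_def exp_minus field_simps)
  qed
  moreover have "(flat k \<longlongrightarrow> 0) (at_left 0)"
    by (rule tendsto_eventually) (auto simp: eventually_at_left_field flat_def intro!: exI[of _ "-1"])
  ultimately show ?thesis by (simp add: filterlim_at_split)
qed

lemma flat_DERIV:
  "(flat k has_real_derivative flat (k + 2) t - real k * flat (k + 1) t) (at t)"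
proof -
  consider "t > 0" | "t < 0" | "t = 0" by linarith
  then show ?thesis
  proof cases
    case 1
    have "((\<lambda>t. exp (- (1 / t)) / t ^ k) has_real_derivative flat (k + 2) t - real k * flat (k + 1) t) (at t)"
    proof -
      have "((\<lambda>t. exp (- (1 / t)) / t ^ k) has_real_derivative
          (exp (- (1 / t)) * (1 / t^2) * t ^ k - exp (- (1 / t)) * (real k * t ^ (k - 1))) / (t ^ k * t ^ k)) (at t)"
        using 1 by (auto intro!: derivative_eq_intros simp: power2_eq_square)
      moreover have "(exp (- (1 / t)) * (1 / t^2) * t ^ k - exp (- (1 / t)) * (real k * t ^ (k - 1))) / (t ^ k * t ^ k)
          = flat (k + 2) t - real k * flat (k + 1) t"
        using 1 by (cases k) (auto simp: flat_def field_simps power2_eq_square)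
      ultimately show ?thesis by simp
    qed
    then show ?thesis
      by (rule has_field_derivative_transform_within_open[of _ _ _ "{0<..}"]) (use 1 in \<open>auto simp: flat_def\<close>)
  next
    case 2
    have "((\<lambda>t. 0) has_real_derivative 0) (at t)" by simp
    then have "(flat k has_real_derivative 0) (at t)"
      by (rule has_field_derivative_transform_within_open[of _ _ _ "{..<0}"]) (use 2 in \<open>auto simp: flat_def\<close>)
    then show ?thesis using 2 by (simp add: flat_def)
  next
    case 3
    have "(flat k has_real_derivative 0) (at 0)"
      unfolding has_field_derivative_iff
    proof (rule Lim_transform_eventually[OF flat_tendsto_0[of "k + 1"]])
      show "\<forall>\<^sub>F y in at 0. flat (k + 1) y = (flat k y - flat k 0) / (y - 0)"
        by (rule always_eventually) (simp add: flat_def)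
    qed
    then show ?thesis using 3 by (simp add: flat_def)
  qed
qed

text \<open>Rather than computing iterated derivatives of the bump function, it is placed in an
  algebra of functions that is closed under partial derivatives.\<close>

inductive_set flat_algebra :: "real \<Rightarrow> (real^'d::finite \<Rightarrow> real) set" for r where
  plus: "(\<lambda>x. flat k (r + x $ i)) \<in> flat_algebra r"
| minus: "(\<lambda>x. flat k (r - x $ i)) \<in> flat_algebra r"
| const: "(\<lambda>x. c) \<in> flat_algebra r"
| add: "f \<in> flat_algebra r \<Longrightarrow> g \<in> flat_algebra r \<Longrightarrow> (\<lambda>x. f x + g x) \<in> flat_algebra r"
| mult: "f \<in> flat_algebra r \<Longrightarrow> g \<in> flat_algebra r \<Longrightarrow> (\<lambda>x. f x * g x) \<in> flat_algebra r"

lemma flat_algebra_if: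
  "f \<in> flat_algebra r \<Longrightarrow> (\<lambda>x. if P then f x else 0) \<in> flat_algebra r"
  using flat_algebra.const[of 0 r] by (cases P) auto

lemma flat_algebra_derivative:
  fixes f :: "real^'d::finite \<Rightarrow> real"
  assumes "f \<in> flat_algebra r"
  shows "\<exists>g. (\<forall>i. g i \<in> flat_algebra r) \<and>
    (\<forall>x. (f has_derivative (\<lambda>h. \<Sum>i\<in>UNIV. (h $ i) * g i x)) (at x))"
  using assms
proof induction
  case (plus k i)
  let ?g = "\<lambda>j x. if j = i then flat (k + 2) (r + x $ i) + (- real k) * flat (k + 1) (r + x $ i) else 0"
  have "?g j \<in> flat_algebra r" for j
    by (intro flat_algebra_if flat_algebra.intros)
  moreover have "((\<lambda>x. flat k (r + x $ i)) has_derivative (\<lambda>h. \<Sum>j\<in>UNIV. (h $ j) * ?g j x)) (at x)" for x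
  proof -
    have "((\<lambda>x::real^'d. r + x $ i) has_derivative (\<lambda>h. h $ i)) (at x)"
      by (auto intro!: derivative_eq_intros bounded_linear_imp_has_derivative bounded_linear_vec_nth)
    from has_derivative_compose[OF this, OF flat_DERIV[of k, unfolded has_field_derivative_def]]
    show ?thesis by (simp add: if_distrib[where f="\<lambda>t. _ * t"] algebra_simps cong: if_cong)
  qed
  ultimately show ?case by (intro exI[of _ ?g] conjI allI)
next
  case (minus k i)
  let ?g = "\<lambda>j x. if j = i then (-1) * (flat (k + 2) (r - x $ i) + (- real k) * flat (k + 1) (r - x $ i)) else 0"
  have "?g j \<in> flat_algebra r" for j
    by (intro flat_algebra_if flat_algebra.intros)
  moreover have "((\<lambda>x. flat k (r - x $ i)) has_derivative (\<lambda>h. \<Sum>j\<in>UNIV. (h $ j) * ?g j x)) (at x)" for x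
  proof -
    have "((\<lambda>x::real^'d. r - x $ i) has_derivative (\<lambda>h. - (h $ i))) (at x)"
      by (auto intro!: derivative_eq_intros bounded_linear_imp_has_derivative bounded_linear_vec_nth)
    from has_derivative_compose[OF this, OF flat_DERIV[of k, unfolded has_field_derivative_def]]
    show ?thesis by (simp add: if_distrib[where f="\<lambda>t. _ * t"] algebra_simps cong: if_cong)
  qed
  ultimately show ?case by (intro exI[of _ ?g] conjI allI)
next
  case (const c)
  show ?case by (rule exI[of _ "\<lambda>i x. 0"]) (auto intro: flat_algebra.const)
next
  case (add f g)
  from add.IH(1) obtain f' where f': "\<And>i. f' i \<in> flat_algebra r"
      "\<And>x. (f has_derivative (\<lambda>h. \<Sum>i\<in>UNIV. (h $ i) * f' i x)) (at x)" by blast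
  from add.IH(2) obtain g' where g': "\<And>i. g' i \<in> flat_algebra r"
      "\<And>x. (g has_derivative (\<lambda>h. \<Sum>i\<in>UNIV. (h $ i) * g' i x)) (at x)" by blast
  show ?case
  proof (intro exI[of _ "\<lambda>i x. f' i x + g' i x"] conjI allI)
    show "(\<lambda>x. f' i x + g' i x) \<in> flat_algebra r" for i using f' g' by (intro flat_algebra.add)
    show "((\<lambda>x. f x + g x) has_derivative (\<lambda>h. \<Sum>i\<in>UNIV. (h $ i) * (f' i x + g' i x))) (at x)" for x
      using has_derivative_add[OF f'(2) g'(2), of x] by (simp add: distrib_left sum.distrib)
  qed
next
  case (mult f g)
  from mult.IH(1) obtain f' where f': "\<And>i. f' i \<in> flat_algebra r"
      "\<And>x. (f has_derivative (\<lambda>h. \<Sum>i\<in>UNIV. (h $ i) * f' i x)) (at x)" by blast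
  from mult.IH(2) obtain g' where g': "\<And>i. g' i \<in> flat_algebra r"
      "\<And>x. (g has_derivative (\<lambda>h. \<Sum>i\<in>UNIV. (h $ i) * g' i x)) (at x)" by blast
  show ?case
  proof (intro exI[of _ "\<lambda>i x. f x * g' i x + f' i x * g x"] conjI allI)
    show "(\<lambda>x. f x * g' i x + f' i x * g x) \<in> flat_algebra r" for i
      using f' g' mult by (intro flat_algebra.add flat_algebra.mult)
    show "((\<lambda>x. f x * g x) has_derivative (\<lambda>h. \<Sum>i\<in>UNIV. (h $ i) * (f x * g' i x + f' i x * g x))) (at x)" for x
      using has_derivative_mult[OF f'(2) g'(2), of x]
      by (simp add: distrib_left sum.distrib sum_distrib_left sum_distrib_right mult_ac)
  qed
qed

lemma flat_algebra_smooth: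
  fixes f :: "real^'d::finite \<Rightarrow> real"
  assumes "f \<in> flat_algebra r"
  shows "smooth f"
proof -
  have closed: "partial i g \<in> flat_algebra r" if g: "g \<in> flat_algebra r" for i and g :: "real^'d \<Rightarrow> real"
  proof -
    obtain g' where g': "\<And>i. g' i \<in> flat_algebra r"
      "\<And>x. (g has_derivative (\<lambda>h. \<Sum>i\<in>UNIV. (h $ i) * g' i x)) (at x)"
      using flat_algebra_derivative[OF g] by blast
    have "partial i g x = g' i x" for x
      unfolding partial_eqI[OF g'(2)]
      by (simp add: axis_def if_distrib[where f="\<lambda>t. t * _"] cong: if_cong)
    then have "partial i g = g' i" by blast
    then show ?thesis using g'(1) by simp
  qed
  have "foldr partial is f \<in> flat_algebra r" for "is"
    by (induction "is") (auto simp: assms closed)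
  then show ?thesis unfolding smooth_def differentiable_on_def
    using flat_algebra_derivative by (blast intro: differentiableI differentiable_at_withinI)
qed

text \<open>The product over all coordinates of \<open>flat 0 (r + x\<^sub>i) flat 0 (r - x\<^sub>i)\<close> is supported in a cube;
  the choice of \<open>r\<close> places the cube in the ball of radius \<open>\<epsilon>\<close>.\<close>

lemma mollifier_exists:
  assumes e: "\<epsilon> > 0"
  obtains \<rho> :: "real^'d::finite \<Rightarrow> real" where "\<rho> \<in> Cc_infty" "\<And>x. \<rho> x \<ge> 0"
    "(LINT x|lebesgue. \<rho> x) = 1" "\<forall>x. norm x > \<epsilon> \<longrightarrow> \<rho> x = 0"
proof -
  define r where "r = \<epsilon> / CARD('d)"
  have r: "r > 0" using e by (simp add: r_def)
  define b :: "real^'d \<Rightarrow> real" where "b x = (\<Prod>i\<in>UNIV. flat 0 (r + x $ i) * flat 0 (r - x $ i))" for x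
  have "(\<lambda>x. \<Prod>i\<in>A. flat 0 (r + x $ i) * flat 0 (r - x $ i)) \<in> flat_algebra r" if "finite A" for A :: "'d set"
    using that
  proof (induction A rule: finite_induct)
    case (insert i A)
    have "(\<lambda>x. \<Prod>j\<in>insert i A. flat 0 (r + x $ j) * flat 0 (r - x $ j))
        = (\<lambda>x::real^'d. (flat 0 (r + x $ i) * flat 0 (r - x $ i))
            * (\<Prod>j\<in>A. flat 0 (r + x $ j) * flat 0 (r - x $ j)))"
      using insert.hyps by simp
    then show ?case using insert.IH
      by (simp only:) (intro flat_algebra.intros)
  qed (simp add: flat_algebra.const)
  then have b: "b \<in> flat_algebra r" by (simp add: b_def[abs_def])
  have b0: "b x \<ge> 0" for x unfolding b_def by (intro prod_nonneg mult_nonneg_nonneg flat_nonneg)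
  have bs: "\<forall>x. norm x > \<epsilon> \<longrightarrow> b x = 0"
  proof (intro allI impI)
    fix x :: "real^'d" assume x: "norm x > \<epsilon>"
    have "\<exists>i. \<bar>x $ i\<bar> > r"
    proof (rule ccontr)
      assume "\<nexists>i. \<bar>x $ i\<bar> > r"
      then have "(\<Sum>i\<in>UNIV. \<bar>x $ i\<bar>) \<le> (\<Sum>i::'d\<in>UNIV. r)" by (intro sum_mono) (auto simp: not_less)
      then show False using norm_le_l1_cart[of x] x by (simp add: r_def)
    qed
    then obtain i where "\<bar>x $ i\<bar> > r" ..
    then have "flat 0 (r + x $ i) * flat 0 (r - x $ i) = 0" by (auto simp: flat_def)
    then show "b x = 0" unfolding b_def by (intro prod_zero) auto
  qed
  have bC: "b \<in> Cc_infty" using flat_algebra_smooth[OF b] bs by (auto simp: Cc_infty_iff)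
  have bc: "continuous_on UNIV b" using C1c_continuous[OF Cc_infty_C1c[OF bC]] .
  have bi: "integrable lebesgue b"
  proof -
    obtain B where B: "\<And>x. norm (b x) \<le> B" using compact_support_bounded[OF bc bs] by metis
    have "locally_integrable (\<lambda>_::real^'d. 1::real)" by (rule continuous_locally_integrable) simp
    from locally_integrable_mult(1)[OF this continuous_measurable_lebesgue[OF bc], of B \<epsilon>]
    show ?thesis using B bs by simp
  qed
  have "b 0 > 0" using r by (auto simp: b_def flat_def intro!: prod_pos)
  define I where "I = (LINT x|lebesgue. b x)"
  have "I \<noteq> 0"
  proof
    assume "I = 0"
    then have ae: "AE x in lebesgue. b x = 0"
      unfolding I_def using integral_nonneg_eq_0_iff_AE[OF bi] b0 by auto
    have "open {x. b x \<noteq> 0}" by (rule open_Collect_neq) (auto intro: bc continuous_intros)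
    moreover from this have "{x. b x \<noteq> 0} \<in> sets lebesgue" by (simp add: borel_open)
    then have "{x. b x \<noteq> 0} \<in> null_sets lebesgue" using ae by (simp add: AE_iff_null_sets)
    then have "negligible {x. b x \<noteq> 0}" by (simp add: negligible_iff_null_sets)
    ultimately have "{x. b x \<noteq> 0} = {}" using open_not_negligible by blast
    then show False using \<open>b 0 > 0\<close> by auto
  qed
  moreover have "I \<ge> 0" unfolding I_def by (intro integral_nonneg_AE) (auto simp: b0)
  ultimately have I: "I > 0" by simp
  show ?thesis
  proof (rule that[of "\<lambda>x. (1 / I) * b x"])
    have "(\<lambda>x. (1 / I) * b x) \<in> flat_algebra r" by (intro flat_algebra.intros b)
    then show "(\<lambda>x. (1 / I) * b x) \<in> Cc_infty"
      using flat_algebra_smooth bs by (auto simp: Cc_infty_iff)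
    show "(LINT x|lebesgue. (1 / I) * b x) = 1" using I by (simp add: I_def)
    show "0 \<le> (1 / I) * b x" for x using I b0 by simp
  qed (use bs in auto)
qed

section \<open>Integration by parts and mollifiers\<close>

lemma integral_reflect:
  fixes f :: "real^'d::finite \<Rightarrow> 'b::euclidean_space"
  assumes "f \<in> borel_measurable lebesgue"
  shows "(LINT y|lebesgue. f (x - y)) = (LINT y|lebesgue. f y)"
proof -
  have T: "(\<lambda>y. x + (\<Sum>j\<in>Basis. (- 1 * (y \<bullet> j)) *\<^sub>R j)) = (\<lambda>y. x - y)"
    using euclidean_representation[of "_ :: real^'d"] by (auto simp: sum_negf)
  have m: "(\<lambda>y. x - y) \<in> lebesgue \<rightarrow>\<^sub>M (lebesgue :: (real^'d) measure)"
    using lebesgue_affine_measurable[of "\<lambda>_. -1" x] unfolding T by simp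
  have "(lebesgue :: (real^'d) measure) = distr lebesgue lebesgue (\<lambda>y. x - y)"
    using lebesgue_affine_euclidean[of "\<lambda>_. -1" x] unfolding T by (simp add: density_1)
  then have "(LINT y|lebesgue. f y) = (LINT y|distr lebesgue lebesgue (\<lambda>y. x - y). f y)" by simp
  also have "\<dots> = (LINT y|lebesgue. f (x - y))" using integral_distr[OF m assms] .
  finally show ?thesis by simp
qed

lemma conv_commute:
  fixes f g :: "real^'d::finite \<Rightarrow> real"
  assumes "continuous_on UNIV f" "continuous_on UNIV g"
  shows "conv f g x = conv g f x"
proof -
  have "continuous_on UNIV (\<lambda>y. f (x - y))"
    by (rule continuous_on_compose2[OF assms(1)]) (auto intro!: continuous_intros)
  then have "continuous_on UNIV (\<lambda>y. f (x - y) * g y)" using assms by (intro continuous_intros)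
  from integral_reflect[OF continuous_measurable_lebesgue[OF this], of x]
  show ?thesis by (simp add: conv_def mult.commute)
qed

lemma conv_partial_right:
  fixes k f :: "real^'d::finite \<Rightarrow> real"
  assumes k: "k \<in> C1c" and f: "f \<in> C1c"
  shows "partial i (conv k f) x = conv k (partial i f) x"
proof -
  have "conv k f = conv f k"
    using conv_commute[OF C1c_continuous[OF k] C1c_continuous[OF f]] by blast
  then have "partial i (conv k f) x = conv (partial i f) k x"
    using conv_partial[OF f continuous_locally_integrable[OF C1c_continuous[OF k]]] by simp
  then show ?thesis
    using conv_commute[OF C1c_continuous[OF k] C1c_partial_continuous[OF f]] by simp
qed

text \<open>The convolution of \<open>f\<close> with the constant function \<open>1\<close> is constant, so its derivative,
  the integral of a partial derivative of \<open>f\<close>, vanishes.\<close>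

lemma integral_partial_eq_0:
  fixes f :: "real^'d::finite \<Rightarrow> real"
  assumes f: "f \<in> C1c"
  shows "(LINT x|lebesgue. partial i f x) = 0"
proof -
  have one: "locally_integrable (\<lambda>_::real^'d. 1::real)" by (rule continuous_locally_integrable) simp
  have "conv f (\<lambda>_. 1::real) = (\<lambda>x. LINT y|lebesgue. f y)"
    unfolding conv_def
    using integral_reflect[OF continuous_measurable_lebesgue[OF C1c_continuous[OF f]]] by auto
  then have "partial i (conv f (\<lambda>_. 1::real)) 0 = 0"
    by (simp add: partial_eqI[OF has_derivative_const])
  then have "conv (partial i f) (\<lambda>_. 1::real) 0 = 0" using conv_partial[OF f one] by simp
  then show ?thesis unfolding conv_def
    using integral_reflect[OF continuous_measurable_lebesgue[OF C1c_partial_continuous[OF f]], of i 0] by simp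
qed

lemma integrable_continuous_compact:
  fixes f :: "real^'d::finite \<Rightarrow> 'b::euclidean_space"
  assumes f: "continuous_on UNIV f" and s: "\<forall>x. norm x > R \<longrightarrow> f x = 0"
  shows "integrable lebesgue f"
proof -
  have "integrable lebesgue (\<lambda>x. indicator (cball 0 R) x *\<^sub>R f x)"
    using continuous_locally_integrable[OF f] by (simp add: locally_integrable_def)
  moreover have "(\<lambda>x. indicator (cball 0 R) x *\<^sub>R f x) = f"
    using s by (auto simp: indicator_def fun_eq_iff not_le)
  ultimately show ?thesis by simp
qed

lemma integration_by_parts:
  fixes f :: "real^'d::finite \<Rightarrow> real" and g :: "real^'d \<Rightarrow> 'b::euclidean_space"
  assumes f: "f \<in> C1c" and g: "g \<in> C1"
  shows "(LINT x|lebesgue. partial i f x *\<^sub>R g x) = - (LINT x|lebesgue. f x *\<^sub>R partial i g x)"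
proof -
  obtain R where R: "\<forall>x. norm x > R \<longrightarrow> f x = 0" using C1c_support[OF f] by blast
  have i1: "integrable lebesgue (\<lambda>x. partial i f x *\<^sub>R g x)"
    by (rule integrable_continuous_compact[of _ R])
      (use R partial_vanishes[OF R] in \<open>auto intro!: continuous_on_scaleR C1c_partial_continuous[OF f] C1_continuous[OF g]\<close>)
  have i2: "integrable lebesgue (\<lambda>x. f x *\<^sub>R partial i g x)"
    by (rule integrable_continuous_compact[of _ R])
      (use R in \<open>auto intro!: continuous_on_scaleR C1c_continuous[OF f] C1_partial_continuous[OF g]\<close>)
  have "((LINT x|lebesgue. partial i f x *\<^sub>R g x) + (LINT x|lebesgue. f x *\<^sub>R partial i g x)) \<bullet> b = 0" for b
  proof -
    have "(\<lambda>x. f x *\<^sub>R g x) \<in> C1c" using C1c_scaleR[OF C1c_C1[OF f] g] f by blast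
    from integral_partial_eq_0[OF C1c_inner[OF this, of b], of i]
    have "(LINT x|lebesgue. (partial i f x *\<^sub>R g x + f x *\<^sub>R partial i g x) \<bullet> b) = 0"
      using C1_inner(2)[OF C1_scaleR(1)[OF C1c_C1[OF f] g], of i b] C1_scaleR(2)[OF C1c_C1[OF f] g, of i] by simp
    then have "(LINT x|lebesgue. (partial i f x *\<^sub>R g x + f x *\<^sub>R partial i g x)) \<bullet> b = 0"
      using i1 i2 by (simp add: integral_inner_left)
    then show ?thesis using i1 i2 by simp
  qed
  then have "(LINT x|lebesgue. partial i f x *\<^sub>R g x) + (LINT x|lebesgue. f x *\<^sub>R partial i g x) = 0"
    by (metis inner_eq_zero_iff)
  then show ?thesis by (simp add: eq_neg_iff_add_eq_0)
qed

definition mollifier :: "real \<Rightarrow> (real^'d::finite \<Rightarrow> real) \<Rightarrow> bool" where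
  "mollifier \<epsilon> \<rho> \<longleftrightarrow> \<rho> \<in> Cc_infty \<and> (\<forall>x. \<rho> x \<ge> 0) \<and> (LINT x|lebesgue. \<rho> x) = 1 \<and>
    (\<forall>x. norm x > \<epsilon> \<longrightarrow> \<rho> x = 0)"

lemma mollifierD:
  assumes "mollifier \<epsilon> \<rho>"
  shows "\<rho> \<in> Cc_infty" "\<rho> \<in> C1c" "continuous_on UNIV \<rho>" "\<rho> x \<ge> 0" "(LINT x|lebesgue. \<rho> x) = 1"
    "\<forall>x. norm x > \<epsilon> \<longrightarrow> \<rho> x = 0"
  using assms Cc_infty_C1c C1c_continuous unfolding mollifier_def by blast+

lemma mollifier_shifted:
  fixes \<rho> :: "real^'d::finite \<Rightarrow> real"
  assumes \<rho>: "mollifier \<epsilon> \<rho>"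
  shows "integrable lebesgue (\<lambda>y. \<rho> (x - y))" "(LINT y|lebesgue. \<rho> (x - y)) = 1"
proof -
  have one: "locally_integrable (\<lambda>_::real^'d. 1::real)" by (rule continuous_locally_integrable) simp
  show "integrable lebesgue (\<lambda>y. \<rho> (x - y))"
    using conv_integrable[OF mollifierD(3,6)[OF \<rho>] one] by simp
  show "(LINT y|lebesgue. \<rho> (x - y)) = 1"
    using integral_reflect[OF continuous_measurable_lebesgue[OF mollifierD(3)[OF \<rho>]], of x]
      mollifierD(5)[OF \<rho>] by simp
qed

lemma mollify_uniform:
  fixes f :: "real^'d::finite \<Rightarrow> 'b::euclidean_space"
  assumes \<rho>: "mollifier \<epsilon> \<rho>" and f: "continuous_on UNIV f"
    and e: "\<And>x y. norm (x - y) \<le> \<epsilon> \<Longrightarrow> norm (f y - f x) \<le> e"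
  shows "norm (conv \<rho> f x - f x) \<le> e"
proof -
  have i: "integrable lebesgue (\<lambda>y. \<rho> (x - y) *\<^sub>R f y)"
    by (rule conv_integrable[OF mollifierD(3,6)[OF \<rho>] continuous_locally_integrable[OF f]])
  have i1: "integrable lebesgue (\<lambda>y. \<rho> (x - y) *\<^sub>R f x)"
    using mollifier_shifted(1)[OF \<rho>] by (rule integrable_scaleR_left)
  have "conv \<rho> f x - f x = (LINT y|lebesgue. \<rho> (x - y) *\<^sub>R f y) - (LINT y|lebesgue. \<rho> (x - y) *\<^sub>R f x)"
    using mollifier_shifted[OF \<rho>, of x] by (simp add: conv_def)
  also have "\<dots> = (LINT y|lebesgue. \<rho> (x - y) *\<^sub>R (f y - f x))"
    using i i1 by (simp add: scaleR_diff_right)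
  also have "norm \<dots> \<le> (LINT y|lebesgue. norm (\<rho> (x - y) *\<^sub>R (f y - f x)))"
    by (rule integral_norm_bound)
  also have "\<dots> \<le> (LINT y|lebesgue. \<rho> (x - y) * e)"
  proof (rule integral_mono)
    show "integrable lebesgue (\<lambda>y. norm (\<rho> (x - y) *\<^sub>R (f y - f x)))"
      using i i1 by (auto intro!: integrable_norm simp: scaleR_diff_right)
    show "integrable lebesgue (\<lambda>y. \<rho> (x - y) * e)"
      using mollifier_shifted(1)[OF \<rho>] by (rule integrable_mult_left)
    show "norm (\<rho> (x - y) *\<^sub>R (f y - f x)) \<le> \<rho> (x - y) * e" for y
      using e[of x y] mollifierD(4,6)[OF \<rho>] by (cases "norm (x - y) \<le> \<epsilon>") (auto intro: mult_left_mono)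
  qed
  also have "\<dots> = e" using mollifier_shifted[OF \<rho>, of x] by simp
  finally show ?thesis .
qed

text \<open>Uniform convergence of the function and of its gradient, with supports in a common ball: this is
  what a distribution of order one needs.\<close>

lemma C1c_approx_Cc_infty:
  fixes f :: "real^'d::finite \<Rightarrow> real"
  assumes f: "f \<in> C1c" and R: "\<forall>x. norm x > R \<longrightarrow> f x = 0" and e: "e > 0"
  obtains g where "g \<in> Cc_infty" "\<forall>x. norm x > R + 1 \<longrightarrow> g x = 0"
    "\<And>x. \<bar>g x - f x\<bar> \<le> e" "\<And>i x. \<bar>partial i g x - partial i f x\<bar> \<le> e"
proof -
  obtain d0 where d0: "d0 > 0" "\<And>x y. norm (x - y) < d0 \<Longrightarrow> norm (f x - f y) < e"
    using compact_support_uniformly_continuous[OF C1c_continuous[OF f] R e] by metis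
  have "\<forall>i. \<exists>d>0. \<forall>x y. norm (x - y) < d \<longrightarrow> norm (partial i f x - partial i f y) < e"
    using compact_support_uniformly_continuous[OF C1c_partial_continuous[OF f] partial_vanishes[OF R] e] by metis
  then obtain d where d: "\<And>i. d i > 0"
    "\<And>i x y. norm (x - y) < d i \<Longrightarrow> norm (partial i f x - partial i f y) < e" by metis
  define \<delta> where "\<delta> = min (min 1 d0) (Min (range d)) / 2"
  have pos: "min (min 1 d0) (Min (range d)) > 0" using d(1) d0(1) by auto
  have \<delta>: "\<delta> > 0" "\<delta> \<le> 1" "\<delta> < d0" "\<And>i. \<delta> < d i"
  proof -
    show "\<delta> > 0" using pos by (simp add: \<delta>_def)
    have lt: "\<delta> < min (min 1 d0) (Min (range d))" using pos unfolding \<delta>_def by linarith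
    then show "\<delta> \<le> 1" "\<delta> < d0" by auto
    show "\<delta> < d i" for i using lt by auto
  qed
  obtain \<rho> :: "real^'d \<Rightarrow> real" where \<rho>: "mollifier \<delta> \<rho>"
    unfolding mollifier_def using mollifier_exists[OF \<delta>(1)] by metis
  show ?thesis
  proof (rule that[of "conv \<rho> f"])
    show "conv \<rho> f \<in> Cc_infty"
      by (rule conv_Cc_infty[OF mollifierD(1)[OF \<rho>] continuous_locally_integrable[OF C1c_continuous[OF f]] R])
    show "\<forall>x. norm x > R + 1 \<longrightarrow> conv \<rho> f x = 0"
      using conv_vanishes[OF mollifierD(6)[OF \<rho>] R] \<delta>(2) by auto
    show "\<bar>conv \<rho> f x - f x\<bar> \<le> e" for x
      using mollify_uniform[OF \<rho> C1c_continuous[OF f], where e=e and x=x] d0(2) \<delta>(3)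
      by (smt (verit) norm_minus_commute real_norm_def)
    show "\<bar>partial i (conv \<rho> f) x - partial i f x\<bar> \<le> e" for i x
      unfolding conv_partial_right[OF mollifierD(2)[OF \<rho>] f]
      using mollify_uniform[OF \<rho> C1c_partial_continuous[OF f], where e=e and x=x] d(2) \<delta>(4)
      by (smt (verit) norm_minus_commute real_norm_def)
  qed
qed

lemma smooth_reflect:
  fixes f :: "real^'d::finite \<Rightarrow> real"
  assumes "smooth f"
  shows "smooth (\<lambda>y. f (x - y))"
    and "partial i (\<lambda>y. f (x - y)) = (\<lambda>y. - partial i f (x - y))"
proof -
  have d: "((\<lambda>y. c * g (x - y)) has_derivative (\<lambda>h. \<Sum>i\<in>UNIV. (h $ i) *\<^sub>R (- c * partial i g (x - y)))) (at y)"
    if g: "g differentiable at (x - y)" for g :: "real^'d \<Rightarrow> real" and y c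
  proof -
    have "((\<lambda>y. x - y) has_derivative (\<lambda>h. - h)) (at y)" by (auto intro!: derivative_eq_intros)
    from has_derivative_mult_right[OF has_derivative_compose[OF this has_derivative_partial[OF g]], of c]
    show ?thesis by (simp add: sum_negf sum_distrib_left mult_ac)
  qed
  have p: "partial i (\<lambda>y. c * g (x - y)) = (\<lambda>y. - c * partial i g (x - y))"
    if "\<And>z. g differentiable at z" for g :: "real^'d \<Rightarrow> real" and i c
    using partial_eqI[OF d[OF that]]
    by (auto simp: axis_def sum_negf if_distrib[where f="\<lambda>t. t * _"] cong: if_cong)
  have *: "smooth (foldr partial is f) \<and>
      foldr partial is (\<lambda>y. f (x - y)) = (\<lambda>y. (-1) ^ length is * foldr partial is f (x - y))" for "is"
  proof (induction "is")
    case (Cons i "is")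
    then show ?case using p[of "foldr partial is f" i "(-1) ^ length is"]
      by (auto simp: smooth_partial smooth_differentiable)
  qed (use assms in auto)
  have "foldr partial is (\<lambda>y. f (x - y)) differentiable (at y)" for "is" y
  proof -
    let ?g = "foldr partial is f"
    have "?g differentiable at (x - y)" using * smooth_differentiable by blast
    from differentiableI[OF d[OF this, of "(-1) ^ length is"]] show ?thesis using * by simp
  qed
  then show "smooth (\<lambda>y. f (x - y))"
    unfolding smooth_def by (auto simp: differentiable_on_def intro: differentiable_at_withinI)
  show "partial i (\<lambda>y. f (x - y)) = (\<lambda>y. - partial i f (x - y))"
    using p[of f i 1] smooth_differentiable[OF assms] by simp
qed

lemma Cc_infty_reflect:
  fixes f :: "real^'d::finite \<Rightarrow> real"
  assumes "f \<in> Cc_infty"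
  shows "(\<lambda>y. f (x - y)) \<in> Cc_infty"
proof -
  obtain R where R: "\<forall>x. norm x > R \<longrightarrow> f x = 0" using assms by (auto simp: Cc_infty_iff)
  have "f (x - y) = 0" if "norm y > R + norm x" for y
  proof -
    have "norm y \<le> norm x + norm (x - y)" by norm
    then show ?thesis using R that by simp
  qed
  then show ?thesis using assms smooth_reflect(1) by (auto simp: Cc_infty_iff)
qed

section \<open>Mollification in the space of square integrable functions\<close>

lemma integral_cauchy_schwarz:
  fixes f g :: "'a \<Rightarrow> real"
  assumes [measurable]: "f \<in> borel_measurable M" "g \<in> borel_measurable M"
    and f: "integrable M (\<lambda>x. (f x)\<^sup>2)" and g: "integrable M (\<lambda>x. (g x)\<^sup>2)"
  shows "integrable M (\<lambda>x. f x * g x)"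
    and "(LINT x|M. f x * g x) \<le> sqrt (LINT x|M. (f x)\<^sup>2) * sqrt (LINT x|M. (g x)\<^sup>2)"
proof -
  show fg: "integrable M (\<lambda>x. f x * g x)"
  proof (rule Bochner_Integration.integrable_bound[OF Bochner_Integration.integrable_add[OF f g]])
    show "AE x in M. norm (f x * g x) \<le> norm ((f x)\<^sup>2 + (g x)\<^sup>2)"
    proof (rule AE_I2)
      fix x
      have "2 * (\<bar>f x\<bar> * \<bar>g x\<bar>) \<le> (f x)\<^sup>2 + (g x)\<^sup>2"
        using sum_squares_bound[of "\<bar>f x\<bar>" "\<bar>g x\<bar>"] by (simp add: mult.assoc)
      moreover have "\<bar>f x\<bar> * \<bar>g x\<bar> \<ge> 0" by simp
      ultimately have "\<bar>f x\<bar> * \<bar>g x\<bar> \<le> (f x)\<^sup>2 + (g x)\<^sup>2" by linarith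
      then show "norm (f x * g x) \<le> norm ((f x)\<^sup>2 + (g x)\<^sup>2)" by (simp add: abs_mult)
    qed
  qed measurable
  let ?A = "LINT x|M. (f x)\<^sup>2" and ?B = "LINT x|M. f x * g x" and ?C = "LINT x|M. (g x)\<^sup>2"
  have A: "?A \<ge> 0" and C: "?C \<ge> 0" by (auto intro: integral_nonneg_AE)
  have quad: "0 \<le> ?A - 2 * t * ?B + t\<^sup>2 * ?C" for t
  proof -
    have "0 \<le> (LINT x|M. (f x - t * g x)\<^sup>2)" by (intro integral_nonneg_AE) auto
    also have "\<dots> = (LINT x|M. (f x)\<^sup>2 - 2 * t * (f x * g x) + t\<^sup>2 * (g x)\<^sup>2)"
      by (rule Bochner_Integration.integral_cong) (auto simp: power2_eq_square algebra_simps)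
    also have "\<dots> = ?A - 2 * t * ?B + t\<^sup>2 * ?C" using f g fg by simp
    finally show ?thesis .
  qed
  have "?B\<^sup>2 \<le> ?A * ?C"
  proof (cases "?C = 0")
    case True
    have "?B = 0"
    proof (rule ccontr)
      assume "?B \<noteq> 0"
      \<comment> \<open>at this value of \<open>t\<close> the affine function \<open>?A - 2 t ?B\<close> is negative\<close>
      then have "?A - 2 * ((?A + 1) / (2 * ?B)) * ?B = - 1" by (simp add: field_simps)
      then show False using quad[of "(?A + 1) / (2 * ?B)"] True by simp
    qed
    then show ?thesis using True by simp
  next
    case False
    then have "?C > 0" using C by linarith
    then have eq: "?A - 2 * (?B / ?C) * ?B + (?B / ?C)\<^sup>2 * ?C = ?A - ?B\<^sup>2 / ?C"
      by (simp add: field_simps power2_eq_square)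
    have "0 \<le> ?A - ?B\<^sup>2 / ?C" using quad[of "?B / ?C"] unfolding eq .
    then show ?thesis using \<open>?C > 0\<close> by (simp add: field_simps)
  qed
  then have "\<bar>?B\<bar> \<le> sqrt (?A * ?C)" by (metis real_sqrt_abs real_sqrt_le_iff)
  then show "?B \<le> sqrt ?A * sqrt ?C" by (simp add: real_sqrt_mult)
qed

lemma L2_integrable: "f \<in> Lp 2 \<Longrightarrow> integrable lebesgue (\<lambda>x. (norm (f x))\<^sup>2)"
  using Lp_integrable[of f 2] by simp

lemma L2_norm: "Lp_norm 2 f = sqrt (LINT x|lebesgue. (norm (f x))\<^sup>2)"
  by (simp add: Lp_norm_def powr_half_sqrt integral_nonneg_AE)

lemma L2_dominated:
  assumes "f \<in> borel_measurable lebesgue" "g \<in> Lp 2" "\<And>x. norm (f x) \<le> B * norm (g x)"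
  shows "f \<in> Lp 2"
proof (rule Lp_dominated[OF assms(1)])
  show "integrable lebesgue (\<lambda>x. B\<^sup>2 * (norm (g x))\<^sup>2)" using L2_integrable[OF assms(2)] by simp
  show "AE x in lebesgue. norm (f x) powr 2 \<le> B\<^sup>2 * (norm (g x))\<^sup>2"
    using power_mono[OF assms(3) norm_ge_zero, where n=2] by (simp add: power_mult_distrib)
qed

lemma L2_norm_product:
  fixes f :: "real^'d::finite \<Rightarrow> complex^'m::finite" and g :: "real^'d \<Rightarrow> complex^'n::finite"
  assumes f: "f \<in> Lp 2" and g: "g \<in> Lp 2"
  shows "integrable lebesgue (\<lambda>x. norm (f x) * norm (g x))"
    and "(LINT x|lebesgue. norm (f x) * norm (g x)) \<le> Lp_norm 2 f * Lp_norm 2 g"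
  using integral_cauchy_schwarz[of "\<lambda>x. norm (f x)" lebesgue "\<lambda>x. norm (g x)"] Lp_measurable[OF f]
    Lp_measurable[OF g] L2_integrable[OF f] L2_integrable[OF g] by (auto simp: L2_norm)

text \<open>Every error term below is dominated by a product of two square integrable functions.\<close>

lemma L2_bilinear_bound:
  fixes f g :: "real^'d::finite \<Rightarrow> complex^'m::finite" and h :: "real^'d \<Rightarrow> real"
  assumes f: "f \<in> Lp 2" and g: "g \<in> Lp 2" and h: "h \<in> borel_measurable lebesgue"
    and "B \<ge> 0" and b: "\<And>x. \<bar>h x\<bar> \<le> B * (norm (f x) * norm (g x))"
  shows "integrable lebesgue h"
    and "\<bar>LINT x|lebesgue. h x\<bar> \<le> B * (Lp_norm 2 f * Lp_norm 2 g)"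
proof -
  have B: "B * (norm (f x) * norm (g x)) \<ge> 0" for x using b[of x] by linarith
  have i: "integrable lebesgue (\<lambda>x. B * (norm (f x) * norm (g x)))"
    using L2_norm_product(1)[OF f g] by simp
  show h': "integrable lebesgue h"
    by (rule Bochner_Integration.integrable_bound[OF i h]) (use b B in auto)
  have "\<bar>LINT x|lebesgue. h x\<bar> \<le> (LINT x|lebesgue. \<bar>h x\<bar>)"
    using integral_norm_bound[of lebesgue h] by simp
  also have "\<dots> \<le> (LINT x|lebesgue. B * (norm (f x) * norm (g x)))"
    using h' i b by (intro integral_mono) auto
  also have "\<dots> = B * (LINT x|lebesgue. norm (f x) * norm (g x))" by simp
  also have "\<dots> \<le> B * (Lp_norm 2 f * Lp_norm 2 g)"
    using L2_norm_product(2)[OF f g] \<open>B \<ge> 0\<close> by (rule mult_left_mono)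
  finally show "\<bar>LINT x|lebesgue. h x\<bar> \<le> B * (Lp_norm 2 f * Lp_norm 2 g)" .
qed

lemma L2_local_bound:
  fixes f :: "real^'d::finite \<Rightarrow> complex^'m::finite"
  assumes f: "f \<in> Lp 2"
  shows "integrable lebesgue (\<lambda>x. indicator (cball 0 R) x *\<^sub>R f x)"
    and "(LINT x|lebesgue. norm (indicator (cball 0 R) x *\<^sub>R f x))
      \<le> sqrt (measure lebesgue (cball (0::real^'d) R)) * Lp_norm 2 f"
proof -
  have [measurable]: "f \<in> borel_measurable lebesgue" using Lp_measurable[OF f] .
  have i: "integrable lebesgue (\<lambda>x. (indicator (cball (0::real^'d) R) x)\<^sup>2 :: real)"
  proof -
    have "(\<lambda>x. (indicator (cball (0::real^'d) R) x)\<^sup>2 :: real) = indicator (cball (0::real^'d) R)"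
      by (auto simp: indicator_def fun_eq_iff)
    moreover have "integrable lebesgue (indicator (cball (0::real^'d) R) :: _ \<Rightarrow> real)"
      using lmeasurable_cball[of "0::real^'d" R] by (simp add: fmeasurable_def less_top[symmetric])
    ultimately show ?thesis by simp
  qed
  have eq: "(LINT x|lebesgue. (indicator (cball (0::real^'d) R) x)\<^sup>2 :: real) = measure lebesgue (cball (0::real^'d) R)"
  proof -
    have "(\<lambda>x. (indicator (cball (0::real^'d) R) x)\<^sup>2 :: real) = indicator (cball (0::real^'d) R)"
      by (auto simp: indicator_def fun_eq_iff)
    then show ?thesis by simp
  qed
  have m1: "(\<lambda>x. indicator (cball (0::real^'d) R) x :: real) \<in> borel_measurable lebesgue"
    by (simp add: borel_measurable_indicator)
  have m2: "(\<lambda>x. norm (f x)) \<in> borel_measurable lebesgue" by measurable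
  note cs = integral_cauchy_schwarz[OF m1 m2 i L2_integrable[OF f]]
  have n: "norm (indicator (cball 0 R) x *\<^sub>R f x) = indicator (cball 0 R) x * norm (f x)" for x by simp
  show "integrable lebesgue (\<lambda>x. indicator (cball 0 R) x *\<^sub>R f x)"
  proof (subst integrable_norm_iff[symmetric])
    show "integrable lebesgue (\<lambda>x. norm (indicator (cball 0 R) x *\<^sub>R f x))"
      unfolding n by (rule cs(1))
    show "(\<lambda>x. indicator (cball 0 R) x *\<^sub>R f x) \<in> borel_measurable lebesgue"
      using m1 by measurable
  qed
  show "(LINT x|lebesgue. norm (indicator (cball 0 R) x *\<^sub>R f x))
      \<le> sqrt (measure lebesgue (cball (0::real^'d) R)) * Lp_norm 2 f"
    unfolding n L2_norm using cs(2) eq by simp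
qed

lemma L2_locally_integrable: "f \<in> Lp 2 \<Longrightarrow> locally_integrable f"
  using L2_local_bound(1) Lp_measurable by (auto simp: locally_integrable_def)

lemma continuous_compact_Lp:
  fixes f :: "real^'d::finite \<Rightarrow> complex^'m::finite"
  assumes f: "continuous_on UNIV f" "\<forall>x. norm x > R \<longrightarrow> f x = 0" and p: "p > 0"
  shows "f \<in> Lp p"
proof -
  have "continuous_on UNIV (\<lambda>x. norm (f x) powr p)"
    using p by (intro continuous_on_powr' continuous_intros f) auto
  from integrable_continuous_compact[OF this, of R] f show ?thesis
    by (simp add: Lp_def continuous_measurable_lebesgue p)
qed

lemma Cc_infty_Lp: "f \<in> Cc_infty \<Longrightarrow> p > 0 \<Longrightarrow> f \<in> Lp p"
  using continuous_compact_Lp C1c_continuous[OF Cc_infty_C1c] C1c_support[OF Cc_infty_C1c] by metis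

lemma Lp_norm_uniform_bound:
  fixes f :: "real^'d::finite \<Rightarrow> complex^'m::finite"
  assumes f: "f \<in> Lp p" and s: "\<forall>x. norm x > R \<longrightarrow> f x = 0" and b: "\<And>x. norm (f x) \<le> B" and p: "p > 0"
  shows "Lp_norm p f \<le> B * measure lebesgue (cball (0::real^'d) R) powr (1 / p)"
proof -
  have B: "B \<ge> 0" using b[of 0] norm_ge_zero order_trans by blast
  have i: "integrable lebesgue (\<lambda>x. B powr p * indicator (cball (0::real^'d) R) x)"
    using lmeasurable_cball[of "0::real^'d" R] by (simp add: fmeasurable_def less_top[symmetric])
  have "(LINT x|lebesgue. norm (f x) powr p) \<le> (LINT x|lebesgue. B powr p * indicator (cball (0::real^'d) R) x)"
  proof (rule integral_mono[OF Lp_integrable[OF f] i])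
    show "norm (f x) powr p \<le> B powr p * indicator (cball 0 R) x" for x
      using b[of x] s p B by (cases "norm x \<le> R") (auto intro!: powr_mono2)
  qed
  also have "\<dots> = (B * measure lebesgue (cball (0::real^'d) R) powr (1 / p)) powr p"
    using p B by (simp add: powr_mult powr_powr)
  finally show ?thesis using p B by (subst Lp_norm_le_iff) auto
qed

text \<open>After truncation \<open>f\<close> is bounded by \<open>M\<close> and has bounded support. As a measurable function it is
  an almost everywhere limit of continuous functions; these are projected to the ball of radius
  \<open>M\<close> and cut off, which does not affect the limit but provides a dominating function.\<close>

lemma continuous_compact_dense:
  fixes f :: "real^'d::finite \<Rightarrow> complex^'m::finite"
  assumes f: "f \<in> Lp p" and p: "p \<ge> 1" and e: "e > 0"
  obtains g R where "continuous_on UNIV g" "\<forall>x. norm x > R \<longrightarrow> g x = 0" "Lp_norm p (\<lambda>x. f x - g x) < e"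
proof -
  have p0: "p > 0" using p by simp
  note [measurable] = Lp_measurable[OF f]
  define F where "F n x = (if norm x \<le> real n \<and> norm (f x) \<le> real n then f x else 0)" for n x
  have Fm[measurable]: "F n \<in> borel_measurable lebesgue" for n
  proof -
    have [measurable]: "(\<lambda>x::real^'d. norm x) \<in> borel_measurable lebesgue"
      by (rule continuous_measurable_lebesgue) (intro continuous_intros)
    show ?thesis unfolding F_def by measurable
  qed
  have FL: "F n \<in> Lp p" for n
    by (rule Lp_dominated[OF Fm Lp_integrable[OF f]]) (auto simp: F_def)
  have "(\<lambda>n. Lp_norm p (\<lambda>x. F n x - f x)) \<longlonglongrightarrow> 0"
  proof (rule Lp_dominated_convergence[OF _ Lp_integrable[OF f] p0])
    show "norm (F n x - f x) powr p \<le> norm (f x) powr p" for n x by (auto simp: F_def)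
    show "AE x in lebesgue. (\<lambda>n. F n x - f x) \<longlonglongrightarrow> 0"
    proof (rule AE_I2)
      fix x
      obtain N where N: "max (norm x) (norm (f x)) \<le> real N" using real_arch_simple by blast
      have "F n x - f x = 0" if "n \<ge> N" for n
        using N that by (auto simp: F_def)
      then show "(\<lambda>n. F n x - f x) \<longlonglongrightarrow> 0"
        by (intro tendsto_eventually) (auto simp: eventually_sequentially)
    qed
  qed measurable
  then have "\<forall>\<^sub>F n in sequentially. Lp_norm p (\<lambda>x. F n x - f x) < e / 2"
    using e by (intro order_tendstoD) auto
  then obtain n where n: "Lp_norm p (\<lambda>x. F n x - f x) < e / 2"
    by (auto simp: eventually_sequentially)
  define M where "M = real n + 1"
  have M: "M > 0" by (simp add: M_def)
  have Fb: "norm (F n x) \<le> M" for x by (auto simp: F_def M_def)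
  have "F n measurable_on UNIV" by (rule lebesgue_measurable_imp_measurable_on) auto
  then obtain N G where N: "negligible N" and G: "\<And>k. continuous_on UNIV (G k)"
    and lim: "\<And>x. x \<notin> N \<Longrightarrow> (\<lambda>k. G k x) \<longlonglongrightarrow> F n x"
    unfolding measurable_on_def by auto
  \<comment> \<open>the radial retraction onto the ball of radius \<open>M\<close>\<close>
  define \<tau> where "\<tau> v = (M / max M (norm v)) *\<^sub>R v" for v :: "complex^'m"
  have \<tau>c: "continuous_on UNIV \<tau>" unfolding \<tau>_def
    using M by (intro continuous_intros) (auto simp: max_def)
  have \<tau>b: "norm (\<tau> v) \<le> M" for v
    using M by (auto simp: \<tau>_def max_def field_simps intro: mult_left_mono)
  have \<tau>id: "\<tau> v = v" if "norm v \<le> M" for v using that M by (simp add: \<tau>_def max_def)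
  define cut where "cut x = max 0 (min 1 (M - norm x))" for x :: "real^'d"
  have cut_cont: "continuous_on UNIV cut" unfolding cut_def by (intro continuous_intros)
  define H where "H k x = cut x *\<^sub>R \<tau> (G k x)" for k x
  have Hc: "continuous_on UNIV (H k)" for k
    unfolding H_def by (intro continuous_on_scaleR cut_cont continuous_on_compose2[OF \<tau>c G]) auto
  have Hs: "\<forall>x. norm x > M \<longrightarrow> H k x = 0" for k by (auto simp: H_def cut_def)
  have HL: "H k \<in> Lp p" for k by (rule continuous_compact_Lp[OF Hc Hs p0])
  have Hb: "norm (H k x) \<le> M" for k x
  proof -
    have "norm (H k x) = cut x * norm (\<tau> (G k x))" by (simp add: H_def cut_def)
    also have "\<dots> \<le> 1 * M" using \<tau>b M by (intro mult_mono) (auto simp: cut_def)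
    finally show ?thesis by simp
  qed
  have FsM: "norm x > M \<Longrightarrow> F n x = 0" for x by (auto simp: F_def M_def)
  have "(\<lambda>k. Lp_norm p (\<lambda>x. H k x - F n x)) \<longlonglongrightarrow> 0"
  proof (rule Lp_dominated_convergence[OF _ _ p0])
    show "(\<lambda>x. H k x - F n x) \<in> borel_measurable lebesgue" for k
      using Lp_measurable[OF HL[of k]] by measurable
    show "integrable lebesgue (\<lambda>x. (2 * M) powr p * indicator (cball (0::real^'d) M) x)"
      using lmeasurable_cball[of "0::real^'d" M] by (simp add: fmeasurable_def less_top[symmetric])
    show "norm (H k x - F n x) powr p \<le> (2 * M) powr p * indicator (cball 0 M) x" for k x
    proof (cases "norm x \<le> M")
      case True
      have "norm (H k x - F n x) \<le> 2 * M"
        using norm_triangle_ineq4[of "H k x" "F n x"] Hb[of k x] Fb[of x] by simp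
      then show ?thesis using True p0 by (auto intro: powr_mono2)
    qed (use Hs FsM in auto)
    have "AE x in lebesgue. x \<notin> N"
      using N by (simp add: negligible_iff_null_sets AE_not_in)
    then show "AE x in lebesgue. (\<lambda>k. H k x - F n x) \<longlonglongrightarrow> 0"
    proof eventually_elim
      case (elim x)
      have "isCont \<tau> (F n x)" using \<tau>c by (simp add: continuous_on_eq_continuous_at)
      then have "(\<lambda>k. \<tau> (G k x)) \<longlonglongrightarrow> \<tau> (F n x)" using lim[OF elim] by (rule isCont_tendsto_compose)
      then have "(\<lambda>k. H k x) \<longlonglongrightarrow> cut x *\<^sub>R F n x"
        unfolding H_def using \<tau>id[OF Fb[of x]] by (auto intro!: tendsto_intros)
      moreover have "cut x *\<^sub>R F n x = F n x"
        by (auto simp: cut_def F_def M_def)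
      ultimately show ?case by (simp add: LIM_zero_iff)
    qed
  qed
  then have "\<forall>\<^sub>F k in sequentially. Lp_norm p (\<lambda>x. H k x - F n x) < e / 2"
    using e by (intro order_tendstoD) auto
  then obtain k where k: "Lp_norm p (\<lambda>x. H k x - F n x) < e / 2"
    by (auto simp: eventually_sequentially)
  have "Lp_norm p (\<lambda>x. f x - H k x) \<le> Lp_norm p (\<lambda>x. f x - F n x) + Lp_norm p (\<lambda>x. F n x - H k x)"
    using f FL HL p by (intro Lp_norm_triangle_diff)
  also have "\<dots> < e" using n k
    by (simp add: Lp_norm_minus_commute[of p f "F n"] Lp_norm_minus_commute[of p "F n" "H k"])
  finally show ?thesis by (rule that[OF Hc Hs])
qed

text \<open>For a probability density \<open>\<rho>(x - \<cdot>)\<close> the mean \<open>c = conv \<rho> f x\<close> satisfies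
  \<open>0 \<le> \<integral> \<rho>(x - y) |f(y) - c|\<^sup>2 dy = \<integral> \<rho>(x - y) |f(y)|\<^sup>2 dy - |c|\<^sup>2\<close>.\<close>

lemma mollify_jensen:
  fixes f :: "real^'d::finite \<Rightarrow> 'b::euclidean_space"
  assumes \<rho>: "mollifier \<epsilon> \<rho>" and f: "continuous_on UNIV f"
  shows "(norm (conv \<rho> f x))\<^sup>2 \<le> (LINT y|lebesgue. \<rho> (x - y) * (norm (f y))\<^sup>2)"
proof -
  let ?c = "conv \<rho> f x"
  have i: "integrable lebesgue (\<lambda>y. \<rho> (x - y) *\<^sub>R f y)"
    by (rule conv_integrable[OF mollifierD(3,6)[OF \<rho>] continuous_locally_integrable[OF f]])
  have ii: "integrable lebesgue (\<lambda>y. (\<rho> (x - y) *\<^sub>R f y) \<bullet> ?c)" using i by (rule integrable_inner_left)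
  have i2: "integrable lebesgue (\<lambda>y. \<rho> (x - y) * (norm (f y))\<^sup>2)"
    using conv_integrable[OF mollifierD(3,6)[OF \<rho>] continuous_locally_integrable[of "\<lambda>y. (norm (f y))\<^sup>2"]] f
    by (simp add: continuous_intros)
  have "0 \<le> (LINT y|lebesgue. \<rho> (x - y) * (norm (f y - ?c))\<^sup>2)"
    using mollifierD(4)[OF \<rho>] by (intro integral_nonneg_AE) auto
  also have "\<dots> = (LINT y|lebesgue. \<rho> (x - y) * (norm (f y))\<^sup>2 - 2 * ((\<rho> (x - y) *\<^sub>R f y) \<bullet> ?c) + \<rho> (x - y) * (norm ?c)\<^sup>2)"
    by (rule Bochner_Integration.integral_cong)
      (auto simp: power2_norm_eq_inner inner_diff_left inner_diff_right inner_commute algebra_simps)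
  also have "\<dots> = (LINT y|lebesgue. \<rho> (x - y) * (norm (f y))\<^sup>2) - 2 * (?c \<bullet> ?c) + (norm ?c)\<^sup>2"
    using i2 ii mollifier_shifted[OF \<rho>, of x] integral_inner_left[OF i, of ?c]
    by (simp add: conv_def)
  finally show ?thesis by (simp add: power2_norm_eq_inner)
qed

text \<open>Jensen's inequality and Fubini's theorem. For continuous functions the measurability of the
  integrand on the product space is immediate.\<close>

lemma mollify_L2_continuous:
  fixes f :: "real^'d::finite \<Rightarrow> complex^'m::finite"
  assumes \<rho>: "mollifier \<epsilon> \<rho>" and f: "continuous_on UNIV f" and s: "\<forall>x. norm x > R \<longrightarrow> f x = 0"
  shows "conv \<rho> f \<in> Lp 2" "Lp_norm 2 (conv \<rho> f) \<le> Lp_norm 2 f"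
proof -
  let ?K = "\<lambda>x y. \<rho> (x - y) * (norm (f y))\<^sup>2"
  have fL: "f \<in> Lp 2" using continuous_compact_Lp[OF f s] by simp
  have lf: "locally_integrable f" by (rule continuous_locally_integrable[OF f])
  have cc: "continuous_on UNIV (conv \<rho> f)"
    using conv_differentiable[OF mollifierD(2)[OF \<rho>] lf]
    by (auto intro!: continuous_at_imp_continuous_on differentiable_imp_continuous_within)
  show cL: "conv \<rho> f \<in> Lp 2"
    using continuous_compact_Lp[OF cc conv_vanishes[OF mollifierD(6)[OF \<rho>] s]] by simp
  have K0: "?K x y \<ge> 0" for x y using mollifierD(4)[OF \<rho>] by simp
  have Ki: "integrable lebesgue (\<lambda>y. ?K x y)" for x
    using conv_integrable[OF mollifierD(3,6)[OF \<rho>] continuous_locally_integrable[of "\<lambda>y. (norm (f y))\<^sup>2"]] f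
    by (simp add: continuous_intros)
  have c1: "continuous_on UNIV (\<lambda>z::(real^'d) \<times> (real^'d). \<rho> (fst z - snd z))"
    by (rule continuous_on_compose2[OF mollifierD(3)[OF \<rho>]]) (auto intro!: continuous_intros)
  have c2: "continuous_on UNIV (\<lambda>z::(real^'d) \<times> (real^'d). f (snd z))"
    by (rule continuous_on_compose2[OF f]) (auto intro!: continuous_intros)
  have cont: "continuous_on UNIV (\<lambda>z. ?K (fst z) (snd z))"
    by (intro continuous_on_mult continuous_on_power continuous_on_norm c1 c2)
  have "(\<lambda>z. ?K (fst z) (snd z)) \<in> borel_measurable (lborel \<Otimes>\<^sub>M lborel)"
    using borel_measurable_continuous_onI[OF cont] by (simp add: lborel_prod)
  then have Km: "(\<lambda>(x, y). ennreal (?K x y)) \<in> borel_measurable (lborel \<Otimes>\<^sub>M lborel)"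
    unfolding split_def by measurable
  have fub: "(\<integral>\<^sup>+x. (\<integral>\<^sup>+y. ennreal (?K x y) \<partial>lborel) \<partial>lborel) = (\<integral>\<^sup>+y. (\<integral>\<^sup>+x. ennreal (?K x y) \<partial>lborel) \<partial>lborel)"
    using lborel_pair.Fubini'[OF Km] by simp
  have inner: "(\<integral>\<^sup>+x. ennreal (?K x y) \<partial>lborel) = ennreal ((norm (f y))\<^sup>2)" for y
  proof -
    have r: "(LINT x|lebesgue. \<rho> (x - y)) = 1" "integrable lebesgue (\<lambda>x. \<rho> (x - y))"
    proof -
      have "continuous_on UNIV (\<lambda>x. \<rho> (x - y))"
        by (rule continuous_on_compose2[OF mollifierD(3)[OF \<rho>]]) (auto intro!: continuous_intros)
      moreover have "\<rho> (x - y) = 0" if "norm x > \<epsilon> + norm y" for x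
      proof -
        have "norm x \<le> norm (x - y) + norm y" by norm
        then show ?thesis using that mollifierD(6)[OF \<rho>] by simp
      qed
      ultimately show "integrable lebesgue (\<lambda>x. \<rho> (x - y))"
        by (intro integrable_continuous_compact) auto
      define \<sigma> where "\<sigma> x = \<rho> (- x)" for x
      have \<sigma>c: "continuous_on UNIV \<sigma>" unfolding \<sigma>_def
        by (rule continuous_on_compose2[OF mollifierD(3)[OF \<rho>]]) (auto intro!: continuous_intros)
      have "(LINT x|lebesgue. \<rho> (x - y)) = (LINT x|lebesgue. \<sigma> (y - x))" by (simp add: \<sigma>_def)
      also have "\<dots> = (LINT x|lebesgue. \<sigma> x)"
        by (rule integral_reflect[OF continuous_measurable_lebesgue[OF \<sigma>c]])
      also have "\<dots> = (LINT x|lebesgue. \<rho> (0 - x))" by (simp add: \<sigma>_def)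
      also have "\<dots> = 1" by (rule mollifier_shifted[OF \<rho>])
      finally show "(LINT x|lebesgue. \<rho> (x - y)) = 1" .
    qed
    have "(\<integral>\<^sup>+x. ennreal (?K x y) \<partial>lborel) = (\<integral>\<^sup>+x. ennreal (?K x y) \<partial>lebesgue)"
      by (simp add: nn_integral_completion)
    also have "\<dots> = ennreal (LINT x|lebesgue. ?K x y)"
      using K0 r(2) by (intro nn_integral_eq_integral) auto
    also have "(LINT x|lebesgue. ?K x y) = (norm (f y))\<^sup>2" using r by simp
    finally show ?thesis .
  qed
  have "ennreal (LINT x|lebesgue. (norm (conv \<rho> f x))\<^sup>2) = (\<integral>\<^sup>+x. ennreal ((norm (conv \<rho> f x))\<^sup>2) \<partial>lebesgue)"
    by (rule nn_integral_eq_integral[symmetric]) (use L2_integrable[OF cL] in auto)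
  also have "\<dots> \<le> (\<integral>\<^sup>+x. (\<integral>\<^sup>+y. ennreal (?K x y) \<partial>lebesgue) \<partial>lebesgue)"
  proof (rule nn_integral_mono)
    fix x
    have "ennreal ((norm (conv \<rho> f x))\<^sup>2) \<le> ennreal (LINT y|lebesgue. ?K x y)"
      using mollify_jensen[OF \<rho> f] by (rule ennreal_leI)
    also have "\<dots> = (\<integral>\<^sup>+y. ennreal (?K x y) \<partial>lebesgue)"
      by (rule nn_integral_eq_integral[symmetric]) (use Ki K0 in auto)
    finally show "ennreal ((norm (conv \<rho> f x))\<^sup>2) \<le> (\<integral>\<^sup>+y. ennreal (?K x y) \<partial>lebesgue)" .
  qed
  also have "\<dots> = (\<integral>\<^sup>+y. ennreal ((norm (f y))\<^sup>2) \<partial>lebesgue)"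
    unfolding nn_integral_completion fub inner ..
  also have "\<dots> = ennreal (LINT x|lebesgue. (norm (f x))\<^sup>2)"
    by (rule nn_integral_eq_integral) (use L2_integrable[OF fL] in auto)
  finally have "(LINT x|lebesgue. (norm (conv \<rho> f x))\<^sup>2) \<le> (LINT x|lebesgue. (norm (f x))\<^sup>2)"
    by (simp add: ennreal_le_iff integral_nonneg_AE)
  then show "Lp_norm 2 (conv \<rho> f) \<le> Lp_norm 2 f" by (simp add: L2_norm)
qed

lemma conv_continuous:
  assumes "k \<in> C1c" "locally_integrable u"
  shows "continuous_on UNIV (conv k u)"
  using conv_differentiable[OF assms]
  by (auto intro!: continuous_at_imp_continuous_on differentiable_imp_continuous_within)

lemma conv_diff:
  assumes "mollifier \<epsilon> \<rho>" "locally_integrable u" "locally_integrable v"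
  shows "conv \<rho> (\<lambda>y. u y - v y) x = conv \<rho> u x - conv \<rho> v x"
  unfolding conv_def
  using conv_integrable[OF mollifierD(3,6)[OF assms(1)] assms(2)]
    conv_integrable[OF mollifierD(3,6)[OF assms(1)] assms(3)] by (simp add: scaleR_diff_right)

text \<open>The contraction property extends from continuous functions to all of \<open>L\<^sup>2\<close> by Fatou's lemma,
  since \<open>conv \<rho> g\<^sub>n\<close> converges pointwise if \<open>g\<^sub>n\<close> converges in \<open>L\<^sup>2\<close>.\<close>

lemma mollify_L2:
  fixes f :: "real^'d::finite \<Rightarrow> complex^'m::finite"
  assumes \<rho>: "mollifier \<epsilon> \<rho>" and f: "f \<in> Lp 2"
  shows "conv \<rho> f \<in> Lp 2" "Lp_norm 2 (conv \<rho> f) \<le> Lp_norm 2 f"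
proof -
  have "conv \<rho> f \<in> Lp 2 \<and> Lp_norm 2 (conv \<rho> f) \<le> Lp_norm 2 f + e" if e: "e > 0" for e
  proof -
    have "\<exists>g. continuous_on UNIV g \<and> (\<exists>R. \<forall>x. norm x > R \<longrightarrow> g x = 0) \<and>
        Lp_norm 2 (\<lambda>x. f x - g x) < e / real (Suc n)" for n
    proof -
      have "e / real (Suc n) > 0" using e by simp
      from continuous_compact_dense[OF f _ this] obtain g R where "continuous_on UNIV g"
        "\<forall>x. norm x > R \<longrightarrow> g x = 0" "Lp_norm 2 (\<lambda>x. f x - g x) < e / real (Suc n)" by auto
      then show ?thesis by blast
    qed
    then obtain g where gc: "\<And>n. continuous_on UNIV (g n)" and gs: "\<And>n. \<exists>R. \<forall>x. norm x > R \<longrightarrow> g n x = 0"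
      and gn: "\<And>n. Lp_norm 2 (\<lambda>x. f x - g n x) < e / real (Suc n)" by metis
    have gL: "g n \<in> Lp 2" for n using continuous_compact_Lp[OF gc] gs[of n] by fastforce
    have mem: "conv \<rho> (g n) \<in> Lp 2" "Lp_norm 2 (conv \<rho> (g n)) \<le> Lp_norm 2 f + e" for n
    proof -
      obtain R where R: "\<forall>x. norm x > R \<longrightarrow> g n x = 0" using gs by blast
      show "conv \<rho> (g n) \<in> Lp 2" using mollify_L2_continuous[OF \<rho> gc R] by blast
      have "Lp_norm 2 (conv \<rho> (g n)) \<le> Lp_norm 2 (g n)" using mollify_L2_continuous[OF \<rho> gc R] by blast
      also have "\<dots> \<le> Lp_norm 2 f + Lp_norm 2 (\<lambda>x. g n x - f x)"
        using gL f by (intro Lp_norm_le_add_diff) auto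
      also have "\<dots> = Lp_norm 2 f + Lp_norm 2 (\<lambda>x. f x - g n x)"
        by (simp add: Lp_norm_minus_commute[of 2 f])
      also have "\<dots> \<le> Lp_norm 2 f + e"
      proof -
        have "e / real (Suc n) \<le> e" using e by (simp add: field_simps)
        then show ?thesis using gn[of n] by simp
      qed
      finally show "Lp_norm 2 (conv \<rho> (g n)) \<le> Lp_norm 2 f + e" .
    qed
    have lim: "(\<lambda>n. conv \<rho> (g n) x) \<longlonglongrightarrow> conv \<rho> f x" for x
    proof -
      obtain B where B: "B > 0" "\<And>x. norm (\<rho> x) \<le> B" using compact_support_bounded[OF mollifierD(3,6)[OF \<rho>]] by blast
      let ?R = "\<epsilon> + norm x"
      have c: "(\<lambda>y. \<rho> (x - y)) \<in> borel_measurable lebesgue"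
        by (intro continuous_measurable_lebesgue continuous_on_compose2[OF mollifierD(3)[OF \<rho>]] continuous_intros) auto
      have s: "\<rho> (x - y) = 0" if "norm y > ?R" for y
      proof -
        have "norm y \<le> norm x + norm (x - y)" by norm
        then show ?thesis using that mollifierD(6)[OF \<rho>] by simp
      qed
      have b1: "norm (conv \<rho> (g n) x - conv \<rho> f x)
          \<le> B * sqrt (measure lebesgue (cball (0::real^'d) ?R)) * (e / real (Suc n))" for n
      proof -
        have d: "(\<lambda>y. g n y - f y) \<in> Lp 2" using gL f by (intro Lp_diff) auto
        have "norm (conv \<rho> (g n) x - conv \<rho> f x) = norm (LINT y|lebesgue. \<rho> (x - y) *\<^sub>R (g n y - f y))"
          using conv_diff[OF \<rho> L2_locally_integrable[OF gL] L2_locally_integrable[OF f], of n x]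
          by (simp add: conv_def)
        also have "\<dots> \<le> B * (LINT y|lebesgue. norm (indicator (cball 0 ?R) y *\<^sub>R (g n y - f y)))"
          using locally_integrable_mult(2)[OF L2_locally_integrable[OF d] c, of B ?R] B(2) s by auto
        also have "\<dots> \<le> B * (sqrt (measure lebesgue (cball (0::real^'d) ?R)) * (e / real (Suc n)))"
        proof (rule mult_left_mono)
          have "Lp_norm 2 (\<lambda>y. g n y - f y) \<le> e / real (Suc n)"
            using gn[of n] by (simp add: Lp_norm_minus_commute[of 2 "g n"])
          then show "(LINT y|lebesgue. norm (indicator (cball 0 ?R) y *\<^sub>R (g n y - f y)))
              \<le> sqrt (measure lebesgue (cball (0::real^'d) ?R)) * (e / real (Suc n))"
            using L2_local_bound(2)[OF d, of ?R] by (meson measure_nonneg mult_left_mono order_trans real_sqrt_ge_zero)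
        qed (use B in simp)
        finally show ?thesis by simp
      qed
      have b2: "(\<lambda>n. B * sqrt (measure lebesgue (cball (0::real^'d) ?R)) * (e / real (Suc n))) \<longlonglongrightarrow> 0"
        by (intro tendsto_mult_right_zero LIMSEQ_Suc[OF lim_const_over_n])
      have "(\<lambda>n. conv \<rho> (g n) x - conv \<rho> f x) \<longlonglongrightarrow> 0"
        by (rule Lim_null_comparison[OF always_eventually[OF allI[OF b1]] b2])
      then show ?thesis by (simp add: LIM_zero_iff)
    qed
    have fm: "conv \<rho> f \<in> borel_measurable lebesgue"
      using continuous_measurable_lebesgue[OF conv_continuous[OF mollifierD(2)[OF \<rho>] L2_locally_integrable[OF f]]] .
    have "Lp_norm 2 f + e \<ge> 0" using e Lp_norm_nonneg[of 2 f] by linarith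
    then show ?thesis
      using Lp_fatou_AE[where f="\<lambda>n. conv \<rho> (g n)", OF mem(1) fm _ _ mem(2) AE_I2[OF lim]] by auto
  qed
  then show "conv \<rho> f \<in> Lp 2" "Lp_norm 2 (conv \<rho> f) \<le> Lp_norm 2 f"
    using zero_less_one by (blast, blast intro: field_le_epsilon)
qed

definition standard_mollifier :: "nat \<Rightarrow> real^'d::finite \<Rightarrow> real" where
  "standard_mollifier n = (SOME \<rho>. mollifier (1 / real (Suc n)) \<rho>)"

lemma standard_mollifier: "mollifier (1 / real (Suc n)) (standard_mollifier n :: real^'d::finite \<Rightarrow> real)"
proof -
  have "\<exists>\<rho> :: real^'d \<Rightarrow> real. mollifier (1 / real (Suc n)) \<rho>"
    using mollifier_exists[of "1 / real (Suc n)"] unfolding mollifier_def by (metis of_nat_0_less_iff zero_less_Suc zero_less_divide_1_iff)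
  then show ?thesis unfolding standard_mollifier_def by (rule someI_ex)
qed

lemma mollify_continuous_Lp:
  fixes f :: "real^'d::finite \<Rightarrow> complex^'m::finite"
  assumes f: "continuous_on UNIV f" and s: "\<forall>x. norm x > R \<longrightarrow> f x = 0"
  shows "(\<lambda>n. Lp_norm 2 (\<lambda>x. conv (standard_mollifier n) f x - f x)) \<longlonglongrightarrow> 0"
proof (rule LIMSEQ_I)
  fix e :: real assume e: "e > 0"
  define m where "m = measure lebesgue (cball (0::real^'d) (R + 1)) powr (1 / 2)"
  have m: "m \<ge> 0" by (simp add: m_def)
  define e' where "e' = e / (2 * (m + 1))"
  have e': "e' > 0" using e m by (simp add: e'_def)
  obtain d where d: "d > 0" "\<And>x y. norm (x - y) < d \<Longrightarrow> norm (f x - f y) < e'"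
    using compact_support_uniformly_continuous[OF f s e'] by metis
  obtain N where N: "1 / real (Suc N) < d" using nat_approx_posE[OF d(1)] by blast
  show "\<exists>N. \<forall>n\<ge>N. norm (Lp_norm 2 (\<lambda>x. conv (standard_mollifier n) f x - f x) - 0) < e"
  proof (intro exI[of _ N] allI impI)
    fix n assume n: "n \<ge> N"
    let ?\<rho> = "standard_mollifier n :: real^'d \<Rightarrow> real"
    have \<rho>: "mollifier (1 / real (Suc n)) ?\<rho>" by (rule standard_mollifier)
    have nd: "1 / real (Suc n) < d"
      using N n by (smt (verit) frac_le of_nat_0_less_iff of_nat_mono Suc_le_mono zero_less_Suc)
    have n1: "1 / real (Suc n) \<le> 1" by simp
    have unif: "norm (conv ?\<rho> f x - f x) \<le> e'" for x
    proof (rule mollify_uniform[OF \<rho> f])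
      fix x y :: "real^'d" assume "norm (x - y) \<le> 1 / real (Suc n)"
      then show "norm (f y - f x) \<le> e'" using d(2)[of x y] nd by (simp add: norm_minus_commute)
    qed
    have van: "\<forall>x. norm x > R + 1 \<longrightarrow> conv ?\<rho> f x - f x = 0"
    proof (intro allI impI)
      fix x :: "real^'d" assume x: "norm x > R + 1"
      then have "conv ?\<rho> f x = 0"
        using conv_vanishes[OF mollifierD(6)[OF \<rho>] s] n1 by (smt (verit))
      then show "conv ?\<rho> f x - f x = 0" using x s by simp
    qed
    have L: "(\<lambda>x. conv ?\<rho> f x - f x) \<in> Lp 2"
      using mollify_L2_continuous(1)[OF \<rho> f s] continuous_compact_Lp[OF f s] by (intro Lp_diff) auto
    have "Lp_norm 2 (\<lambda>x. conv ?\<rho> f x - f x) \<le> e' * m"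
      using Lp_norm_uniform_bound[OF L van unif] by (simp add: m_def)
    also have "\<dots> < e" using e m by (simp add: e'_def field_simps add_nonneg_pos)
    finally show "norm (Lp_norm 2 (\<lambda>x. conv ?\<rho> f x - f x) - 0) < e" by simp
  qed
qed

text \<open>As mollification is a contraction, it suffices to have convergence on a dense set.\<close>

lemma mollify_L2_tendsto:
  fixes f :: "real^'d::finite \<Rightarrow> complex^'m::finite"
  assumes f: "f \<in> Lp 2"
  shows "(\<lambda>n. Lp_norm 2 (\<lambda>x. conv (standard_mollifier n) f x - f x)) \<longlonglongrightarrow> 0"
proof (rule LIMSEQ_I)
  fix e :: real assume "e > 0"
  then have "e / 3 > 0" by simp
  from continuous_compact_dense[OF f _ this] obtain g R where g: "continuous_on UNIV g"
    "\<forall>x. norm x > R \<longrightarrow> g x = 0" "Lp_norm 2 (\<lambda>x. f x - g x) < e / 3" by auto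
  have gL: "g \<in> Lp 2" using continuous_compact_Lp[OF g(1,2)] by simp
  obtain N where N: "\<And>n. n \<ge> N \<Longrightarrow> Lp_norm 2 (\<lambda>x. conv (standard_mollifier n) g x - g x) < e / 3"
    using LIMSEQ_D[OF mollify_continuous_Lp[OF g(1,2)] \<open>e / 3 > 0\<close>] by auto
  show "\<exists>N. \<forall>n\<ge>N. norm (Lp_norm 2 (\<lambda>x. conv (standard_mollifier n) f x - f x) - 0) < e"
  proof (intro exI[of _ N] allI impI)
    fix n assume n: "n \<ge> N"
    let ?\<rho> = "standard_mollifier n :: real^'d \<Rightarrow> real"
    have \<rho>: "mollifier (1 / real (Suc n)) ?\<rho>" by (rule standard_mollifier)
    have fg: "(\<lambda>x. f x - g x) \<in> Lp 2" using f gL by (intro Lp_diff) auto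
    have "Lp_norm 2 (\<lambda>x. conv ?\<rho> f x - f x) \<le> Lp_norm 2 (\<lambda>x. conv ?\<rho> f x - conv ?\<rho> g x)
        + Lp_norm 2 (\<lambda>x. conv ?\<rho> g x - f x)"
      using mollify_L2(1)[OF \<rho>] f gL by (intro Lp_norm_triangle_diff) auto
    also have "Lp_norm 2 (\<lambda>x. conv ?\<rho> g x - f x) \<le> Lp_norm 2 (\<lambda>x. conv ?\<rho> g x - g x) + Lp_norm 2 (\<lambda>x. g x - f x)"
      using mollify_L2(1)[OF \<rho>] f gL by (intro Lp_norm_triangle_diff) auto
    also have "Lp_norm 2 (\<lambda>x. conv ?\<rho> f x - conv ?\<rho> g x) \<le> Lp_norm 2 (\<lambda>x. f x - g x)"
    proof -
      have "conv ?\<rho> (\<lambda>x. f x - g x) = (\<lambda>x. conv ?\<rho> f x - conv ?\<rho> g x)"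
        using conv_diff[OF \<rho> L2_locally_integrable[OF f] L2_locally_integrable[OF gL]] by blast
      then show ?thesis using mollify_L2(2)[OF \<rho> fg] by simp
    qed
    finally show "norm (Lp_norm 2 (\<lambda>x. conv ?\<rho> f x - f x) - 0) < e"
      using N[OF n] g(3) by (simp add: Lp_norm_minus_commute[of 2 g])
  qed
qed

lemma Cc_infty_dense_L2:
  fixes f :: "real^'d::finite \<Rightarrow> complex^'m::finite"
  assumes f: "f \<in> Lp 2" and e: "e > 0"
  obtains g where "g \<in> Cc_infty" "Lp_norm 2 (\<lambda>x. f x - g x) < e"
proof -
  have e2: "e / 2 > 0" using e by simp
  from continuous_compact_dense[OF f _ this] obtain g R where g: "continuous_on UNIV g"
    "\<forall>x. norm x > R \<longrightarrow> g x = 0" "Lp_norm 2 (\<lambda>x. f x - g x) < e / 2" by auto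
  have gL: "g \<in> Lp 2" using continuous_compact_Lp[OF g(1,2)] by simp
  obtain n where n: "Lp_norm 2 (\<lambda>x. conv (standard_mollifier n) g x - g x) < e / 2"
    using LIMSEQ_D[OF mollify_continuous_Lp[OF g(1,2)] e2] by auto
  let ?\<rho> = "standard_mollifier n :: real^'d \<Rightarrow> real"
  have \<rho>: "mollifier (1 / real (Suc n)) ?\<rho>" by (rule standard_mollifier)
  have "Lp_norm 2 (\<lambda>x. f x - conv ?\<rho> g x) \<le> Lp_norm 2 (\<lambda>x. f x - g x) + Lp_norm 2 (\<lambda>x. g x - conv ?\<rho> g x)"
    using mollify_L2(1)[OF \<rho>] f gL by (intro Lp_norm_triangle_diff) auto
  then have "Lp_norm 2 (\<lambda>x. f x - conv ?\<rho> g x) < e"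
    using n g(3) by (simp add: Lp_norm_minus_commute[of 2 g])
  then show ?thesis
    using that conv_Cc_infty[OF mollifierD(1)[OF \<rho>] continuous_locally_integrable[OF g(1)] g(2)] by blast
qed

section \<open>Weak derivatives and the weak form of the operator\<close>

definition weak_partial :: "'d::finite \<Rightarrow> (real^'d \<Rightarrow> complex^'m::finite) \<Rightarrow> (real^'d \<Rightarrow> complex^'m) \<Rightarrow> bool" where
  "weak_partial j u w \<longleftrightarrow> distr_eq (distr_partial j (distr_of u)) (distr_of w)"

text \<open>The value of \<open>\<partial>\<^sub>j (conv \<rho> u)\<close> at \<open>x\<close> is the distribution \<open>\<partial>\<^sub>j u\<close> applied to the test function
  \<open>\<rho>(x - \<cdot>)\<close>.\<close>

lemma weak_partial_mollify:
  fixes u w :: "real^'d::finite \<Rightarrow> complex^'m::finite"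
  assumes w: "weak_partial j u w" and u: "u \<in> Lp 2" and \<rho>: "mollifier \<epsilon> \<rho>"
  shows "partial j (conv \<rho> u) = conv \<rho> w"
proof
  fix x
  have C: "(\<lambda>y. \<rho> (x - y)) \<in> Cc_infty" using Cc_infty_reflect mollifierD(1)[OF \<rho>] by blast
  have "smooth \<rho>" using mollifierD(1)[OF \<rho>] by (simp add: Cc_infty_iff)
  then have p: "partial j (\<lambda>y. \<rho> (x - y)) = (\<lambda>y. - partial j \<rho> (x - y))" by (rule smooth_reflect)
  have "partial j (conv \<rho> u) x = conv (partial j \<rho>) u x"
    by (rule conv_partial[OF mollifierD(2)[OF \<rho>] L2_locally_integrable[OF u]])
  also have "\<dots> = conv \<rho> w x"
    using w C unfolding weak_partial_def distr_eq_def distr_partial_def distr_of_def conv_def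
    by (auto simp: p dest!: bspec[where x="\<lambda>y. \<rho> (x - y)"])
  finally show "partial j (conv \<rho> u) x = conv \<rho> w x" .
qed

lemma nonpos_if_le_all_eps:
  fixes a C :: real
  assumes "C \<ge> 0" "\<And>e. e > 0 \<Longrightarrow> a \<le> e * C"
  shows "a \<le> 0"
proof (rule field_le_epsilon)
  fix e :: real assume e: "e > 0"
  have "a \<le> e / (C + 1) * C" using assms(1) e by (intro assms(2)) auto
  also have "\<dots> \<le> e" using assms(1) e by (simp add: field_simps)
  finally show "a \<le> 0 + e" by simp
qed

lemma locally_integrable_test:
  fixes u :: "real^'d::finite \<Rightarrow> 'b::euclidean_space"
  assumes f: "f \<in> C1c" and u: "locally_integrable u"
  shows "integrable lebesgue (\<lambda>x. f x *\<^sub>R u x)" "integrable lebesgue (\<lambda>x. partial i f x *\<^sub>R u x)"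
proof -
  have *: "integrable lebesgue (\<lambda>x. k x *\<^sub>R u x)"
    if k: "continuous_on UNIV k" and R: "\<forall>x. norm x > R \<longrightarrow> k x = 0" for k R
  proof -
    obtain B where "\<And>x. norm (k x) \<le> B" using compact_support_bounded[OF k R] by blast
    then show ?thesis
      using R by (intro locally_integrable_mult(1)[OF u continuous_measurable_lebesgue[OF k], of B R]) auto
  qed
  obtain R where R: "\<forall>x. norm x > R \<longrightarrow> f x = 0" using C1c_support[OF f] by blast
  show "integrable lebesgue (\<lambda>x. f x *\<^sub>R u x)" by (rule *[OF C1c_continuous[OF f] R])
  show "integrable lebesgue (\<lambda>x. partial i f x *\<^sub>R u x)"
    by (rule *[OF C1c_partial_continuous[OF f] partial_vanishes[OF R]])
qed

text \<open>Test functions occurring below, such as \<open>q\<^sub>i\<^sub>j \<partial>\<^sub>i \<phi>\<close> and nonlinear functions of mollifications,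
  are only continuously differentiable. Mollifying the test function extends identities
  to this class.\<close>

lemma weak_identity_extends:
  fixes F :: "'d::finite \<Rightarrow> real^'d \<Rightarrow> 'b::euclidean_space" and H :: "real^'d \<Rightarrow> 'b"
  assumes F: "\<And>i. locally_integrable (F i)" and H: "locally_integrable H"
    and id: "\<And>\<phi>. \<phi> \<in> Cc_infty \<Longrightarrow>
      (\<Sum>i\<in>UNIV. LINT x|lebesgue. partial i \<phi> x *\<^sub>R F i x) + (LINT x|lebesgue. \<phi> x *\<^sub>R H x) = 0"
    and f: "f \<in> C1c"
  shows "(\<Sum>i\<in>UNIV. LINT x|lebesgue. partial i f x *\<^sub>R F i x) + (LINT x|lebesgue. f x *\<^sub>R H x) = 0"
    (is "?L f = 0")
proof -
  obtain R where R: "\<forall>x. norm x > R \<longrightarrow> f x = 0" using C1c_support[OF f] by blast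
  let ?I = "\<lambda>u. LINT x|lebesgue. norm (indicator (cball 0 (R + 1)) x *\<^sub>R (u x :: 'b))"
  have I: "?I u \<ge> 0" for u by (intro integral_nonneg_AE) auto
  have meas: "k \<in> borel_measurable lebesgue" "partial i k \<in> borel_measurable lebesgue"
    if "k \<in> C1c" for k :: "real^'d \<Rightarrow> real" and i
    using that by (auto intro!: continuous_measurable_lebesgue C1c_continuous C1c_partial_continuous)
  note int = locally_integrable_test
  have "norm (?L f) \<le> e * ((\<Sum>i\<in>UNIV. ?I (F i)) + ?I H)" if e: "e > 0" for e
  proof -
    obtain g where g: "g \<in> Cc_infty" "\<forall>x. norm x > R + 1 \<longrightarrow> g x = 0"
      "\<And>x. \<bar>g x - f x\<bar> \<le> e" "\<And>i x. \<bar>partial i g x - partial i f x\<bar> \<le> e"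
      using C1c_approx_Cc_infty[OF f R e] by blast
    have gC: "g \<in> C1c" using g(1) by (rule Cc_infty_C1c)
    have "?L f = ?L f - ?L g" using id[OF g(1)] by simp
    also have "\<dots> = (\<Sum>i\<in>UNIV. LINT x|lebesgue. (partial i f x - partial i g x) *\<^sub>R F i x)
        + (LINT x|lebesgue. (f x - g x) *\<^sub>R H x)"
      using int[OF f F] int[OF gC F] int[OF f H] int[OF gC H]
      by (simp add: scaleR_diff_left sum_subtractf)
    also have "norm \<dots> \<le> (\<Sum>i\<in>UNIV. e * ?I (F i)) + e * ?I H"
    proof (rule order_trans[OF norm_triangle_ineq add_mono[OF sum_norm_le]])
      fix i
      show "norm (LINT x|lebesgue. (partial i f x - partial i g x) *\<^sub>R F i x) \<le> e * ?I (F i)"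
      proof (rule locally_integrable_mult(2)[OF F])
        show "(\<lambda>x. partial i f x - partial i g x) \<in> borel_measurable lebesgue"
          using meas(2)[OF f] meas(2)[OF gC] by measurable
        show "\<bar>partial i f x - partial i g x\<bar> \<le> e" for x using g(4)[of i x] by simp
        show "partial i f x - partial i g x = 0" if "norm x > R + 1" for x
          using that partial_vanishes[OF R, of i] partial_vanishes[OF g(2), of i] by simp
      qed
    next
      show "norm (LINT x|lebesgue. (f x - g x) *\<^sub>R H x) \<le> e * ?I H"
      proof (rule locally_integrable_mult(2)[OF H])
        show "(\<lambda>x. f x - g x) \<in> borel_measurable lebesgue"
          using meas(1)[OF f] meas(1)[OF gC] by measurable
        show "\<bar>f x - g x\<bar> \<le> e" for x using g(3)[of x] by simp
        show "f x - g x = 0" if "norm x > R + 1" for x using that R g(2) by simp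
      qed
    qed
    finally show ?thesis by (simp add: sum_distrib_left distrib_left)
  qed
  then have "norm (?L f) \<le> 0"
    by (intro nonpos_if_le_all_eps[where C="(\<Sum>i\<in>UNIV. ?I (F i)) + ?I H"] add_nonneg_nonneg sum_nonneg I)
  then show ?thesis by simp
qed

lemma locally_integrable_C1c_inner:
  fixes u :: "real^'d::finite \<Rightarrow> 'b::euclidean_space"
  assumes u: "locally_integrable u" and c: "continuous_on UNIV W" and R: "\<forall>x. norm x > R \<longrightarrow> W x = 0"
  shows "integrable lebesgue (\<lambda>x. W x \<bullet> u x)"
    and "(LINT x|lebesgue. W x \<bullet> u x) = (\<Sum>b\<in>Basis. (LINT x|lebesgue. (W x \<bullet> b) *\<^sub>R u x) \<bullet> b)"
proof -
  have i: "integrable lebesgue (\<lambda>x. (W x \<bullet> b) *\<^sub>R u x)" for b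
  proof -
    have cb: "continuous_on UNIV (\<lambda>x. W x \<bullet> b)" using c by (intro continuous_intros)
    have s: "\<forall>x. norm x > R \<longrightarrow> W x \<bullet> b = 0" using R by simp
    obtain B where "\<And>x. norm (W x \<bullet> b) \<le> B" using compact_support_bounded[OF cb s] by blast
    then show ?thesis
      using R by (intro locally_integrable_mult(1)[OF u continuous_measurable_lebesgue[OF cb], of B R]) auto
  qed
  have eq: "W x \<bullet> u x = (\<Sum>b\<in>Basis. ((W x \<bullet> b) *\<^sub>R u x) \<bullet> b)" for x
    by (subst euclidean_inner) (simp)
  have ib: "integrable lebesgue (\<lambda>x. ((W x \<bullet> b) *\<^sub>R u x) \<bullet> b)" for b
    using i by (rule integrable_inner_left)
  show "integrable lebesgue (\<lambda>x. W x \<bullet> u x)" unfolding eq by (intro Bochner_Integration.integrable_sum ib)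
  show "(LINT x|lebesgue. W x \<bullet> u x) = (\<Sum>b\<in>Basis. (LINT x|lebesgue. (W x \<bullet> b) *\<^sub>R u x) \<bullet> b)"
    unfolding eq using ib i by (subst Bochner_Integration.integral_sum) (auto simp del: inner_scaleR_left)
qed

text \<open>For a vector-valued test function the identity is applied to its coordinates and summed.\<close>

lemma weak_identity_vector:
  fixes F :: "'d::finite \<Rightarrow> real^'d \<Rightarrow> 'b::euclidean_space" and H W :: "real^'d \<Rightarrow> 'b"
  assumes F: "\<And>i. locally_integrable (F i)" and H: "locally_integrable H"
    and id: "\<And>\<phi>. \<phi> \<in> Cc_infty \<Longrightarrow>
      (\<Sum>i\<in>UNIV. LINT x|lebesgue. partial i \<phi> x *\<^sub>R F i x) + (LINT x|lebesgue. \<phi> x *\<^sub>R H x) = 0"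
    and W: "W \<in> C1c"
  shows "integrable lebesgue (\<lambda>x. (\<Sum>i\<in>UNIV. partial i W x \<bullet> F i x) + W x \<bullet> H x)"
    and "(LINT x|lebesgue. (\<Sum>i\<in>UNIV. partial i W x \<bullet> F i x) + W x \<bullet> H x) = 0"
proof -
  obtain R where R: "\<forall>x. norm x > R \<longrightarrow> W x = 0" using C1c_support[OF W] by blast
  note WH = locally_integrable_C1c_inner[OF H C1c_continuous[OF W] R]
  note WF = locally_integrable_C1c_inner[OF F C1c_partial_continuous[OF W] partial_vanishes[OF R]]
  show "integrable lebesgue (\<lambda>x. (\<Sum>i\<in>UNIV. partial i W x \<bullet> F i x) + W x \<bullet> H x)"
    by (intro Bochner_Integration.integrable_add Bochner_Integration.integrable_sum WH(1) WF(1))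
  have "(LINT x|lebesgue. (\<Sum>i\<in>UNIV. partial i W x \<bullet> F i x) + W x \<bullet> H x)
      = (\<Sum>i\<in>UNIV. LINT x|lebesgue. partial i W x \<bullet> F i x) + (LINT x|lebesgue. W x \<bullet> H x)"
    using WH(1) WF(1) by (simp add: Bochner_Integration.integral_add Bochner_Integration.integral_sum)
  also have "\<dots> = (\<Sum>i\<in>UNIV. \<Sum>b\<in>Basis. (LINT x|lebesgue. (partial i W x \<bullet> b) *\<^sub>R F i x) \<bullet> b)
      + (\<Sum>b\<in>Basis. (LINT x|lebesgue. (W x \<bullet> b) *\<^sub>R H x) \<bullet> b)"
    unfolding WH(2) WF(2) ..
  also have "\<dots> = (\<Sum>b\<in>Basis. ((\<Sum>i\<in>UNIV. LINT x|lebesgue. (partial i W x \<bullet> b) *\<^sub>R F i x)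
      + (LINT x|lebesgue. (W x \<bullet> b) *\<^sub>R H x)) \<bullet> b)"
    by (subst sum.swap) (simp add: sum.distrib inner_add_left inner_sum_left)
  also have "\<dots> = 0"
  proof (rule sum.neutral, rule ballI)
    fix b :: 'b
    have "partial i (\<lambda>x. W x \<bullet> b) = (\<lambda>x. partial i W x \<bullet> b)" for i
      by (rule C1_inner(2)[OF C1c_C1[OF W]])
    then show "((\<Sum>i\<in>UNIV. LINT x|lebesgue. (partial i W x \<bullet> b) *\<^sub>R F i x)
      + (LINT x|lebesgue. (W x \<bullet> b) *\<^sub>R H x)) \<bullet> b = 0"
      using weak_identity_extends[OF F H id C1c_inner[OF W, of b]] by simp
  qed
  finally show "(LINT x|lebesgue. (\<Sum>i\<in>UNIV. partial i W x \<bullet> F i x) + W x \<bullet> H x) = 0" .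
qed

lemma weak_partial_C1c:
  fixes u w :: "real^'d::finite \<Rightarrow> complex^'m::finite"
  assumes w: "weak_partial j u w" and u: "u \<in> Lp 2" and wL: "w \<in> Lp 2" and f: "f \<in> C1c"
  shows "(LINT x|lebesgue. partial j f x *\<^sub>R u x) = - (LINT x|lebesgue. f x *\<^sub>R w x)"
proof -
  let ?F = "\<lambda>i x. if i = j then u x else 0"
  have eq: "(\<Sum>i\<in>UNIV. LINT x|lebesgue. partial i \<phi> x *\<^sub>R ?F i x) = (LINT x|lebesgue. partial j \<phi> x *\<^sub>R u x)"
    for \<phi> :: "real^'d \<Rightarrow> real"
  proof -
    have "(LINT x|lebesgue. partial i \<phi> x *\<^sub>R ?F i x) = (if i = j then LINT x|lebesgue. partial j \<phi> x *\<^sub>R u x else 0)" for i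
      by simp
    then show ?thesis by simp
  qed
  have "(\<Sum>i\<in>UNIV. LINT x|lebesgue. partial i f x *\<^sub>R ?F i x) + (LINT x|lebesgue. f x *\<^sub>R w x) = 0"
  proof (rule weak_identity_extends[OF _ L2_locally_integrable[OF wL] _ f])
    show "locally_integrable (?F i)" for i
      using L2_locally_integrable[OF u] L2_locally_integrable[OF Lp_zero] by (cases "i = j") auto
    fix \<phi> :: "real^'d \<Rightarrow> real" assume "\<phi> \<in> Cc_infty"
    then have "- (LINT x|lebesgue. partial j \<phi> x *\<^sub>R u x) = (LINT x|lebesgue. \<phi> x *\<^sub>R w x)"
      using w unfolding weak_partial_def distr_eq_def distr_partial_def distr_of_def by blast
    then show "(\<Sum>i\<in>UNIV. LINT x|lebesgue. partial i \<phi> x *\<^sub>R ?F i x) + (LINT x|lebesgue. \<phi> x *\<^sub>R w x) = 0"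
      unfolding eq by (metis add.left_inverse neg_equal_iff_equal minus_minus)
  qed
  then show ?thesis unfolding eq by (simp add: eq_neg_iff_add_eq_0)
qed

lemma matrix_vector_mult_bound:
  fixes A :: "real^'m::finite^'m"
  assumes "\<And>i j. \<bar>A $ i $ j\<bar> \<le> C"
  shows "norm (cmatrix A *v \<xi>) \<le> C * (real CARD('m))\<^sup>2 * norm \<xi>"
proof -
  have "norm (cmatrix A *v \<xi>) \<le> (\<Sum>i\<in>UNIV. norm ((cmatrix A *v \<xi>) $ i))" 
    unfolding norm_vec_def by (rule L2_set_le_sum) simp
  also have "\<dots> \<le> (\<Sum>i::'m\<in>UNIV. \<Sum>j::'m\<in>UNIV. C * norm \<xi>)"
  proof (rule sum_mono)
    fix i
    have "norm ((cmatrix A *v \<xi>) $ i) = norm (\<Sum>j\<in>UNIV. complex_of_real (A $ i $ j) * \<xi> $ j)"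
      by (simp add: matrix_vector_mult_def cmatrix_def)
    also have "\<dots> \<le> (\<Sum>j::'m\<in>UNIV. C * norm \<xi>)"
    proof (rule sum_norm_le)
      fix j
      show "norm (complex_of_real (A $ i $ j) * \<xi> $ j) \<le> C * norm \<xi>"
        unfolding norm_mult using assms[of i j] Finite_Cartesian_Product.norm_nth_le[where x=\<xi> and i=j] order_trans[OF abs_ge_zero assms[of i j]]
        by (intro mult_mono) auto
    qed
    finally show "norm ((cmatrix A *v \<xi>) $ i) \<le> (\<Sum>j::'m\<in>UNIV. C * norm \<xi>)" .
  qed
  also have "\<dots> = C * (real CARD('m))\<^sup>2 * norm \<xi>" by (simp add: power2_eq_square)
  finally show ?thesis .
qed

lemma potential_local_bound:
  fixes V :: "real^'d::finite \<Rightarrow> real^'m::finite^'m"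
  assumes V: "\<And>i j. Linf_loc (\<lambda>x. V x $ i $ j)"
  obtains C where "C \<ge> 0" "AE x in lebesgue. norm x \<le> R \<longrightarrow> (\<forall>\<xi>. norm (cmatrix (V x) *v \<xi>) \<le> C * norm \<xi>)"
proof -
  have ex: "\<forall>i j. \<exists>C. AE x in lebesgue. x \<in> cball 0 R \<longrightarrow> \<bar>V x $ i $ j\<bar> \<le> C"
    using V compact_cball unfolding Linf_loc_def by blast
  define C where "C i j = (SOME C. AE x in lebesgue. x \<in> cball 0 R \<longrightarrow> \<bar>V x $ i $ j\<bar> \<le> C)" for i j
  have C: "AE x in lebesgue. x \<in> cball 0 R \<longrightarrow> \<bar>V x $ i $ j\<bar> \<le> C i j" for i j
    unfolding C_def by (rule someI_ex) (rule ex[rule_format])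
  define D where "D = Max (range (\<lambda>(i, j). \<bar>C i j\<bar>))"
  have D: "\<bar>C i j\<bar> \<le> D" for i j unfolding D_def by (rule Max_ge) auto
  have D0: "D \<ge> 0" using D[of undefined undefined] by linarith
  have "AE x in lebesgue. \<forall>i j. x \<in> cball 0 R \<longrightarrow> \<bar>V x $ i $ j\<bar> \<le> C i j"
    unfolding AE_all_countable using C by blast
  then have "AE x in lebesgue. norm x \<le> R \<longrightarrow> (\<forall>\<xi>. norm (cmatrix (V x) *v \<xi>) \<le> D * (real CARD('m))\<^sup>2 * norm \<xi>)"
  proof eventually_elim
    case (elim x)
    show ?case
    proof (intro impI allI matrix_vector_mult_bound)
      fix i j assume "norm x \<le> R"
      then have "\<bar>V x $ i $ j\<bar> \<le> C i j" using elim by simp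
      also have "\<dots> \<le> D" using D[of i j] by linarith
      finally show "\<bar>V x $ i $ j\<bar> \<le> D" .
    qed
  qed
  with D0 show ?thesis by (intro that[of "D * (real CARD('m))\<^sup>2"]) auto
qed

lemma potential_measurable:
  fixes V :: "real^'d::finite \<Rightarrow> real^'m::finite^'m"
  assumes V: "\<And>i j. Linf_loc (\<lambda>x. V x $ i $ j)" and u: "u \<in> borel_measurable lebesgue"
  shows "(\<lambda>x. cmatrix (V x) *v u x) \<in> borel_measurable lebesgue"
proof -
  have [measurable]: "(\<lambda>x. V x $ i $ j) \<in> borel_measurable lebesgue" for i j
    using V by (simp add: Linf_loc_def)
  have [measurable]: "(\<lambda>x. u x $ j) \<in> borel_measurable lebesgue" for j
    by (rule borel_measurable_continuous_on[OF _ u]) (intro continuous_intros)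
  have "(\<lambda>x. (cmatrix (V x) *v u x) $ i) \<in> borel_measurable lebesgue" for i
    unfolding matrix_vector_mult_def cmatrix_def by simp
  then have "(\<lambda>x. (cmatrix (V x) *v u x) \<bullet> b) \<in> borel_measurable lebesgue" if "b \<in> Basis" for b
    using that by (auto simp: Basis_vec_def inner_axis)
  then show ?thesis using borel_measurable_euclidean_space by blast
qed

lemma potential_locally_integrable:
  fixes V :: "real^'d::finite \<Rightarrow> real^'m::finite^'m"
  assumes V: "\<And>i j. Linf_loc (\<lambda>x. V x $ i $ j)" and u: "u \<in> Lp 2"
  shows "locally_integrable (\<lambda>x. cmatrix (V x) *v u x)"
  unfolding locally_integrable_def
proof (intro conjI allI)
  have m: "(\<lambda>x. cmatrix (V x) *v u x) \<in> borel_measurable lebesgue"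
    by (rule potential_measurable[OF V Lp_measurable[OF u]])
  then show "(\<lambda>x. cmatrix (V x) *v u x) \<in> borel_measurable lebesgue" .
  fix R
  obtain C where C: "C \<ge> 0" "AE x in lebesgue. norm x \<le> R \<longrightarrow> (\<forall>\<xi>. norm (cmatrix (V x) *v \<xi>) \<le> C * norm \<xi>)"
    by (rule potential_local_bound[OF V])
  have m2: "indicator (cball 0 R) \<in> borel_measurable (lebesgue :: (real^'d) measure)"
    by (simp add: borel_measurable_indicator)
  have "integrable lebesgue (\<lambda>x. C *\<^sub>R (indicator (cball 0 R) x *\<^sub>R u x))"
    using L2_local_bound(1)[OF u] by (rule integrable_scaleR_right)
  then show "integrable lebesgue (\<lambda>x. indicator (cball 0 R) x *\<^sub>R (cmatrix (V x) *v u x))"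
  proof (rule Bochner_Integration.integrable_bound)
    show "(\<lambda>x. indicator (cball 0 R) x *\<^sub>R (cmatrix (V x) *v u x)) \<in> borel_measurable lebesgue"
      using m m2 by (rule borel_measurable_scaleR[rotated])
    show "AE x in lebesgue. norm (indicator (cball 0 R) x *\<^sub>R (cmatrix (V x) *v u x))
        \<le> norm (C *\<^sub>R (indicator (cball 0 R) x *\<^sub>R u x))"
      using C(2) by eventually_elim (use C(1) in \<open>auto simp: indicator_def\<close>)
  qed
qed

lemma locally_integrable_add:
  "locally_integrable u \<Longrightarrow> locally_integrable v \<Longrightarrow> locally_integrable (\<lambda>x. u x + v x)"
  unfolding locally_integrable_def by (auto simp: scaleR_add_right)

section \<open>A cut-off function\<close>

text \<open>The square makes the function continuously differentiable across the sphere of radius \<open>R\<close>. It is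
  not constant near the origin; it suffices that it tends to \<open>1\<close> and its gradient to \<open>0\<close> for large \<open>R\<close>.\<close>

definition cutoff :: "real \<Rightarrow> real^'d::finite \<Rightarrow> real" where
  "cutoff R x = (max 0 (1 - (norm x)\<^sup>2 / R\<^sup>2))\<^sup>2"

lemma positive_part_square_DERIV: "((\<lambda>t::real. (max 0 t)\<^sup>2) has_real_derivative 2 * max 0 t) (at t)"
proof -
  consider "t > 0" | "t < 0" | "t = 0" by linarith
  then show ?thesis
  proof cases
    case 1
    have "((\<lambda>t::real. t\<^sup>2) has_real_derivative 2 * t) (at t)" by (auto intro!: derivative_eq_intros)
    then have "((\<lambda>t::real. (max 0 t)\<^sup>2) has_real_derivative 2 * t) (at t)"
      by (rule has_field_derivative_transform_within_open[of _ _ _ "{0<..}"]) (use 1 in auto)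
    then show ?thesis using 1 by simp
  next
    case 2
    have "((\<lambda>t::real. 0) has_real_derivative 0) (at t)" by simp
    then have "((\<lambda>t::real. (max 0 t)\<^sup>2) has_real_derivative 0) (at t)"
      by (rule has_field_derivative_transform_within_open[of _ _ _ "{..<0}"]) (use 2 in auto)
    then show ?thesis using 2 by simp
  next
    case 3
    have "((\<lambda>y::real. (max 0 y)\<^sup>2) has_real_derivative 0) (at 0)"
      unfolding has_field_derivative_iff
    proof (rule Lim_null_comparison)
      show "\<forall>\<^sub>F y in at 0. norm (((max 0 y)\<^sup>2 - (max 0 (0::real))\<^sup>2) / (y - 0)) \<le> \<bar>y\<bar>"
        by (rule always_eventually) (auto simp: max_def power2_eq_square)
      show "((\<lambda>y::real. \<bar>y\<bar>) \<longlongrightarrow> 0) (at 0)" by (intro tendsto_rabs_zero tendsto_ident_at)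
    qed
    then show ?thesis using 3 by simp
  qed
qed

lemma cutoff:
  fixes R :: real
  assumes R: "R > 0"
  shows "cutoff R \<in> (C1c :: (real^'d::finite \<Rightarrow> real) set)"
    and "0 \<le> cutoff R (x::real^'d)" "cutoff R (x::real^'d) \<le> 1"
    and "norm x > R \<Longrightarrow> cutoff R (x::real^'d) = 0"
    and "\<bar>partial i (cutoff R) (x::real^'d)\<bar> \<le> 4 / R"
proof -
  let ?g = "\<lambda>i x::real^'d. 2 * max 0 (1 - (norm x)\<^sup>2 / R\<^sup>2) * (- (2 * x $ i / R\<^sup>2))"
  have d: "(cutoff R has_derivative (\<lambda>h. \<Sum>i\<in>UNIV. (h $ i) *\<^sub>R ?g i x)) (at x)" for x :: "real^'d"
  proof -
    have "((\<lambda>x::real^'d. 1 - (x \<bullet> x) / R\<^sup>2) has_derivative (\<lambda>h. - (2 * (x \<bullet> h) / R\<^sup>2))) (at x)"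
    proof -
      have "((\<lambda>x::real^'d. x \<bullet> x) has_derivative (\<lambda>h. 2 * (x \<bullet> h))) (at x)"
        by (auto intro!: derivative_eq_intros simp: inner_commute)
      from has_derivative_diff[OF has_derivative_const has_derivative_mult_right[OF this, of "1 / R\<^sup>2"], of 1]
      show ?thesis by simp
    qed
    from has_derivative_compose[OF this positive_part_square_DERIV[unfolded has_field_derivative_def]]
    have "(cutoff R has_derivative (\<lambda>h. 2 * max 0 (1 - (x \<bullet> x) / R\<^sup>2) * - (2 * (x \<bullet> h) / R\<^sup>2))) (at x)"
      by (simp add: cutoff_def[abs_def] power2_norm_eq_inner)
    moreover have "2 * max 0 (1 - (x \<bullet> x) / R\<^sup>2) * - (2 * (x \<bullet> h) / R\<^sup>2) = (\<Sum>i\<in>UNIV. (h $ i) *\<^sub>R ?g i x)" for h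
      unfolding inner_vec_def[of x h]
      by (simp add: power2_norm_eq_inner sum_distrib_left sum_divide_distrib sum_negf mult_ac)
    ultimately show ?thesis by simp
  qed
  have c: "continuous_on UNIV (?g i)" for i using R by (intro continuous_intros) auto
  have vanish: "cutoff R x = 0" if "norm x > R" for x :: "real^'d"
  proof -
    have "R\<^sup>2 \<le> (norm x)\<^sup>2" using that R by (intro power_mono) auto
    then show ?thesis using R by (simp add: cutoff_def max_def field_simps)
  qed
  then show "norm x > R \<Longrightarrow> cutoff R (x::real^'d) = 0" .
  show "cutoff R \<in> (C1c :: (real^'d \<Rightarrow> real) set)"
    using C1I(1)[OF d c] vanish unfolding C1c_def by blast
  show "0 \<le> cutoff R x" by (simp add: cutoff_def)
  have m: "0 \<le> max 0 (1 - (norm x)\<^sup>2 / R\<^sup>2)" "max 0 (1 - (norm x)\<^sup>2 / R\<^sup>2) \<le> 1" by auto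
  then show "cutoff R x \<le> 1" unfolding cutoff_def by (rule power_le_one)
  show "\<bar>partial i (cutoff R) x\<bar> \<le> 4 / R"
  proof (cases "norm x \<le> R")
    case True
    have "\<bar>x $ i\<bar> \<le> R" using component_le_norm_cart[of x i] True by linarith
    then have "\<bar>2 * x $ i / R\<^sup>2\<bar> \<le> 2 / R" using R by (simp add: abs_mult power2_eq_square field_simps)
    moreover have "\<bar>2 * max 0 (1 - (norm x)\<^sup>2 / R\<^sup>2)\<bar> \<le> 2" using m by simp
    ultimately have "\<bar>2 * max 0 (1 - (norm x)\<^sup>2 / R\<^sup>2)\<bar> * \<bar>2 * x $ i / R\<^sup>2\<bar> \<le> 2 * (2 / R)"
      by (intro mult_mono) auto
    then show ?thesis unfolding C1I(2)[OF d c] by (simp add: abs_mult)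
  next
    case False
    then show ?thesis using partial_vanishes[of R "cutoff R" i] vanish R by auto
  qed
qed

lemma cutoff_tendsto: "(\<lambda>n. cutoff (real (Suc n)) x) \<longlonglongrightarrow> 1"
proof -
  have "(\<lambda>n. (max 0 (1 - (norm x * (1 / real (Suc n)))\<^sup>2))\<^sup>2) \<longlonglongrightarrow> (max 0 (1 - (norm x * 0)\<^sup>2))\<^sup>2"
    by (intro tendsto_intros LIMSEQ_Suc[OF lim_1_over_n])
  then show ?thesis by (simp add: cutoff_def power_divide)
qed

section \<open>Radial convex functions\<close>

text \<open>The convex functions are \<open>F(|z|\<^sup>2)\<close> with \<open>F' = a\<close>; up to the factor \<open>2\<close> the gradient is
  \<open>a(|z|\<^sup>2) z\<close>, and \<open>a + 2 s a' \<ge> 0\<close> is convexity in the radial direction.\<close>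

definition profile :: "(real \<Rightarrow> real) \<Rightarrow> (real \<Rightarrow> real) \<Rightarrow> real \<Rightarrow> bool" where
  "profile a a' M \<longleftrightarrow> (\<forall>s\<ge>0. (a has_real_derivative a' s) (at s)) \<and> continuous_on {0..} a' \<and>
    (\<forall>s\<ge>0. 0 \<le> a s \<and> a s \<le> M \<and> \<bar>a' s\<bar> * s \<le> M \<and> 0 \<le> a s + 2 * s * a' s)"

definition radial :: "(real \<Rightarrow> real) \<Rightarrow> 'b::euclidean_space \<Rightarrow> 'b" where
  "radial a z = a ((norm z)\<^sup>2) *\<^sub>R z"

definition radial_deriv :: "(real \<Rightarrow> real) \<Rightarrow> (real \<Rightarrow> real) \<Rightarrow> 'b::euclidean_space \<Rightarrow> 'b \<Rightarrow> 'b" where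
  "radial_deriv a a' z h = a ((norm z)\<^sup>2) *\<^sub>R h + (2 * a' ((norm z)\<^sup>2) * (z \<bullet> h)) *\<^sub>R z"

lemma profileD:
  assumes "profile a a' M" "s \<ge> 0"
  shows "(a has_real_derivative a' s) (at s)" "0 \<le> a s" "a s \<le> M" "\<bar>a' s\<bar> * s \<le> M" "0 \<le> a s + 2 * s * a' s"
  using assms unfolding profile_def by blast+

lemma radial_has_derivative:
  fixes z :: "'b::euclidean_space"
  assumes P: "profile a a' M"
  shows "(radial a has_derivative radial_deriv a a' z) (at z)"
proof -
  have 1: "((\<lambda>z::'b. (norm z)\<^sup>2) has_derivative (\<lambda>h. 2 * (z \<bullet> h))) (at z)"
    unfolding power2_norm_eq_inner by (auto intro!: derivative_eq_intros simp: inner_commute)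
  have "((\<lambda>z::'b. a ((norm z)\<^sup>2)) has_derivative (\<lambda>h. a' ((norm z)\<^sup>2) * (2 * (z \<bullet> h)))) (at z)"
    using has_derivative_compose[OF 1 profileD(1)[OF P, of "(norm z)\<^sup>2", unfolded has_field_derivative_def]] by simp
  from has_derivative_scaleR[OF this has_derivative_ident]
  show ?thesis unfolding radial_def[abs_def] radial_deriv_def[abs_def] by (simp add: mult_ac)
qed

lemma radial_deriv_bound:
  assumes P: "profile a a' M"
  shows "norm (radial_deriv a a' z h) \<le> 3 * M * norm h"
proof -
  let ?s = "(norm z)\<^sup>2"
  note p = profileD[OF P, of ?s]
  have "norm (radial_deriv a a' z h) \<le> norm (a ?s *\<^sub>R h) + norm ((2 * a' ?s * (z \<bullet> h)) *\<^sub>R z)"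
    unfolding radial_deriv_def by (rule norm_triangle_ineq)
  also have "norm (a ?s *\<^sub>R h) \<le> M * norm h" using p by (auto intro: mult_right_mono)
  also have "norm ((2 * a' ?s * (z \<bullet> h)) *\<^sub>R z) = 2 * \<bar>a' ?s\<bar> * (\<bar>z \<bullet> h\<bar> * norm z)"
    by (simp add: abs_mult)
  also have "\<dots> \<le> 2 * \<bar>a' ?s\<bar> * ((norm z * norm h) * norm z)"
    by (intro mult_left_mono mult_right_mono Cauchy_Schwarz_ineq2) auto
  also have "\<dots> = 2 * (\<bar>a' ?s\<bar> * ?s) * norm h" by (simp add: power2_eq_square)
  also have "\<dots> \<le> 2 * M * norm h" using p by (intro mult_right_mono) auto
  finally show ?thesis by simp
qed

lemma radial_bound:
  assumes P: "profile a a' M"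
  shows "norm (radial a z) \<le> M * norm z"
  using profileD[OF P, of "(norm z)\<^sup>2"] by (auto simp: radial_def intro: mult_right_mono)

lemma profile_bound_nonneg: "profile a a' M \<Longrightarrow> M \<ge> 0"
  using profileD(2,3)[of a a' M 0] by simp

lemma radial_lipschitz:
  fixes y z :: "'b::euclidean_space"
  assumes P: "profile a a' M"
  shows "norm (radial a y - radial a z) \<le> 3 * M * norm (y - z)"
proof (rule differentiable_bound[of UNIV "radial a" "\<lambda>z. radial_deriv a a' z"])
  fix x :: 'b
  show "(radial a has_derivative radial_deriv a a' x) (at x within UNIV)"
    using radial_has_derivative[OF P, of x] by simp
  show "onorm (radial_deriv a a' x) \<le> 3 * M"
    using radial_deriv_bound[OF P] profile_bound_nonneg[OF P] by (intro onorm_bound) auto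
qed auto

lemma radial_deriv_diff: "radial_deriv a a' z (h - k) = radial_deriv a a' z h - radial_deriv a a' z k"
  by (simp add: radial_deriv_def inner_diff_right algebra_simps)

lemma radial_C1:
  fixes v :: "real^'d::finite \<Rightarrow> 'b::euclidean_space"
  assumes P: "profile a a' M" and v: "v \<in> C1"
  shows "(\<lambda>x. radial a (v x)) \<in> C1"
    and "partial i (\<lambda>x. radial a (v x)) = (\<lambda>x. radial_deriv a a' (v x) (partial i v x))"
proof -
  let ?g = "\<lambda>i x. radial_deriv a a' (v x) (partial i v x)"
  have d: "((\<lambda>x. radial a (v x)) has_derivative (\<lambda>h. \<Sum>i\<in>UNIV. (h $ i) *\<^sub>R ?g i x)) (at x)" for x
    using has_derivative_compose[OF has_derivative_partial[OF C1_differentiable[OF v]] radial_has_derivative[OF P], of x]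
    by (simp add: radial_deriv_def inner_sum_right scaleR_add_right sum.distrib scaleR_sum_right
        scaleR_sum_left sum_distrib_left mult_ac)
  have ac: "continuous_on {0..} a"
    using profileD(1)[OF P] by (auto intro!: continuous_at_imp_continuous_on DERIV_isCont)
  have a'c: "continuous_on {0..} a'" using P by (simp add: profile_def)
  have sq: "continuous_on UNIV (\<lambda>x. (norm (v x))\<^sup>2)" using C1_continuous[OF v] by (intro continuous_intros)
  have c: "continuous_on UNIV (?g i)" for i
    unfolding radial_deriv_def
    by (intro continuous_on_add continuous_on_scaleR continuous_on_mult continuous_on_inner continuous_on_const
        continuous_on_compose2[OF ac sq] continuous_on_compose2[OF a'c sq] C1_continuous[OF v] C1_partial_continuous[OF v]) auto
  show "(\<lambda>x. radial a (v x)) \<in> C1" by (rule C1I(1)[OF d c])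
  show "partial i (\<lambda>x. radial a (v x)) = ?g i" by (rule C1I(2)[OF d c])
qed

text \<open>If \<open>a' < 0\<close>, only the part of the gradient parallel to \<open>z\<close> sees the negative term; splitting
  off this part, \<open>a + 2 |z|\<^sup>2 a' \<ge> 0\<close> suffices for positivity.\<close>

lemma radial_deriv_trace_nonneg:
  fixes q :: "'d::finite \<Rightarrow> 'd \<Rightarrow> real" and w :: "'d \<Rightarrow> 'b::euclidean_space"
  assumes P: "profile a a' M" and q: "\<And>\<xi>. 0 \<le> (\<Sum>i\<in>UNIV. \<Sum>j\<in>UNIV. q i j * (\<xi> i * \<xi> j))"
  shows "0 \<le> (\<Sum>i\<in>UNIV. \<Sum>j\<in>UNIV. q i j * (radial_deriv a a' z (w i) \<bullet> w j))"
proof -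
  let ?s = "(norm z)\<^sup>2"
  define T where "T = (\<Sum>i\<in>UNIV. \<Sum>j\<in>UNIV. q i j * (w i \<bullet> w j))"
  define P' where "P' = (\<Sum>i\<in>UNIV. \<Sum>j\<in>UNIV. q i j * ((z \<bullet> w i) * (z \<bullet> w j)))"
  have gram: "0 \<le> (\<Sum>i\<in>UNIV. \<Sum>j\<in>UNIV. q i j * (v i \<bullet> v j))" for v :: "'d \<Rightarrow> 'b"
  proof -
    have "(\<Sum>i\<in>UNIV. \<Sum>j\<in>UNIV. q i j * (v i \<bullet> v j))
        = (\<Sum>i\<in>UNIV. \<Sum>j\<in>UNIV. \<Sum>b\<in>Basis. q i j * ((v i \<bullet> b) * (v j \<bullet> b)))"
      by (subst euclidean_inner) (simp add: sum_distrib_left)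
    also have "\<dots> = (\<Sum>b\<in>Basis. \<Sum>i\<in>UNIV. \<Sum>j\<in>UNIV. q i j * ((v i \<bullet> b) * (v j \<bullet> b)))"
      by (subst sum.swap[of _ Basis], subst sum.swap[of _ Basis]) simp
    also have "\<dots> \<ge> 0" by (intro sum_nonneg q)
    finally show ?thesis .
  qed
  have eq: "(\<Sum>i\<in>UNIV. \<Sum>j\<in>UNIV. q i j * (radial_deriv a a' z (w i) \<bullet> w j)) = a ?s * T + 2 * a' ?s * P'"
    unfolding T_def P'_def radial_deriv_def
    by (simp add: inner_add_left distrib_left sum.distrib sum_distrib_left mult_ac)
  have T0: "T \<ge> 0" unfolding T_def by (rule gram)
  have P0: "P' \<ge> 0" unfolding P'_def by (rule q)
  have PT: "P' \<le> ?s * T"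
  proof (cases "z = 0")
    case False
    then have s: "?s > 0" by simp
    \<comment> \<open>the Gram form of the parts orthogonal to \<open>z\<close>\<close>
    define c where "c i = (z \<bullet> w i) / ?s" for i
    have zz: "z \<bullet> z = ?s" by (simp add: power2_norm_eq_inner)
    have "(w i - c i *\<^sub>R z) \<bullet> (w j - c j *\<^sub>R z) = w i \<bullet> w j - (z \<bullet> w i) * (z \<bullet> w j) / ?s" for i j
    proof -
      have "(w i - c i *\<^sub>R z) \<bullet> (w j - c j *\<^sub>R z)
          = w i \<bullet> w j - c j * (z \<bullet> w i) - c i * (z \<bullet> w j) + c i * c j * ?s"
        by (simp add: inner_diff_left inner_diff_right inner_commute zz algebra_simps)
      also have "\<dots> = w i \<bullet> w j - (z \<bullet> w i) * (z \<bullet> w j) / ?s"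
        using s by (simp add: c_def field_simps)
      finally show ?thesis .
    qed
    then have "0 \<le> (\<Sum>i\<in>UNIV. \<Sum>j\<in>UNIV. q i j * (w i \<bullet> w j - (z \<bullet> w i) * (z \<bullet> w j) / ?s))"
      using gram[of "\<lambda>i. w i - c i *\<^sub>R z"] by simp
    also have "\<dots> = T - P' / ?s"
      unfolding T_def P'_def by (simp add: right_diff_distrib sum_subtractf sum_divide_distrib)
    finally show ?thesis using s by (simp add: field_simps)
  qed (simp add: P'_def)
  note p = profileD[OF P, of ?s]
  have "0 \<le> a ?s * T + 2 * a' ?s * P'"
  proof (cases "a' ?s \<ge> 0")
    case True
    then show ?thesis using p T0 P0 by simp
  next
    case False
    then have "2 * a' ?s * P' \<ge> 2 * a' ?s * (?s * T)" using PT by (intro mult_left_mono_neg) auto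
    moreover have "(a ?s + 2 * ?s * a' ?s) * T \<ge> 0" using p T0 by (intro mult_nonneg_nonneg) auto
    ultimately show ?thesis by (simp add: algebra_simps)
  qed
  then show ?thesis unfolding eq .
qed

lemma radial_monotone:
  fixes y z :: "'b::euclidean_space"
  assumes P: "profile a a' M"
  shows "0 \<le> radial_deriv a a' z h \<bullet> h"
proof -
  have "0 \<le> (\<Sum>i\<in>UNIV. \<Sum>j\<in>UNIV. (1::real) * (radial_deriv a a' z ((\<lambda>_::unit. h) i) \<bullet> (\<lambda>_::unit. h) j))"
    by (rule radial_deriv_trace_nonneg[OF P]) (simp add: UNIV_unit)
  then show ?thesis by (simp add: UNIV_unit)
qed

text \<open>On the segment from \<open>z\<close> to \<open>y\<close> the mean value theorem produces the gradient at an intermediate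
  point, and the gradient in direction \<open>y - z\<close> is nondecreasing.\<close>

lemma radial_convex:
  fixes y z :: "'b::euclidean_space"
  assumes P: "profile a a' M" and F: "\<And>s. s \<ge> 0 \<Longrightarrow> (F has_real_derivative a s) (at s)"
  shows "F ((norm y)\<^sup>2) - F ((norm z)\<^sup>2) \<le> 2 * (radial a y \<bullet> (y - z))"
proof -
  let ?l = "\<lambda>t. z + t *\<^sub>R (y - z)"
  have l: "(?l has_derivative (\<lambda>h. h *\<^sub>R (y - z))) (at t)" for t :: real
    by (auto intro!: derivative_eq_intros)
  have dF: "((\<lambda>t. F ((norm (?l t))\<^sup>2)) has_real_derivative 2 * (radial a (?l t) \<bullet> (y - z))) (at t)" for t
  proof -
    have 1: "((\<lambda>z::'b. (norm z)\<^sup>2) has_derivative (\<lambda>h. 2 * (?l t \<bullet> h))) (at (?l t))"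
      unfolding power2_norm_eq_inner by (auto intro!: derivative_eq_intros simp: inner_commute)
    have "((\<lambda>z::'b. F ((norm z)\<^sup>2)) has_derivative (\<lambda>h. a ((norm (?l t))\<^sup>2) * (2 * (?l t \<bullet> h)))) (at (?l t))"
      using has_derivative_compose[OF 1 F[of "(norm (?l t))\<^sup>2", unfolded has_field_derivative_def]] by simp
    from has_derivative_compose[OF l this]
    show ?thesis unfolding has_field_derivative_def
      by (rule has_derivative_eq_rhs) (auto simp: fun_eq_iff radial_def)
  qed
  have dG: "((\<lambda>t. radial a (?l t) \<bullet> (y - z)) has_real_derivative (radial_deriv a a' (?l t) (y - z) \<bullet> (y - z))) (at t)" for t
  proof -
    show ?thesis unfolding has_field_derivative_def
      by (rule has_derivative_eq_rhs[OF
            has_derivative_inner_left[OF has_derivative_compose[OF l radial_has_derivative[OF P]]]])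
        (auto simp: fun_eq_iff radial_deriv_def algebra_simps)
  qed
  obtain t where t: "0 < t" "t < 1" "F ((norm (?l 1))\<^sup>2) - F ((norm (?l 0))\<^sup>2) = (1 - 0) * (2 * (radial a (?l t) \<bullet> (y - z)))"
    using MVT2[of 0 1 "\<lambda>t. F ((norm (?l t))\<^sup>2)", OF _ dF] by auto
  have "radial a (?l t) \<bullet> (y - z) \<le> radial a (?l 1) \<bullet> (y - z)"
    by (rule DERIV_nonneg_imp_nondecreasing[of t 1 "\<lambda>t. radial a (?l t) \<bullet> (y - z)"])
      (use t dG radial_monotone[OF P] in \<open>auto\<close>)
  then show ?thesis using t(3) by simp
qed

lemma radial_F_lipschitz:
  fixes y z :: "'b::euclidean_space"
  assumes P: "profile a a' M" and F: "\<And>s. s \<ge> 0 \<Longrightarrow> (F has_real_derivative a s) (at s)"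
  shows "\<bar>F ((norm y)\<^sup>2) - F ((norm z)\<^sup>2)\<bar> \<le> 2 * M * ((norm y + norm z) * norm (y - z))"
proof -
  have *: "F ((norm u)\<^sup>2) - F ((norm v)\<^sup>2) \<le> 2 * M * ((norm u + norm v) * norm (u - v))" for u v :: 'b
  proof -
    have "F ((norm u)\<^sup>2) - F ((norm v)\<^sup>2) \<le> 2 * (radial a u \<bullet> (u - v))" by (rule radial_convex[OF P F])
    also have "radial a u \<bullet> (u - v) \<le> norm (radial a u) * norm (u - v)" by (rule norm_cauchy_schwarz)
    also have "\<dots> \<le> (M * (norm u + norm v)) * norm (u - v)"
    proof (rule mult_right_mono)
      have "norm (radial a u) \<le> M * norm u" by (rule radial_bound[OF P])
      also have "\<dots> \<le> M * (norm u + norm v)" using profile_bound_nonneg[OF P] by (intro mult_left_mono) auto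
      finally show "norm (radial a u) \<le> M * (norm u + norm v)" .
    qed simp
    finally show ?thesis by simp
  qed
  show ?thesis using *[of y z] *[of z y] by (simp add: norm_minus_commute add.commute abs_le_iff)
qed

section \<open>Dissipativity\<close>

lemma Lp_inner_measurable:
  fixes f g :: "real^'d::finite \<Rightarrow> 'b::euclidean_space"
  assumes "f \<in> borel_measurable lebesgue" "g \<in> borel_measurable lebesgue"
  shows "(\<lambda>x. f x \<bullet> g x) \<in> borel_measurable lebesgue"
  using assms by measurable

lemma radial_measurable:
  fixes u :: "'a \<Rightarrow> 'b::euclidean_space"
  assumes P: "profile a a' M" and u: "u \<in> borel_measurable N"
  shows "(\<lambda>x. radial a (u x)) \<in> borel_measurable N"
proof -
  have "continuous_on UNIV (radial a :: 'b \<Rightarrow> 'b)"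
    using radial_has_derivative[OF P] by (auto intro!: continuous_at_imp_continuous_on has_derivative_continuous)
  from borel_measurable_continuous_on[OF this u] show ?thesis .
qed

lemma radial_L2:
  assumes P: "profile a a' M" and u: "u \<in> Lp 2"
  shows "(\<lambda>x. radial a (u x)) \<in> Lp 2"
  using L2_dominated[OF radial_measurable[OF P Lp_measurable[OF u]] u radial_bound[OF P]] .

lemma L2_inner_integrable:
  assumes "f \<in> Lp 2" "g \<in> Lp 2"
  shows "integrable lebesgue (\<lambda>x. f x \<bullet> g x)" "\<bar>LINT x|lebesgue. f x \<bullet> g x\<bar> \<le> Lp_norm 2 f * Lp_norm 2 g"
  using L2_bilinear_bound[OF assms Lp_inner_measurable[OF Lp_measurable Lp_measurable, OF assms], of 1]
    Cauchy_Schwarz_ineq2 by auto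

lemma cmatrix_inner: "(A::complex^'m::finite) \<bullet> \<xi> = Re (\<Sum>i\<in>UNIV. A $ i * cnj (\<xi> $ i))"
  by (simp add: inner_vec_def inner_complex_def)

locale schroedinger =
  fixes Q :: "real^'d::finite \<Rightarrow> real^'d^'d" and V :: "real^'d \<Rightarrow> real^'m::finite^'m"
  assumes Q_C1: "\<And>i j. bounded_C1 (\<lambda>x. Q x $ i $ j)"
    and Q_nonneg: "\<And>x \<xi>. 0 \<le> (Q x *v \<xi>) \<bullet> \<xi>"
    and V_Linf_loc: "\<And>i j. Linf_loc (\<lambda>x. V x $ i $ j)"
    and V_accretive: "\<And>x \<xi>. 0 \<le> (cmatrix (V x) *v \<xi>) \<bullet> \<xi>"
begin

lemma Q_entry_C1: "(\<lambda>x. Q x $ i $ j) \<in> C1"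
  using Q_C1[of i j] by (auto simp: bounded_C1_def C1_def differentiable_on_def)

lemma Q_form_nonneg: "0 \<le> (\<Sum>i\<in>UNIV. \<Sum>j\<in>UNIV. Q x $ i $ j * (\<xi> i * \<xi> j))"
proof -
  have "(Q x *v (\<chi> i. \<xi> i)) \<bullet> (\<chi> i. \<xi> i) = (\<Sum>i\<in>UNIV. \<Sum>j\<in>UNIV. Q x $ i $ j * (\<xi> i * \<xi> j))"
    by (simp add: inner_vec_def matrix_vector_mult_def sum_distrib_left sum_distrib_right mult_ac)
  then show ?thesis using Q_nonneg[of x "\<chi> i. \<xi> i"] by simp
qed

text \<open>The components of \<open>Q \<nabla>u\<close>, for a family \<open>w\<close> in the place of the partial derivatives of \<open>u\<close>.\<close>

definition flux :: "('d \<Rightarrow> real^'d \<Rightarrow> complex^'m) \<Rightarrow> 'd \<Rightarrow> real^'d \<Rightarrow> complex^'m" where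
  "flux w i x = (\<Sum>j\<in>UNIV. Q x $ i $ j *\<^sub>R w j x)"

lemma flux_L2:
  assumes w: "\<And>j. w j \<in> Lp 2"
  shows "flux w i \<in> Lp 2"
proof -
  have "(\<lambda>x. Q x $ i $ j *\<^sub>R w j x) \<in> Lp 2" for j
  proof -
    obtain B where B: "\<And>x. \<bar>Q x $ i $ j\<bar> \<le> B"
      using Q_C1[of i j] by (auto simp: bounded_C1_def bounded_iff)
    show ?thesis
    proof (rule L2_dominated[OF _ w[of j], of _ B])
      show "(\<lambda>x. Q x $ i $ j *\<^sub>R w j x) \<in> borel_measurable lebesgue"
        using continuous_measurable_lebesgue[OF C1_continuous[OF Q_entry_C1[of i j]]] Lp_measurable[OF w[of j]]
        by (rule borel_measurable_scaleR)
      show "norm (Q x $ i $ j *\<^sub>R w j x) \<le> B * norm (w j x)" for x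
        using B[of x] by (auto intro: mult_right_mono)
    qed
  qed
  then show ?thesis unfolding flux_def[abs_def] by (intro Lp_sum(1)) auto
qed

lemma Delta_Q_weak:
  assumes u: "u \<in> Lp 2" and w: "\<And>j. w j \<in> Lp 2" "\<And>j. weak_partial j u (w j)" and f: "f \<in> Cc_infty"
  shows "Delta_Q Q u f = - (\<Sum>i\<in>UNIV. LINT x|lebesgue. partial i f x *\<^sub>R flux w i x)"
proof -
  have C: "(\<lambda>x. Q x $ i $ j * partial i f x) \<in> C1c" for i j
    using C1c_scaleR[OF Q_entry_C1 C1c_C1, of "partial i f" i j] Cc_infty_C1c[OF Cc_infty_partial[OF f]] by simp
  have int: "integrable lebesgue (\<lambda>x. (Q x $ i $ j * partial i f x) *\<^sub>R w j x)" for i j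
    by (rule locally_integrable_test(1)[OF C L2_locally_integrable[OF w(1)]])
  have "Delta_Q Q u f = (\<Sum>i\<in>UNIV. - (\<Sum>j\<in>UNIV. - (LINT x|lebesgue. partial j (\<lambda>x. Q x $ i $ j * partial i f x) x *\<^sub>R u x)))"
    by (simp add: Delta_Q_def distr_partial_def distr_mult_def distr_of_def)
  also have "\<dots> = (\<Sum>i\<in>UNIV. - (\<Sum>j\<in>UNIV. LINT x|lebesgue. (Q x $ i $ j * partial i f x) *\<^sub>R w j x))"
    unfolding weak_partial_C1c[OF w(2) u w(1) C] by simp
  also have "\<dots> = (\<Sum>i\<in>UNIV. - (LINT x|lebesgue. (\<Sum>j\<in>UNIV. (Q x $ i $ j * partial i f x) *\<^sub>R w j x)))"
    using int by (simp add: Bochner_Integration.integral_sum)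
  also have "\<dots> = - (\<Sum>i\<in>UNIV. LINT x|lebesgue. partial i f x *\<^sub>R flux w i x)"
    by (simp add: flux_def scaleR_sum_right sum_negf mult.commute)
  finally show ?thesis .
qed

text \<open>The equation for \<open>A u\<close> with all derivatives of second order moved to the test function once.\<close>

lemma op_A_weak_form:
  assumes "(u, g) \<in> op_A Q V"
  obtains w where "\<And>j. w j \<in> Lp 2" "\<And>j. weak_partial j u (w j)"
    "\<And>\<phi>. \<phi> \<in> Cc_infty \<Longrightarrow> (\<Sum>i\<in>UNIV. LINT x|lebesgue. partial i \<phi> x *\<^sub>R flux w i x)
      + (LINT x|lebesgue. \<phi> x *\<^sub>R (cmatrix (V x) *v u x + g x)) = 0"
proof -
  have u: "u \<in> Lp 2" and g: "g \<in> Lp 2" and e: "distr_eq (calA Q V u) (distr_of g)"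
    and ex: "\<forall>j. \<exists>w\<in>Lp 2. weak_partial j u w"
    using assms by (auto simp: op_A_def H1_def weak_partial_def)
  from bchoice[of UNIV "\<lambda>j w. w \<in> Lp 2 \<and> weak_partial j u w"] ex
  obtain w where w: "\<And>j. w j \<in> Lp 2" "\<And>j. weak_partial j u (w j)" by blast
  show ?thesis
  proof (rule that[OF w])
    fix f :: "real^'d \<Rightarrow> real" assume f: "f \<in> Cc_infty"
    have "Delta_Q Q u f - (LINT x|lebesgue. f x *\<^sub>R (cmatrix (V x) *v u x)) = (LINT x|lebesgue. f x *\<^sub>R g x)"
      using e f unfolding distr_eq_def calA_def distr_of_def by blast
    then have "(LINT x|lebesgue. f x *\<^sub>R (cmatrix (V x) *v u x)) + (LINT x|lebesgue. f x *\<^sub>R g x)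
        = - (\<Sum>i\<in>UNIV. LINT x|lebesgue. partial i f x *\<^sub>R flux w i x)"
      using Delta_Q_weak[OF u w f] by (simp add: algebra_simps)
    moreover have "(LINT x|lebesgue. f x *\<^sub>R (cmatrix (V x) *v u x + g x))
        = (LINT x|lebesgue. f x *\<^sub>R (cmatrix (V x) *v u x)) + (LINT x|lebesgue. f x *\<^sub>R g x)"
      using locally_integrable_test(1)[OF Cc_infty_C1c[OF f] potential_locally_integrable[OF V_Linf_loc u]] locally_integrable_test(1)[OF Cc_infty_C1c[OF f] L2_locally_integrable[OF g]]
      by (simp add: scaleR_add_right)
    ultimately show "(\<Sum>i\<in>UNIV. LINT x|lebesgue. partial i f x *\<^sub>R flux w i x)
      + (LINT x|lebesgue. f x *\<^sub>R (cmatrix (V x) *v u x + g x)) = 0" by simp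
  qed
qed

text \<open>The test function is \<open>cutoff R \<cdot> radial a v\<close> with a mollification \<open>v\<close> of \<open>u\<close>. Everything
  that has a sign is kept, and the errors are collected in the last four terms; they tend to \<open>0\<close>
  when first \<open>v \<rightarrow> u\<close> in \<open>H\<^sup>1\<close> and then \<open>R \<rightarrow> \<infinity>\<close>.\<close>

lemma dissipative_pointwise:
  fixes u v g Vu :: "complex^'m" and w w' F :: "'d \<Rightarrow> complex^'m"
  assumes P: "profile a a' M" and \<zeta>: "0 \<le> \<zeta>" "\<zeta> \<le> 1" and D: "\<And>i. \<bar>d i\<bar> \<le> D"
    and F: "\<And>i. F i = (\<Sum>j\<in>UNIV. Q x $ i $ j *\<^sub>R w j)"
    and Vu: "0 \<le> Vu \<bullet> u" "norm Vu \<le> C * norm u \<or> \<zeta> = 0" and C: "C \<ge> 0"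
  shows "\<zeta> * (radial a u \<bullet> g)
    \<le> (\<Sum>i\<in>UNIV. (d i *\<^sub>R radial a v + \<zeta> *\<^sub>R radial_deriv a a' v (w' i)) \<bullet> F i)
      + (\<zeta> *\<^sub>R radial a v) \<bullet> (Vu + g)
      + 3 * M * (norm (v - u) * norm g)
      + M * C * (norm (v - u) * norm u)
      + (\<Sum>i\<in>UNIV. D * M * (norm v * norm (F i)))
      + (\<Sum>i\<in>UNIV. 3 * M * (norm (w' i - w i) * norm (F i)))"
proof -
  have M: "M \<ge> 0" using profile_bound_nonneg[OF P] .
  have 1: "\<zeta> * (radial a u \<bullet> g) \<le> (\<zeta> *\<^sub>R radial a v) \<bullet> g + 3 * M * (norm (v - u) * norm g)"
  proof -
    have "\<zeta> * ((radial a u - radial a v) \<bullet> g) \<le> 1 * (norm (radial a u - radial a v) * norm g)"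
      using \<zeta> by (intro order_trans[OF mult_left_mono[OF norm_cauchy_schwarz] mult_right_mono]) auto
    also have "\<dots> \<le> (3 * M * norm (u - v)) * norm g"
      using radial_lipschitz[OF P, of u v] by (simp add: mult_right_mono)
    finally show ?thesis by (simp add: inner_diff_left norm_minus_commute algebra_simps)
  qed
  have 2: "0 \<le> (\<zeta> *\<^sub>R radial a v) \<bullet> Vu + M * C * (norm (v - u) * norm u)"
  proof (cases "\<zeta> = 0")
    case True
    then show ?thesis using M C by simp
  next
    case False
    let ?a = "a ((norm v)\<^sup>2)"
    have a: "0 \<le> ?a" "?a \<le> M" using profileD[OF P, of "(norm v)\<^sup>2"] by auto
    have "- (\<zeta> * ?a * ((v - u) \<bullet> Vu)) \<le> \<zeta> * ?a * (norm (v - u) * norm Vu)"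
      using \<zeta> a Cauchy_Schwarz_ineq2[of "v - u" Vu]
      by (subst mult_minus_right[symmetric], intro mult_left_mono) auto
    also have "\<dots> \<le> 1 * M * (norm (v - u) * (C * norm u))"
      using \<zeta> a Vu(2) False by (intro mult_mono) auto
    finally have "- (\<zeta> * ?a * ((v - u) \<bullet> Vu)) \<le> M * C * (norm (v - u) * norm u)" by (simp add: mult_ac)
    moreover have "0 \<le> \<zeta> * ?a * (u \<bullet> Vu)" using \<zeta> a Vu(1) by (simp add: inner_commute)
    moreover have "(\<zeta> *\<^sub>R radial a v) \<bullet> Vu = \<zeta> * ?a * (u \<bullet> Vu) + \<zeta> * ?a * ((v - u) \<bullet> Vu)"
      by (simp add: radial_def inner_diff_left algebra_simps)
    ultimately show ?thesis by linarith
  qed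
  have 3: "0 \<le> (d i *\<^sub>R radial a v) \<bullet> F i + D * M * (norm v * norm (F i))" for i
  proof -
    have "\<bar>(d i *\<^sub>R radial a v) \<bullet> F i\<bar> \<le> norm (d i *\<^sub>R radial a v) * norm (F i)" by (rule Cauchy_Schwarz_ineq2)
    also have "\<dots> \<le> (D * (M * norm v)) * norm (F i)"
      using D[of i] radial_bound[OF P, of v] by (auto intro!: mult_right_mono mult_mono)
    finally show ?thesis by (simp add: mult_ac)
  qed
  have 4: "0 \<le> (\<Sum>i\<in>UNIV. \<zeta> * (radial_deriv a a' v (w i) \<bullet> F i))"
  proof -
    have "0 \<le> (\<Sum>i\<in>UNIV. \<Sum>j\<in>UNIV. Q x $ i $ j * (radial_deriv a a' v (w i) \<bullet> w j))"
      by (rule radial_deriv_trace_nonneg[OF P Q_form_nonneg])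
    then have "0 \<le> (\<Sum>i\<in>UNIV. radial_deriv a a' v (w i) \<bullet> F i)" by (simp add: F inner_sum_right)
    then show ?thesis using \<zeta> by (simp flip: sum_distrib_left)
  qed
  have 5: "\<zeta> * (radial_deriv a a' v (w i) \<bullet> F i)
      \<le> (\<zeta> *\<^sub>R radial_deriv a a' v (w' i)) \<bullet> F i + 3 * M * (norm (w' i - w i) * norm (F i))" for i
  proof -
    have "\<zeta> * (radial_deriv a a' v (w i - w' i) \<bullet> F i) \<le> 1 * (norm (radial_deriv a a' v (w i - w' i)) * norm (F i))"
      using \<zeta> by (intro order_trans[OF mult_left_mono[OF norm_cauchy_schwarz] mult_right_mono]) auto
    also have "\<dots> \<le> (3 * M * norm (w i - w' i)) * norm (F i)"
      using radial_deriv_bound[OF P, of v "w i - w' i"] by (simp add: mult_right_mono)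
    finally show ?thesis by (simp add: radial_deriv_diff inner_diff_left norm_minus_commute algebra_simps)
  qed
  have "0 \<le> (\<Sum>i\<in>UNIV. (\<zeta> *\<^sub>R radial_deriv a a' v (w' i)) \<bullet> F i)
      + (\<Sum>i\<in>UNIV. 3 * M * (norm (w' i - w i) * norm (F i)))"
  proof -
    have "(\<Sum>i\<in>UNIV. \<zeta> * (radial_deriv a a' v (w i) \<bullet> F i))
        \<le> (\<Sum>i\<in>UNIV. (\<zeta> *\<^sub>R radial_deriv a a' v (w' i)) \<bullet> F i + 3 * M * (norm (w' i - w i) * norm (F i)))"
      by (rule sum_mono) (rule 5)
    then show ?thesis using 4 unfolding sum.distrib by linarith
  qed
  moreover have "0 \<le> (\<Sum>i\<in>UNIV. (d i *\<^sub>R radial a v) \<bullet> F i) + (\<Sum>i\<in>UNIV. D * M * (norm v * norm (F i)))"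
    unfolding sum.distrib[symmetric] by (intro sum_nonneg 3)
  ultimately show ?thesis using 1 2 by (simp add: inner_add_left inner_add_right sum.distrib)
qed

text \<open>The integral of the terms that involve the test function vanishes by the weak form of the
  equation. Removing the mollification leaves only the error caused by the gradient of the cut-off
  function, which is of order \<open>1/R\<close>.\<close>

lemma dissipative_localized:
  assumes P: "profile a a' M" and u: "u \<in> Lp 2" and g: "g \<in> Lp 2"
    and w: "\<And>j. w j \<in> Lp 2" "\<And>j. weak_partial j u (w j)"
    and id: "\<And>\<phi>. \<phi> \<in> Cc_infty \<Longrightarrow> (\<Sum>i\<in>UNIV. LINT x|lebesgue. partial i \<phi> x *\<^sub>R flux w i x)
      + (LINT x|lebesgue. \<phi> x *\<^sub>R (cmatrix (V x) *v u x + g x)) = 0"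
    and R: "R > 0"
  shows "(LINT x|lebesgue. cutoff R x * (radial a (u x) \<bullet> g x))
    \<le> (\<Sum>i\<in>UNIV. 4 / R * M * (Lp_norm 2 u * Lp_norm 2 (flux w i)))"
proof -
  have M: "M \<ge> 0" using profile_bound_nonneg[OF P] .
  have F: "flux w i \<in> Lp 2" for i using w(1) by (rule flux_L2)
  note \<zeta> = cutoff[OF R, where 'd='d]
  have \<zeta>m: "cutoff R \<in> borel_measurable (lebesgue :: (real^'d) measure)"
    by (rule continuous_measurable_lebesgue[OF C1c_continuous[OF \<zeta>(1)]])
  obtain C where C: "C \<ge> 0"
    "AE x in lebesgue. norm x \<le> R \<longrightarrow> (\<forall>\<xi>. norm (cmatrix (V x) *v \<xi>) \<le> C * norm \<xi>)"
    by (rule potential_local_bound[OF V_Linf_loc])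
  have HI: "locally_integrable (\<lambda>x. cmatrix (V x) *v u x + g x)"
    by (intro locally_integrable_add potential_locally_integrable[OF V_Linf_loc u] L2_locally_integrable[OF g])
  have lhs: "integrable lebesgue (\<lambda>x. cutoff R x * (radial a (u x) \<bullet> g x))"
  proof (rule L2_bilinear_bound(1)[OF radial_L2[OF P u] g, of _ 1])
    show "(\<lambda>x. cutoff R x * (radial a (u x) \<bullet> g x)) \<in> borel_measurable lebesgue"
      by (intro borel_measurable_times \<zeta>m Lp_inner_measurable Lp_measurable[OF radial_L2[OF P u]] Lp_measurable[OF g])
    show "\<bar>cutoff R x * (radial a (u x) \<bullet> g x)\<bar> \<le> 1 * (norm (radial a (u x)) * norm (g x))" for x
      unfolding abs_mult using \<zeta>(2,3)[of x] Cauchy_Schwarz_ineq2[of "radial a (u x)" "g x"]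
      by (intro mult_mono) auto
  qed simp
  let ?v = "\<lambda>n. conv (standard_mollifier n) u" and ?w = "\<lambda>n i. conv (standard_mollifier n) (w i)"
  have vL: "?v n \<in> Lp 2" and vn: "Lp_norm 2 (?v n) \<le> Lp_norm 2 u" for n
    using mollify_L2[OF standard_mollifier u] by auto
  have wL: "?w n i \<in> Lp 2" for n i using mollify_L2[OF standard_mollifier w(1)] by auto
  have dv: "(\<lambda>x. ?v n x - u x) \<in> Lp 2" for n using vL u by (intro Lp_diff) auto
  have dw: "(\<lambda>x. ?w n i x - w i x) \<in> Lp 2" for n i using wL w by (intro Lp_diff) auto
  define E where "E n = 3 * M * (Lp_norm 2 (\<lambda>x. ?v n x - u x) * Lp_norm 2 g)
      + M * C * (Lp_norm 2 (\<lambda>x. ?v n x - u x) * Lp_norm 2 u)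
      + (\<Sum>i\<in>UNIV. 4 / R * M * (Lp_norm 2 u * Lp_norm 2 (flux w i)))
      + (\<Sum>i\<in>UNIV. 3 * M * (Lp_norm 2 (\<lambda>x. ?w n i x - w i x) * Lp_norm 2 (flux w i)))" for n
  have le: "(LINT x|lebesgue. cutoff R x * (radial a (u x) \<bullet> g x)) \<le> E n" for n
  proof -
    let ?W = "\<lambda>x. cutoff R x *\<^sub>R radial a (?v n x)"
    have vC1: "?v n \<in> C1"
      using conv_smooth[OF mollifierD(1)[OF standard_mollifier] L2_locally_integrable[OF u]]
      unfolding C1_def
      by (auto intro!: smooth_differentiable continuous_at_imp_continuous_on
          differentiable_imp_continuous_within smooth_partial)
    have pv: "partial i (?v n) = ?w n i" for i
      by (rule weak_partial_mollify[OF w(2) u standard_mollifier])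
    have WC: "?W \<in> C1c" using C1c_scaleR[OF C1c_C1[OF \<zeta>(1)] radial_C1(1)[OF P vC1]] \<zeta>(1) by blast
    have pW: "partial i ?W = (\<lambda>x. partial i (cutoff R) x *\<^sub>R radial a (?v n x)
        + cutoff R x *\<^sub>R radial_deriv a a' (?v n x) (?w n i x))" for i
      using C1_scaleR(2)[OF C1c_C1[OF \<zeta>(1)] radial_C1(1)[OF P vC1], of i] radial_C1(2)[OF P vC1, of i]
      by (simp add: pv)
    note weak = weak_identity_vector[OF L2_locally_integrable[OF F] HI id WC]
    let ?B = "\<lambda>x. (\<Sum>i\<in>UNIV. partial i ?W x \<bullet> flux w i x) + ?W x \<bullet> (cmatrix (V x) *v u x + g x)"
    let ?e1 = "\<lambda>x. 3 * M * (norm (?v n x - u x) * norm (g x))"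
    let ?e2 = "\<lambda>x. M * C * (norm (?v n x - u x) * norm (u x))"
    let ?e3 = "\<lambda>x. \<Sum>i\<in>UNIV. 4 / R * M * (norm (?v n x) * norm (flux w i x))"
    let ?e4 = "\<lambda>x. \<Sum>i\<in>UNIV. 3 * M * (norm (?w n i x - w i x) * norm (flux w i x))"
    have i1: "integrable lebesgue ?e1" using L2_norm_product(1)[OF dv g] by (rule integrable_mult_right)
    have i2: "integrable lebesgue ?e2" using L2_norm_product(1)[OF dv u] by (rule integrable_mult_right)
    have i3': "integrable lebesgue (\<lambda>x. 4 / R * M * (norm (?v n x) * norm (flux w i x)))" for i
      using L2_norm_product(1)[OF vL F] by (rule integrable_mult_right)
    have i4': "integrable lebesgue (\<lambda>x. 3 * M * (norm (?w n i x - w i x) * norm (flux w i x)))" for i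
      using L2_norm_product(1)[OF dw F] by (rule integrable_mult_right)
    have i3: "integrable lebesgue ?e3" by (intro Bochner_Integration.integrable_sum i3')
    have i4: "integrable lebesgue ?e4" by (intro Bochner_Integration.integrable_sum i4')
    note j1 = Bochner_Integration.integrable_add[OF weak(1) i1]
    note j2 = Bochner_Integration.integrable_add[OF j1 i2]
    note j3 = Bochner_Integration.integrable_add[OF j2 i3]
    have "(LINT x|lebesgue. cutoff R x * (radial a (u x) \<bullet> g x))
        \<le> (LINT x|lebesgue. ?B x + ?e1 x + ?e2 x + ?e3 x + ?e4 x)"
    proof (rule integral_mono_AE[OF lhs])
      show "integrable lebesgue (\<lambda>x. ?B x + ?e1 x + ?e2 x + ?e3 x + ?e4 x)"
        by (rule Bochner_Integration.integrable_add[OF j3 i4])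
      show "AE x in lebesgue. cutoff R x * (radial a (u x) \<bullet> g x) \<le> ?B x + ?e1 x + ?e2 x + ?e3 x + ?e4 x"
        using C(2)
      proof eventually_elim
        case (elim x)
        have c: "norm (cmatrix (V x) *v u x) \<le> C * norm (u x) \<or> cutoff R x = 0"
          using elim \<zeta>(4)[of x] by (cases "norm x \<le> R") auto
        show ?case unfolding pW
          by (rule dissipative_pointwise[OF P \<zeta>(2,3) \<zeta>(5) _ V_accretive c C(1)]) (simp add: flux_def)
      qed
    qed
    also have "\<dots> = (LINT x|lebesgue. ?B x) + (LINT x|lebesgue. ?e1 x) + (LINT x|lebesgue. ?e2 x)
        + (LINT x|lebesgue. ?e3 x) + (LINT x|lebesgue. ?e4 x)"
      by (simp only: Bochner_Integration.integral_add[OF j3 i4] Bochner_Integration.integral_add[OF j2 i3]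
          Bochner_Integration.integral_add[OF j1 i2] Bochner_Integration.integral_add[OF weak(1) i1])
    also have "(LINT x|lebesgue. ?B x) = 0" by (rule weak(2))
    also have "(LINT x|lebesgue. ?e1 x) \<le> 3 * M * (Lp_norm 2 (\<lambda>x. ?v n x - u x) * Lp_norm 2 g)"
      using L2_norm_product(2)[OF dv g] M by (simp add: mult_left_mono)
    also have "(LINT x|lebesgue. ?e2 x) \<le> M * C * (Lp_norm 2 (\<lambda>x. ?v n x - u x) * Lp_norm 2 u)"
      using L2_norm_product(2)[OF dv u] M C by (simp add: mult_left_mono)
    also have "(LINT x|lebesgue. ?e3 x) \<le> (\<Sum>i\<in>UNIV. 4 / R * M * (Lp_norm 2 u * Lp_norm 2 (flux w i)))"
    proof (subst Bochner_Integration.integral_sum[OF i3'], rule sum_mono)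
      fix i
      have "(LINT x|lebesgue. norm (?v n x) * norm (flux w i x)) \<le> Lp_norm 2 (?v n) * Lp_norm 2 (flux w i)"
        by (rule L2_norm_product(2)[OF vL F])
      also have "\<dots> \<le> Lp_norm 2 u * Lp_norm 2 (flux w i)" by (rule mult_right_mono[OF vn]) simp
      finally show "(LINT x|lebesgue. 4 / R * M * (norm (?v n x) * norm (flux w i x)))
          \<le> 4 / R * M * (Lp_norm 2 u * Lp_norm 2 (flux w i))"
        unfolding integral_mult_right_zero using M R by (intro mult_left_mono) auto
    qed
    also have "(LINT x|lebesgue. ?e4 x) \<le> (\<Sum>i\<in>UNIV. 3 * M * (Lp_norm 2 (\<lambda>x. ?w n i x - w i x) * Lp_norm 2 (flux w i)))"
    proof (subst Bochner_Integration.integral_sum[OF i4'], rule sum_mono)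
      fix i
      show "(LINT x|lebesgue. 3 * M * (norm (?w n i x - w i x) * norm (flux w i x)))
          \<le> 3 * M * (Lp_norm 2 (\<lambda>x. ?w n i x - w i x) * Lp_norm 2 (flux w i))"
        unfolding integral_mult_right_zero using M L2_norm_product(2)[OF dw F] by (intro mult_left_mono) auto
    qed
    finally show ?thesis by (simp add: E_def)
  qed
  have "E \<longlonglongrightarrow> 3 * M * (0 * Lp_norm 2 g) + M * C * (0 * Lp_norm 2 u)
      + (\<Sum>i\<in>UNIV. 4 / R * M * (Lp_norm 2 u * Lp_norm 2 (flux w i)))
      + (\<Sum>i::'d\<in>UNIV. 3 * M * (0 * Lp_norm 2 (flux w i)))"
    unfolding E_def by (intro tendsto_add tendsto_sum tendsto_mult tendsto_const mollify_L2_tendsto u w)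
  then have "E \<longlonglongrightarrow> (\<Sum>i\<in>UNIV. 4 / R * M * (Lp_norm 2 u * Lp_norm 2 (flux w i)))" by simp
  then show ?thesis by (rule LIMSEQ_le_const) (use le in auto)
qed

lemma dissipative:
  assumes P: "profile a a' M" and ug: "(u, g) \<in> op_A Q V"
  shows "(LINT x|lebesgue. radial a (u x) \<bullet> g x) \<le> 0"
proof -
  have u: "u \<in> Lp 2" and g: "g \<in> Lp 2" using ug by (auto simp: op_A_def H1_def)
  obtain w where w: "\<And>j. w j \<in> Lp 2" "\<And>j. weak_partial j u (w j)"
    and id: "\<And>\<phi>. \<phi> \<in> Cc_infty \<Longrightarrow> (\<Sum>i\<in>UNIV. LINT x|lebesgue. partial i \<phi> x *\<^sub>R flux w i x)
      + (LINT x|lebesgue. \<phi> x *\<^sub>R (cmatrix (V x) *v u x + g x)) = 0"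
    using op_A_weak_form[OF ug] by blast
  let ?K = "\<Sum>i\<in>UNIV. M * (Lp_norm 2 u * Lp_norm 2 (flux w i))"
  have le: "(LINT x|lebesgue. cutoff (real (Suc n)) x * (radial a (u x) \<bullet> g x)) \<le> 4 * ?K / real (Suc n)" for n
    using dissipative_localized[OF P u g w id, of "real (Suc n)"]
    by (simp add: sum_distrib_left sum_divide_distrib mult.assoc)
  have GL: "(\<lambda>x. radial a (u x)) \<in> Lp 2" by (rule radial_L2[OF P u])
  have "(\<lambda>n. LINT x|lebesgue. cutoff (real (Suc n)) x * (radial a (u x) \<bullet> g x))
      \<longlonglongrightarrow> (LINT x|lebesgue. radial a (u x) \<bullet> g x)"
  proof (rule integral_dominated_convergence[OF _ _ L2_norm_product(1)[OF GL g]])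
    show m: "(\<lambda>x. radial a (u x) \<bullet> g x) \<in> borel_measurable lebesgue"
      by (intro Lp_inner_measurable Lp_measurable[OF GL] Lp_measurable[OF g])
    show "(\<lambda>x. cutoff (real (Suc n)) x * (radial a (u x) \<bullet> g x)) \<in> borel_measurable lebesgue" for n
      by (intro borel_measurable_times m continuous_measurable_lebesgue C1c_continuous cutoff(1)) simp
    show "AE x in lebesgue. norm (cutoff (real (Suc n)) x * (radial a (u x) \<bullet> g x))
        \<le> norm (radial a (u x)) * norm (g x)" for n
    proof (rule AE_I2)
      fix x
      have "\<bar>cutoff (real (Suc n)) x\<bar> * \<bar>radial a (u x) \<bullet> g x\<bar> \<le> 1 * (norm (radial a (u x)) * norm (g x))"
        using cutoff(2,3)[of "real (Suc n)" x] Cauchy_Schwarz_ineq2[of "radial a (u x)" "g x"]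
        by (intro mult_mono) auto
      then show "norm (cutoff (real (Suc n)) x * (radial a (u x) \<bullet> g x)) \<le> norm (radial a (u x)) * norm (g x)"
        by (simp add: abs_mult)
    qed
    show "AE x in lebesgue. (\<lambda>n. cutoff (real (Suc n)) x * (radial a (u x) \<bullet> g x)) \<longlonglongrightarrow> radial a (u x) \<bullet> g x"
      using tendsto_mult[OF cutoff_tendsto tendsto_const] by (intro AE_I2) fastforce
  qed
  moreover have "(\<lambda>n. 4 * ?K / real (Suc n)) \<longlonglongrightarrow> 0" by (intro LIMSEQ_Suc[OF lim_const_over_n])
  ultimately show ?thesis by (rule LIMSEQ_le) (use le in auto)
qed

end

section \<open>Test functions in the domain\<close>

lemma C1_sum:
  fixes f :: "'i \<Rightarrow> real^'d::finite \<Rightarrow> 'b::euclidean_space"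
  assumes "\<And>j. j \<in> A \<Longrightarrow> f j \<in> C1"
  shows "(\<lambda>x. \<Sum>j\<in>A. f j x) \<in> C1"
proof -
  have d: "((\<lambda>x. \<Sum>j\<in>A. f j x) has_derivative (\<lambda>h. \<Sum>i\<in>UNIV. (h $ i) *\<^sub>R (\<Sum>j\<in>A. partial i (f j) x))) (at x)" for x
  proof -
    have "((\<lambda>x. \<Sum>j\<in>A. f j x) has_derivative (\<lambda>h. \<Sum>j\<in>A. \<Sum>i\<in>UNIV. (h $ i) *\<^sub>R partial i (f j) x)) (at x)"
      by (intro has_derivative_sum has_derivative_partial C1_differentiable assms)
    then show ?thesis by (subst (asm) sum.swap) (simp add: scaleR_sum_right)
  qed
  have c: "continuous_on UNIV (\<lambda>x. \<Sum>j\<in>A. partial i (f j) x)" for i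
    by (intro continuous_on_sum C1_partial_continuous assms)
  show ?thesis by (rule C1I(1)[OF d c])
qed

context schroedinger
begin

definition A_classical :: "(real^'d \<Rightarrow> complex^'m) \<Rightarrow> real^'d \<Rightarrow> complex^'m" where
  "A_classical u x = (\<Sum>i\<in>UNIV. partial i (flux (\<lambda>j. partial j u) i) x) - cmatrix (V x) *v u x"

lemma flux_C1c:
  assumes u: "u \<in> Cc_infty"
  shows "flux (\<lambda>j. partial j u) i \<in> C1c"
proof -
  obtain R where R: "\<forall>x. norm x > R \<longrightarrow> u x = 0" using u by (auto simp: Cc_infty_iff)
  have "flux (\<lambda>j. partial j u) i \<in> C1"
    unfolding flux_def[abs_def]
    by (intro C1_sum C1_scaleR(1) Q_entry_C1 C1c_C1 Cc_infty_C1c Cc_infty_partial u)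
  moreover have "\<forall>x. norm x > R \<longrightarrow> flux (\<lambda>j. partial j u) i x = 0"
    using partial_vanishes[OF R] by (simp add: flux_def)
  ultimately show ?thesis unfolding C1c_def by blast
qed

lemma A_classical_Lp:
  assumes u: "u \<in> Cc_infty" and p: "p > 0"
  shows "A_classical u \<in> Lp p"
proof -
  obtain R where R: "\<forall>x. norm x > R \<longrightarrow> u x = 0" using u by (auto simp: Cc_infty_iff)
  let ?D = "\<lambda>x. \<Sum>i\<in>UNIV. partial i (flux (\<lambda>j. partial j u) i) x"
  have fR: "\<forall>x. norm x > R \<longrightarrow> flux (\<lambda>j. partial j u) i x = 0" for i
    using partial_vanishes[OF R] by (simp add: flux_def)
  have D: "?D \<in> Lp p"
  proof (rule continuous_compact_Lp[OF _ _ p])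
    show "continuous_on UNIV ?D" by (intro continuous_on_sum C1c_partial_continuous flux_C1c u)
    show "\<forall>x. norm x > R \<longrightarrow> ?D x = 0" using partial_vanishes[OF fR] by simp
  qed
  obtain C where C: "C \<ge> 0"
    "AE x in lebesgue. norm x \<le> R \<longrightarrow> (\<forall>\<xi>. norm (cmatrix (V x) *v \<xi>) \<le> C * norm \<xi>)"
    by (rule potential_local_bound[OF V_Linf_loc])
  have uL: "u \<in> Lp p" by (rule Cc_infty_Lp[OF u p])
  have "(\<lambda>x. cmatrix (V x) *v u x) \<in> Lp p"
  proof (rule Lp_dominated[OF potential_measurable[OF V_Linf_loc Lp_measurable[OF uL]]])
    show "integrable lebesgue (\<lambda>x. C powr p * norm (u x) powr p)" using Lp_integrable[OF uL] by simp
    show "AE x in lebesgue. norm (cmatrix (V x) *v u x) powr p \<le> C powr p * norm (u x) powr p"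
      using C(2)
    proof eventually_elim
      case (elim x)
      have "norm (cmatrix (V x) *v u x) \<le> C * norm (u x)"
        using elim R by (cases "norm x \<le> R") (auto simp: not_le)
      then have "norm (cmatrix (V x) *v u x) powr p \<le> (C * norm (u x)) powr p"
        using p by (intro powr_mono2) auto
      then show ?case by (simp add: powr_mult)
    qed
  qed
  from Lp_diff[OF D this p] show ?thesis by (simp add: A_classical_def[abs_def])
qed

lemma weak_partial_Cc_infty: "u \<in> Cc_infty \<Longrightarrow> weak_partial j u (partial j u)"
  unfolding weak_partial_def distr_eq_def distr_partial_def distr_of_def
  using integration_by_parts[OF Cc_infty_C1c C1c_C1[OF Cc_infty_C1c]] by fastforce

lemma Cc_infty_L2: "u \<in> Cc_infty \<Longrightarrow> (u :: real^'d \<Rightarrow> complex^'m) \<in> Lp 2"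
  by (rule Cc_infty_Lp) auto

lemma calA_classical:
  assumes u: "u \<in> Cc_infty"
  shows "distr_eq (calA Q V u) (distr_of (A_classical u))"
  unfolding distr_eq_def
proof
  fix f :: "real^'d \<Rightarrow> real" assume f: "f \<in> Cc_infty"
  let ?F = "flux (\<lambda>j. partial j u)"
  have fC: "f \<in> C1c" by (rule Cc_infty_C1c[OF f])
  have "Delta_Q Q u f = - (\<Sum>i\<in>UNIV. LINT x|lebesgue. partial i f x *\<^sub>R ?F i x)"
    by (intro Delta_Q_weak Cc_infty_L2 Cc_infty_partial weak_partial_Cc_infty u f)
  also have "\<dots> = (\<Sum>i\<in>UNIV. LINT x|lebesgue. f x *\<^sub>R partial i (?F i) x)"
    using integration_by_parts[OF fC C1c_C1[OF flux_C1c[OF u]]] by (simp add: sum_negf)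
  also have "\<dots> = (LINT x|lebesgue. (\<Sum>i\<in>UNIV. f x *\<^sub>R partial i (?F i) x))"
  proof (rule Bochner_Integration.integral_sum[symmetric])
    fix i
    obtain R where "\<forall>x. norm x > R \<longrightarrow> f x = 0" using C1c_support[OF fC] by blast
    then show "integrable lebesgue (\<lambda>x. f x *\<^sub>R partial i (?F i) x)"
      by (intro integrable_continuous_compact[of _ R] continuous_on_scaleR C1c_continuous[OF fC]
          C1c_partial_continuous flux_C1c u) auto
  qed
  finally have D: "Delta_Q Q u f = (LINT x|lebesgue. (\<Sum>i\<in>UNIV. f x *\<^sub>R partial i (?F i) x))" .
  have i: "integrable lebesgue (\<lambda>x. f x *\<^sub>R (cmatrix (V x) *v u x))"
    by (rule locally_integrable_test(1)[OF fC potential_locally_integrable[OF V_Linf_loc Cc_infty_L2[OF u]]])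
  have j: "integrable lebesgue (\<lambda>x. f x *\<^sub>R A_classical u x)"
    by (rule locally_integrable_test(1)[OF fC L2_locally_integrable[OF A_classical_Lp[OF u]]]) simp
  have "(LINT x|lebesgue. (\<Sum>i\<in>UNIV. f x *\<^sub>R partial i (?F i) x))
      = (LINT x|lebesgue. f x *\<^sub>R A_classical u x + f x *\<^sub>R (cmatrix (V x) *v u x))"
    by (rule Bochner_Integration.integral_cong)
      (auto simp: A_classical_def scaleR_sum_right scaleR_diff_right)
  also have "\<dots> = (LINT x|lebesgue. f x *\<^sub>R A_classical u x) + (LINT x|lebesgue. f x *\<^sub>R (cmatrix (V x) *v u x))"
    using i j by (rule Bochner_Integration.integral_add[rotated])
  finally show "calA Q V u f = distr_of (A_classical u) f"
    using D by (simp add: calA_def distr_of_def)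
qed

lemma Cc_infty_op_A:
  assumes u: "u \<in> Cc_infty"
  shows "(u, A_classical u) \<in> op_A Q V"
  unfolding op_A_def H1_def
  using Cc_infty_L2[OF u] A_classical_Lp[OF u, of 2] calA_classical[OF u]
    weak_partial_Cc_infty[OF u] Cc_infty_L2[OF Cc_infty_partial[OF u]]
  by (auto simp: weak_partial_def)

end

section \<open>Semigroups on Lebesgue spaces\<close>

lemma bounded_operatorD:
  assumes "bounded_operator p S"
  shows "f \<in> Lp p \<Longrightarrow> S f \<in> Lp p"
    and "f \<in> Lp p \<Longrightarrow> g \<in> Lp p \<Longrightarrow> AE x in lebesgue. S (\<lambda>y. c *s f y + g y) x = c *s S f x + S g x"
  using assms unfolding bounded_operator_def by blast+

lemma bounded_operator_zero:
  assumes S: "bounded_operator p S"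
  shows "AE x in lebesgue. S (\<lambda>y. 0) x = 0"
  using bounded_operatorD(2)[OF S Lp_zero Lp_zero, of "-1"] by simp

lemma bounded_operator_smult:
  assumes S: "bounded_operator p S" and "f \<in> Lp p"
  shows "AE x in lebesgue. S (\<lambda>y. c *s f y) x = c *s S f x"
  using bounded_operatorD(2)[OF assms Lp_zero, of c] bounded_operator_zero[OF S]
  by (eventually_elim) simp

lemma bounded_operator_scaleR:
  assumes S: "bounded_operator p S" and "f \<in> Lp p"
  shows "AE x in lebesgue. S (\<lambda>y. r *\<^sub>R f y) x = r *\<^sub>R S f x"
  using bounded_operator_smult[OF assms, of "of_real r"] by (simp add: smult_of_real)

lemma bounded_operator_diff:
  assumes S: "bounded_operator p S" and f: "f \<in> Lp p" and g: "g \<in> Lp p"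
  shows "AE x in lebesgue. S (\<lambda>y. f y - g y) x = S f x - S g x"
  using bounded_operatorD(2)[OF S g f, of "-1"] by (simp add: algebra_simps)

locale contraction_semigroup =
  fixes T :: "real \<Rightarrow> (real^'d::finite \<Rightarrow> complex^'m::finite) \<Rightarrow> (real^'d \<Rightarrow> complex^'m)"
  assumes semigroup: "C0_semigroup 2 T" and contr: "contractions 2 T"
begin

lemma T_bounded: "t \<ge> 0 \<Longrightarrow> bounded_operator 2 (T t)"
  using semigroup by (simp add: C0_semigroup_def)

lemma T_L2: "t \<ge> 0 \<Longrightarrow> f \<in> Lp 2 \<Longrightarrow> T t f \<in> Lp 2"
  using bounded_operatorD(1)[OF T_bounded] .

lemma T_norm: "t \<ge> 0 \<Longrightarrow> f \<in> Lp 2 \<Longrightarrow> Lp_norm 2 (T t f) \<le> Lp_norm 2 f"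
  using contr by (simp add: contractions_def)

lemma T_zero: "f \<in> Lp 2 \<Longrightarrow> AE x in lebesgue. T 0 f x = f x"
  using semigroup by (simp add: C0_semigroup_def)

lemma T_add: "s \<ge> 0 \<Longrightarrow> t \<ge> 0 \<Longrightarrow> f \<in> Lp 2 \<Longrightarrow> AE x in lebesgue. T (s + t) f x = T s (T t f) x"
  using semigroup by (simp add: C0_semigroup_def)

lemma T_tendsto: "f \<in> Lp 2 \<Longrightarrow> ((\<lambda>t. Lp_norm 2 (\<lambda>x. T t f x - f x)) \<longlongrightarrow> 0) (at_right 0)"
  using semigroup by (simp add: C0_semigroup_def)

lemma T_diff_norm:
  assumes "t \<ge> 0" "f \<in> Lp 2" "g \<in> Lp 2"
  shows "Lp_norm 2 (\<lambda>x. T t f x - T t g x) \<le> Lp_norm 2 (\<lambda>x. f x - g x)"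
proof -
  have d: "(\<lambda>y. f y - g y) \<in> Lp 2" using assms by (intro Lp_diff) auto
  have "Lp_norm 2 (\<lambda>x. T t f x - T t g x) = Lp_norm 2 (T t (\<lambda>y. f y - g y))"
    by (rule Lp_norm_cong_AE[symmetric])
      (use bounded_operator_diff[OF T_bounded[OF assms(1)] assms(2,3)] Lp_measurable[OF T_L2[OF assms(1) d]] in auto)
  then show ?thesis using T_norm[OF assms(1) d] by simp
qed

lemma generator_invariant:
  assumes fg: "(f, g) \<in> generator 2 T" and t: "t \<ge> 0"
  shows "(T t f, T t g) \<in> generator 2 T"
proof -
  have f: "f \<in> Lp 2" and g: "g \<in> Lp 2"
    and lim: "((\<lambda>h. Lp_norm 2 (\<lambda>x. (1 / h) *\<^sub>R (T h f x - f x) - g x)) \<longlongrightarrow> 0) (at_right 0)"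
    using fg by (auto simp: generator_def)
  have le: "Lp_norm 2 (\<lambda>x. (1 / h) *\<^sub>R (T h (T t f) x - T t f x) - T t g x)
      \<le> Lp_norm 2 (\<lambda>x. (1 / h) *\<^sub>R (T h f x - f x) - g x)" if h: "h > 0" for h
  proof -
    have Th: "T h f \<in> Lp 2" using T_L2 h f by simp
    have d: "(\<lambda>x. T h f x - f x) \<in> Lp 2" using Th f by (intro Lp_diff) auto
    have s: "(\<lambda>x. (1 / h) *\<^sub>R (T h f x - f x)) \<in> Lp 2" using d by (rule Lp_scaleR)
    have e: "(\<lambda>x. (1 / h) *\<^sub>R (T h f x - f x) - g x) \<in> Lp 2" using s g by (intro Lp_diff) auto
    note B = T_bounded[OF t]
    have "AE x in lebesgue. T t (\<lambda>x. (1 / h) *\<^sub>R (T h f x - f x) - g x) x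
        = (1 / h) *\<^sub>R (T h (T t f) x - T t f x) - T t g x"
      using bounded_operator_diff[OF B s g] bounded_operator_scaleR[OF B d, of "1 / h"]
        bounded_operator_diff[OF B Th f] T_add[OF t less_imp_le[OF h] f] T_add[OF less_imp_le[OF h] t f]
      by eventually_elim (simp add: add.commute)
    then have "Lp_norm 2 (\<lambda>x. (1 / h) *\<^sub>R (T h (T t f) x - T t f x) - T t g x)
        = Lp_norm 2 (T t (\<lambda>x. (1 / h) *\<^sub>R (T h f x - f x) - g x))"
      by (intro Lp_norm_cong_AE[symmetric] Lp_measurable[OF T_L2[OF t e]])
    also have "\<dots> \<le> Lp_norm 2 (\<lambda>x. (1 / h) *\<^sub>R (T h f x - f x) - g x)" by (rule T_norm[OF t e])
    finally show ?thesis .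
  qed
  have "((\<lambda>h. Lp_norm 2 (\<lambda>x. (1 / h) *\<^sub>R (T h (T t f) x - T t f x) - T t g x)) \<longlongrightarrow> 0) (at_right 0)"
  proof (rule Lim_null_comparison[OF _ lim])
    show "\<forall>\<^sub>F h in at_right 0. norm (Lp_norm 2 (\<lambda>x. (1 / h) *\<^sub>R (T h (T t f) x - T t f x) - T t g x))
        \<le> Lp_norm 2 (\<lambda>x. (1 / h) *\<^sub>R (T h f x - f x) - g x)"
      using le by (auto simp: eventually_at_right_field intro!: exI[of _ 1])
  qed
  then show ?thesis using T_L2[OF t] f g by (auto simp: generator_def)
qed

text \<open>The error of one implicit Euler step.\<close>

definition euler_error :: "(real^'d \<Rightarrow> complex^'m) \<Rightarrow> (real^'d \<Rightarrow> complex^'m) \<Rightarrow> real \<Rightarrow> real" where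
  "euler_error f g h = Lp_norm 2 (\<lambda>x. T h f x - f x - h *\<^sub>R T h g x)"

lemma euler_error_tendsto:
  assumes fg: "(f, g) \<in> generator 2 T"
  shows "((\<lambda>h. euler_error f g h / h) \<longlongrightarrow> 0) (at_right 0)"
proof (rule Lim_null_comparison)
  have f: "f \<in> Lp 2" and g: "g \<in> Lp 2"
    and lim: "((\<lambda>h. Lp_norm 2 (\<lambda>x. (1 / h) *\<^sub>R (T h f x - f x) - g x)) \<longlongrightarrow> 0) (at_right 0)"
    using fg by (auto simp: generator_def)
  show "((\<lambda>h. Lp_norm 2 (\<lambda>x. (1 / h) *\<^sub>R (T h f x - f x) - g x) + Lp_norm 2 (\<lambda>x. T h g x - g x)) \<longlongrightarrow> 0) (at_right 0)"
    using tendsto_add[OF lim T_tendsto[OF g]] by simp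
  have "norm (euler_error f g h / h) \<le> Lp_norm 2 (\<lambda>x. (1 / h) *\<^sub>R (T h f x - f x) - g x) + Lp_norm 2 (\<lambda>x. T h g x - g x)"
    if h: "h > 0" for h
  proof -
    have Th: "T h f \<in> Lp 2" "T h g \<in> Lp 2" using T_L2 h f g by auto
    have s: "(\<lambda>x. (1 / h) *\<^sub>R (T h f x - f x)) \<in> Lp 2" using Th f by (intro Lp_scaleR Lp_diff) auto
    have "euler_error f g h / h = \<bar>1 / h\<bar> * euler_error f g h" using h by simp
    also have "\<dots> = Lp_norm 2 (\<lambda>x. (1 / h) *\<^sub>R (T h f x - f x - h *\<^sub>R T h g x))"
      unfolding euler_error_def by (rule Lp_norm_scaleR[symmetric]) simp
    also have "\<dots> = Lp_norm 2 (\<lambda>x. (1 / h) *\<^sub>R (T h f x - f x) - T h g x)"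
      using h by (simp add: scaleR_diff_right)
    also have "\<dots> \<le> Lp_norm 2 (\<lambda>x. (1 / h) *\<^sub>R (T h f x - f x) - g x) + Lp_norm 2 (\<lambda>x. g x - T h g x)"
      using s g Th by (intro Lp_norm_triangle_diff) auto
    finally show ?thesis using h by (simp add: Lp_norm_minus_commute[of 2 g] euler_error_def)
  qed
  then show "\<forall>\<^sub>F h in at_right 0. norm (euler_error f g h / h)
      \<le> Lp_norm 2 (\<lambda>x. (1 / h) *\<^sub>R (T h f x - f x) - g x) + Lp_norm 2 (\<lambda>x. T h g x - g x)"
    by (auto simp: eventually_at_right_field intro!: exI[of _ 1])
qed

lemma euler_error_steps:
  assumes fg: "(f, g) \<in> generator 2 T" and t: "t > 0"
  shows "(\<lambda>n. real (Suc n) * euler_error f g (t / real (Suc n))) \<longlonglongrightarrow> 0"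
proof -
  have "filterlim (\<lambda>n. t / real (Suc n)) (at_right 0) sequentially"
    unfolding filterlim_at
    using LIMSEQ_Suc[OF lim_const_over_n[of t]] t by (auto intro!: always_eventually)
  from filterlim_compose[OF euler_error_tendsto[OF fg] this]
  have "(\<lambda>n. t * (euler_error f g (t / real (Suc n)) / (t / real (Suc n)))) \<longlonglongrightarrow> t * 0"
    by (intro tendsto_mult_left)
  moreover have "t * (euler_error f g (t / real (Suc n)) / (t / real (Suc n)))
      = real (Suc n) * euler_error f g (t / real (Suc n))" for n
    using t by simp
  ultimately show ?thesis by (simp only: mult_zero_right)
qed

end

section \<open>Convex functionals decrease along the semigroup\<close>

definition energy :: "(real \<Rightarrow> real) \<Rightarrow> (real^'d::finite \<Rightarrow> complex^'m::finite) \<Rightarrow> real" where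
  "energy F f = (LINT x|lebesgue. F ((norm (f x))\<^sup>2))"

definition primitive :: "(real \<Rightarrow> real) \<Rightarrow> (real \<Rightarrow> real) \<Rightarrow> bool" where
  "primitive F a \<longleftrightarrow> F 0 = 0 \<and> (\<forall>s\<ge>0. (F has_real_derivative a s) (at s))"

lemma primitiveD: "primitive F a \<Longrightarrow> F 0 = 0" "primitive F a \<Longrightarrow> s \<ge> 0 \<Longrightarrow> (F has_real_derivative a s) (at s)"
  by (auto simp: primitive_def)

lemma energy_integrable:
  fixes f :: "real^'d::finite \<Rightarrow> complex^'m::finite"
  assumes P: "profile a a' M" and F: "primitive F a" and f: "f \<in> Lp 2"
  shows "integrable lebesgue (\<lambda>x. F ((norm (f x))\<^sup>2))"
proof -
  have Fc: "continuous_on {0..} F"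
    using primitiveD(2)[OF F] by (auto intro!: continuous_at_imp_continuous_on DERIV_isCont)
  have c: "continuous_on UNIV (\<lambda>z::complex^'m. F ((norm z)\<^sup>2))"
    by (rule continuous_on_compose2[OF Fc]) (auto intro!: continuous_intros)
  show ?thesis
  proof (rule L2_bilinear_bound(1)[OF f f, of _ "2 * M"])
    show "(\<lambda>x. F ((norm (f x))\<^sup>2)) \<in> borel_measurable lebesgue"
      by (rule borel_measurable_continuous_on[OF c Lp_measurable[OF f]])
    show "2 * M \<ge> 0" using profile_bound_nonneg[OF P] by simp
    show "\<bar>F ((norm (f x))\<^sup>2)\<bar> \<le> 2 * M * (norm (f x) * norm (f x))" for x
      using radial_F_lipschitz[OF P primitiveD(2)[OF F], of "f x" 0] primitiveD(1)[OF F] by simp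
  qed
qed

lemma energy_lipschitz:
  fixes f g :: "real^'d::finite \<Rightarrow> complex^'m::finite"
  assumes P: "profile a a' M" and F: "primitive F a" and f: "f \<in> Lp 2" and g: "g \<in> Lp 2"
  shows "\<bar>energy F f - energy F g\<bar> \<le> 2 * M * ((Lp_norm 2 f + Lp_norm 2 g) * Lp_norm 2 (\<lambda>x. f x - g x))"
proof -
  have M: "M \<ge> 0" using profile_bound_nonneg[OF P] .
  have d: "(\<lambda>x. f x - g x) \<in> Lp 2" using f g by (intro Lp_diff) auto
  note i = energy_integrable[OF P F f] energy_integrable[OF P F g]
  note j = L2_norm_product(1)[OF f d] L2_norm_product(1)[OF g d]
  have "\<bar>energy F f - energy F g\<bar> = \<bar>LINT x|lebesgue. F ((norm (f x))\<^sup>2) - F ((norm (g x))\<^sup>2)\<bar>"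
    using i by (simp add: energy_def)
  also have "\<dots> \<le> (LINT x|lebesgue. \<bar>F ((norm (f x))\<^sup>2) - F ((norm (g x))\<^sup>2)\<bar>)"
    using integral_norm_bound[of lebesgue "\<lambda>x. F ((norm (f x))\<^sup>2) - F ((norm (g x))\<^sup>2)"] by simp
  also have "\<dots> \<le> (LINT x|lebesgue. 2 * M * (norm (f x) * norm (f x - g x) + norm (g x) * norm (f x - g x)))"
  proof (rule integral_mono)
    show "integrable lebesgue (\<lambda>x. \<bar>F ((norm (f x))\<^sup>2) - F ((norm (g x))\<^sup>2)\<bar>)" using i by simp
    show "integrable lebesgue (\<lambda>x. 2 * M * (norm (f x) * norm (f x - g x) + norm (g x) * norm (f x - g x)))"
      using j by simp
    show "\<bar>F ((norm (f x))\<^sup>2) - F ((norm (g x))\<^sup>2)\<bar>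
        \<le> 2 * M * (norm (f x) * norm (f x - g x) + norm (g x) * norm (f x - g x))" for x
      using radial_F_lipschitz[OF P primitiveD(2)[OF F], of "f x" "g x"] by (simp add: distrib_right)
  qed
  also have "\<dots> = 2 * M * ((LINT x|lebesgue. norm (f x) * norm (f x - g x)) + (LINT x|lebesgue. norm (g x) * norm (f x - g x)))"
    using j by simp
  also have "\<dots> \<le> 2 * M * (Lp_norm 2 f * Lp_norm 2 (\<lambda>x. f x - g x) + Lp_norm 2 g * Lp_norm 2 (\<lambda>x. f x - g x))"
    using M L2_norm_product(2)[OF f d] L2_norm_product(2)[OF g d] by (intro mult_left_mono add_mono) auto
  finally show ?thesis by (simp add: distrib_right)
qed

lemma energy_cong_AE:
  assumes P: "profile a a' M" and F: "primitive F a" and f: "f \<in> Lp 2" and g: "g \<in> Lp 2"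
    and eq: "AE x in lebesgue. f x = g x"
  shows "energy F f = energy F g"
  unfolding energy_def
  by (rule integral_cong_AE)
    (use eq borel_measurable_integrable[OF energy_integrable[OF P F f]]
      borel_measurable_integrable[OF energy_integrable[OF P F g]] in auto)

locale schroedinger_semigroup = schroedinger Q V + contraction_semigroup T
  for Q :: "real^'d::finite \<Rightarrow> real^'d^'d" and V :: "real^'d \<Rightarrow> real^'m::finite^'m"
    and T :: "real \<Rightarrow> (real^'d \<Rightarrow> complex^'m) \<Rightarrow> (real^'d \<Rightarrow> complex^'m)" +
  assumes T_generator: "generator 2 T = op_A Q V"
begin

text \<open>Convexity bounds the increment of the energy over one step by the derivative at the
  new time, where dissipativity applies; what remains is of size \<open>o(h)\<close>, uniformly in time.\<close>

lemma energy_step: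
  assumes P: "profile a a' M" and F: "primitive F a" and fg: "(f, g) \<in> generator 2 T"
    and s: "s \<ge> 0" and h: "h > 0"
  shows "energy F (T (s + h) f) - energy F (T s f) \<le> 2 * M * Lp_norm 2 f * euler_error f g h"
proof -
  have M: "M \<ge> 0" using profile_bound_nonneg[OF P] .
  have f: "f \<in> Lp 2" and g: "g \<in> Lp 2" using fg by (auto simp: generator_def)
  have sh: "s + h \<ge> 0" "h \<ge> 0" using s h by auto
  let ?u = "T (s + h) f" and ?v = "T s f" and ?w = "T (s + h) g"
  let ?e = "\<lambda>x. T h f x - f x - h *\<^sub>R T h g x"
  have L: "?u \<in> Lp 2" "?v \<in> Lp 2" "?w \<in> Lp 2" "T h f \<in> Lp 2" "T h g \<in> Lp 2"
    using T_L2 sh s f g by auto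
  have d1: "(\<lambda>x. T h f x - f x) \<in> Lp 2" using L f by (intro Lp_diff) auto
  have d2: "(\<lambda>x. h *\<^sub>R T h g x) \<in> Lp 2" using L by (intro Lp_scaleR)
  have e: "?e \<in> Lp 2" by (rule Lp_diff[OF d1 d2]) simp
  have Te: "T s ?e \<in> Lp 2" by (rule T_L2[OF s e])
  note B = T_bounded[OF s]
  have eq: "AE x in lebesgue. ?u x - ?v x = h *\<^sub>R ?w x + T s ?e x"
    using bounded_operator_diff[OF B d1 d2] bounded_operator_diff[OF B L(4) f]
      bounded_operator_scaleR[OF B L(5), of h] T_add[OF s sh(2) f] T_add[OF s sh(2) g]
    by eventually_elim simp
  have G: "(\<lambda>x. radial a (?u x)) \<in> Lp 2" by (rule radial_L2[OF P L(1)])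
  have "(?u, ?w) \<in> op_A Q V" using generator_invariant[OF fg sh(1)] T_generator by simp
  then have diss: "(LINT x|lebesgue. radial a (?u x) \<bullet> ?w x) \<le> 0" by (rule dissipative[OF P])
  have i1: "integrable lebesgue (\<lambda>x. radial a (?u x) \<bullet> ?w x)" by (rule L2_inner_integrable(1)[OF G L(3)])
  have i2: "integrable lebesgue (\<lambda>x. radial a (?u x) \<bullet> T s ?e x)" by (rule L2_inner_integrable(1)[OF G Te])
  note iF = energy_integrable[OF P F L(1)] energy_integrable[OF P F L(2)]
  have "energy F ?u - energy F ?v = (LINT x|lebesgue. F ((norm (?u x))\<^sup>2) - F ((norm (?v x))\<^sup>2))"
    using iF by (simp add: energy_def)
  also have "\<dots> \<le> (LINT x|lebesgue. 2 * h * (radial a (?u x) \<bullet> ?w x) + 2 * (radial a (?u x) \<bullet> T s ?e x))"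
  proof (rule integral_mono_AE)
    show "integrable lebesgue (\<lambda>x. F ((norm (?u x))\<^sup>2) - F ((norm (?v x))\<^sup>2))" using iF by simp
    show "integrable lebesgue (\<lambda>x. 2 * h * (radial a (?u x) \<bullet> ?w x) + 2 * (radial a (?u x) \<bullet> T s ?e x))"
      using i1 i2 by simp
    show "AE x in lebesgue. F ((norm (?u x))\<^sup>2) - F ((norm (?v x))\<^sup>2)
        \<le> 2 * h * (radial a (?u x) \<bullet> ?w x) + 2 * (radial a (?u x) \<bullet> T s ?e x)"
      using eq
    proof eventually_elim
      case (elim x)
      then show ?case
        using radial_convex[OF P primitiveD(2)[OF F], of "?u x" "?v x"] by (simp add: inner_add_right)
    qed
  qed
  also have "\<dots> = 2 * h * (LINT x|lebesgue. radial a (?u x) \<bullet> ?w x) + 2 * (LINT x|lebesgue. radial a (?u x) \<bullet> T s ?e x)"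
    using i1 i2 by simp
  also have "\<dots> \<le> 0 + 2 * (M * (Lp_norm 2 f * euler_error f g h))"
  proof (intro add_mono mult_left_mono)
    show "2 * h * (LINT x|lebesgue. radial a (?u x) \<bullet> ?w x) \<le> 0" using h diss by (simp add: mult_nonneg_nonpos)
    have "\<bar>LINT x|lebesgue. radial a (?u x) \<bullet> T s ?e x\<bar> \<le> M * (Lp_norm 2 ?u * Lp_norm 2 (T s ?e))"
    proof (rule L2_bilinear_bound(2)[OF L(1) Te _ M])
      show "(\<lambda>x. radial a (?u x) \<bullet> T s ?e x) \<in> borel_measurable lebesgue"
        using i2 by (rule borel_measurable_integrable)
      show "\<bar>radial a (?u x) \<bullet> T s ?e x\<bar> \<le> M * (norm (?u x) * norm (T s ?e x))" for x
        using Cauchy_Schwarz_ineq2[of "radial a (?u x)" "T s ?e x"] mult_right_mono[OF radial_bound[OF P, of "?u x"], of "norm (T s ?e x)"]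
        by simp
    qed
    also have "\<dots> \<le> M * (Lp_norm 2 f * euler_error f g h)"
      unfolding euler_error_def
      using M T_norm[OF sh(1) f] T_norm[OF s e] by (intro mult_left_mono mult_mono) auto
    finally show "(LINT x|lebesgue. radial a (?u x) \<bullet> T s ?e x) \<le> M * (Lp_norm 2 f * euler_error f g h)" by simp
  qed simp
  finally show ?thesis by (simp add: mult_ac)
qed

text \<open>Summing \<open>n\<close> steps of size \<open>t/n\<close> leaves \<open>n\<close> errors of size \<open>o(t/n)\<close>.\<close>

lemma energy_decreasing_generator:
  assumes P: "profile a a' M" and F: "primitive F a" and fg: "(f, g) \<in> generator 2 T" and t: "t \<ge> 0"
  shows "energy F (T t f) \<le> energy F f"
proof -
  have f: "f \<in> Lp 2" using fg by (auto simp: generator_def)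
  have T0: "energy F (T 0 f) = energy F f"
    by (rule energy_cong_AE[OF P F T_L2[OF _ f] f T_zero[OF f]]) simp
  show ?thesis
  proof (cases "t = 0")
    case False
    with t have t: "t > 0" by simp
    let ?r = "\<lambda>n. euler_error f g (t / real (Suc n))"
    have "energy F (T t f) - energy F f \<le> 2 * M * Lp_norm 2 f * (real (Suc n) * ?r n)" for n
    proof -
      let ?h = "t / real (Suc n)"
      have h: "?h > 0" using t by simp
      have "energy F (T (real k * ?h) f) - energy F f \<le> real k * (2 * M * Lp_norm 2 f * ?r n)" for k
      proof (induction k)
        case (Suc k)
        have "energy F (T (real k * ?h + ?h) f) - energy F (T (real k * ?h) f) \<le> 2 * M * Lp_norm 2 f * ?r n"
          by (rule energy_step[OF P F fg _ h]) (use t in simp)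
        moreover have "real (Suc k) * ?h = real k * ?h + ?h" by (simp add: distrib_right add_divide_distrib)
        ultimately show ?case using Suc by (simp add: distrib_right)
      qed (simp add: T0)
      from this[of "Suc n"] show ?thesis by (simp del: of_nat_Suc add: mult_ac)
    qed
    moreover have "(\<lambda>n. 2 * M * Lp_norm 2 f * (real (Suc n) * ?r n)) \<longlonglongrightarrow> 2 * M * Lp_norm 2 f * 0"
      by (intro tendsto_mult_left euler_error_steps[OF fg t])
    ultimately have "energy F (T t f) - energy F f \<le> 2 * M * Lp_norm 2 f * 0"
      by (intro LIMSEQ_le_const) auto
    then show ?thesis by simp
  qed (simp add: T0)
qed

lemma energy_decreasing:
  assumes P: "profile a a' M" and F: "primitive F a" and f: "f \<in> Lp 2" and t: "t \<ge> 0"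
  shows "energy F (T t f) \<le> energy F f"
proof -
  have M: "M \<ge> 0" using profile_bound_nonneg[OF P] .
  let ?C = "8 * M * (Lp_norm 2 f + 1)"
  have "energy F (T t f) - energy F f \<le> 0"
  proof (rule nonpos_if_le_all_eps)
    show "?C \<ge> 0" using M by (simp add: add_nonneg_nonneg)
    fix e :: real assume "e > 0"
    then have e: "min e 1 > 0" by simp
    obtain g where g: "g \<in> Cc_infty" "Lp_norm 2 (\<lambda>x. f x - g x) < min e 1"
      using Cc_infty_dense_L2[OF f e] by blast
    have gL: "g \<in> Lp 2" by (rule Cc_infty_L2[OF g(1)])
    have gn: "Lp_norm 2 g \<le> Lp_norm 2 f + 1"
      using Lp_norm_le_add_diff[OF gL f] g(2) by (simp add: Lp_norm_minus_commute[of 2 g])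
    have bound: "\<bar>energy F u - energy F v\<bar> \<le> ?C / 2 * e"
      if "u \<in> Lp 2" "v \<in> Lp 2" "Lp_norm 2 u \<le> Lp_norm 2 f + 1" "Lp_norm 2 v \<le> Lp_norm 2 f + 1"
        "Lp_norm 2 (\<lambda>x. u x - v x) \<le> e" for u v :: "real^'d \<Rightarrow> complex^'m"
    proof -
      have "\<bar>energy F u - energy F v\<bar> \<le> 2 * M * ((Lp_norm 2 u + Lp_norm 2 v) * Lp_norm 2 (\<lambda>x. u x - v x))"
        by (rule energy_lipschitz[OF P F that(1,2)])
      also have "\<dots> \<le> 2 * M * ((2 * (Lp_norm 2 f + 1)) * e)"
        using that(3,4,5) M by (intro mult_left_mono mult_mono) auto
      finally show ?thesis by (simp add: algebra_simps)
    qed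
    have "energy F (T t f) - energy F (T t g) \<le> ?C / 2 * e"
    proof -
      have "Lp_norm 2 (T t f) \<le> Lp_norm 2 f + 1" using T_norm[OF t f] by simp
      moreover have "Lp_norm 2 (T t g) \<le> Lp_norm 2 f + 1" using T_norm[OF t gL] gn by simp
      moreover have "Lp_norm 2 (\<lambda>x. T t f x - T t g x) \<le> e"
        using T_diff_norm[OF t f gL] g(2) by simp
      ultimately show ?thesis using bound[OF T_L2[OF t f] T_L2[OF t gL]] by simp
    qed
    moreover have "energy F g - energy F f \<le> ?C / 2 * e"
      using bound[OF f gL] gn g(2) by (simp add: abs_le_iff)
    moreover have "energy F (T t g) \<le> energy F g"
      using Cc_infty_op_A[OF g(1)] T_generator by (intro energy_decreasing_generator[OF P F _ t]) simp
    ultimately show "energy F (T t f) - energy F f \<le> e * ?C" by (simp add: algebra_simps)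
  qed
  then show ?thesis by simp
qed

end

section \<open>Contractivity in all Lebesgue spaces\<close>

text \<open>With \<open>\<sigma> = s + \<epsilon>\<close> the function \<open>power_profile q \<epsilon>\<close> is the derivative, as a function of
  \<open>\<sigma>\<close>, of \<open>\<sigma>\<^sup>q (1 + \<epsilon> \<sigma>)\<^bsup>1 - q\<^esup>\<close>. This is smooth near \<open>0\<close>, grows linearly at infinity, and
  tends to \<open>s\<^sup>q\<close> for \<open>\<epsilon> \<rightarrow> 0\<close>; for \<open>q > 1/2\<close> it leads to a convex function of \<open>z\<close>.\<close>

definition power_profile :: "real \<Rightarrow> real \<Rightarrow> real \<Rightarrow> real" where
  "power_profile q \<epsilon> s = (s + \<epsilon>) powr (q - 1) * (1 + \<epsilon> * (s + \<epsilon>)) powr (- q) * (q + \<epsilon> * (s + \<epsilon>))"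

definition power_profile_deriv :: "real \<Rightarrow> real \<Rightarrow> real \<Rightarrow> real" where
  "power_profile_deriv q \<epsilon> s = q * (q - 1) * ((s + \<epsilon>) powr (q - 2) * (1 + \<epsilon> * (s + \<epsilon>)) powr (- q - 1))"

definition power_primitive :: "real \<Rightarrow> real \<Rightarrow> real \<Rightarrow> real" where
  "power_primitive q \<epsilon> s = (s + \<epsilon>) powr q * (1 + \<epsilon> * (s + \<epsilon>)) powr (1 - q)
    - \<epsilon> powr q * (1 + \<epsilon> * \<epsilon>) powr (1 - q)"

lemma powr_shift_DERIV:
  assumes "s + \<epsilon> > (0::real)"
  shows "((\<lambda>s. (s + \<epsilon>) powr r) has_real_derivative r * (s + \<epsilon>) powr (r - 1)) (at s)"
proof -
  have "((\<lambda>s. s + \<epsilon>) has_real_derivative 1) (at s)" by (auto intro!: derivative_eq_intros)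
  from DERIV_chain2[where f="\<lambda>z. z powr r" and g="\<lambda>s. s + \<epsilon>", OF has_real_derivative_powr[OF assms] this]
  show ?thesis by simp
qed

lemma powr_affine_DERIV:
  assumes "1 + \<epsilon> * (s + \<epsilon>) > (0::real)"
  shows "((\<lambda>s. (1 + \<epsilon> * (s + \<epsilon>)) powr r) has_real_derivative r * (1 + \<epsilon> * (s + \<epsilon>)) powr (r - 1) * \<epsilon>) (at s)"
  by (rule DERIV_chain2[where f="\<lambda>z. z powr r" and g="\<lambda>s. 1 + \<epsilon> * (s + \<epsilon>)", OF has_real_derivative_powr[OF assms]])
    (auto intro!: derivative_eq_intros)

lemma reciprocal_powr: "x > 0 \<Longrightarrow> (1 / x) powr r = x powr (- r)" for x :: real
  by (simp add: powr_divide powr_minus_divide)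

lemma power_primitive_DERIV:
  assumes e: "\<epsilon> > 0" and s: "s \<ge> 0"
  shows "(power_primitive q \<epsilon> has_real_derivative power_profile q \<epsilon> s) (at s)"
proof -
  define x where "x = s + \<epsilon>"
  define y where "y = 1 + \<epsilon> * x"
  have x: "x > 0" using e s by (simp add: x_def)
  have y: "y > 0" using e x by (simp add: y_def add_pos_pos)
  have "(power_primitive q \<epsilon> has_real_derivative
      q * x powr (q - 1) * y powr (1 - q) + ((1 - q) * y powr (1 - q - 1) * \<epsilon>) * x powr q - 0) (at s)"
    unfolding power_primitive_def[abs_def] x_def y_def
    by (intro DERIV_diff DERIV_mult powr_shift_DERIV powr_affine_DERIV DERIV_const)
      (use x y in \<open>simp_all add: x_def y_def\<close>)
  moreover have "q * x powr (q - 1) * y powr (1 - q) + ((1 - q) * y powr (1 - q - 1) * \<epsilon>) * x powr q - 0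
      = x powr (q - 1) * y powr (- q) * (q + \<epsilon> * x)"
  proof -
    have 1: "y powr (1 - q) = y * y powr (- q)" using powr_add[of y 1 "- q"] y by simp
    have 2: "x powr q = x * x powr (q - 1)" using powr_add[of x 1 "q - 1"] x by simp
    have "q * x powr (q - 1) * y powr (1 - q) + ((1 - q) * y powr (1 - q - 1) * \<epsilon>) * x powr q
        = x powr (q - 1) * y powr (- q) * (q * y + (1 - q) * \<epsilon> * x)"
      unfolding 1 2 by (simp add: algebra_simps)
    also have "q * y + (1 - q) * \<epsilon> * x = q + \<epsilon> * x" by (simp add: y_def algebra_simps)
    finally show ?thesis by simp
  qed
  ultimately show ?thesis by (simp add: power_profile_def x_def y_def)
qed

lemma power_profile_DERIV:
  assumes e: "\<epsilon> > 0" and s: "s \<ge> 0"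
  shows "(power_profile q \<epsilon> has_real_derivative power_profile_deriv q \<epsilon> s) (at s)"
proof -
  define x where "x = s + \<epsilon>"
  define y where "y = 1 + \<epsilon> * x"
  have x: "x > 0" using e s by (simp add: x_def)
  have y: "y > 0" using e x by (simp add: y_def add_pos_pos)
  have 0: "((\<lambda>s. q + \<epsilon> * (s + \<epsilon>)) has_real_derivative \<epsilon>) (at s)" by (auto intro!: derivative_eq_intros)
  have "(power_profile q \<epsilon> has_real_derivative
      ((q - 1) * x powr (q - 1 - 1) * y powr (- q) + (- q * y powr (- q - 1) * \<epsilon>) * x powr (q - 1)) * (q + \<epsilon> * x)
        + \<epsilon> * (x powr (q - 1) * y powr (- q))) (at s)"
    unfolding power_profile_def[abs_def] x_def y_def
    by (intro DERIV_mult powr_shift_DERIV powr_affine_DERIV 0)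
      (use x y in \<open>simp_all add: x_def y_def\<close>)
  moreover have "((q - 1) * x powr (q - 1 - 1) * y powr (- q) + (- q * y powr (- q - 1) * \<epsilon>) * x powr (q - 1)) * (q + \<epsilon> * x)
        + \<epsilon> * (x powr (q - 1) * y powr (- q)) = q * (q - 1) * (x powr (q - 2) * y powr (- q - 1))"
  proof -
    have 1: "y powr (- q) = y * y powr (- q - 1)" using powr_add[of y 1 "- q - 1"] y by simp
    have 2: "x powr (q - 1) = x * x powr (q - 2)" using powr_add[of x 1 "q - 2"] x by simp
    have 3: "q - 1 - 1 = q - 2" by simp
    have "((q - 1) * x powr (q - 1 - 1) * y powr (- q) + (- q * y powr (- q - 1) * \<epsilon>) * x powr (q - 1)) * (q + \<epsilon> * x)
        + \<epsilon> * (x powr (q - 1) * y powr (- q))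
        = x powr (q - 2) * y powr (- q - 1) * (((q - 1) * y - q * \<epsilon> * x) * (q + \<epsilon> * x) + \<epsilon> * x * y)"
      unfolding 1 2 3 by (simp add: algebra_simps)
    also have "((q - 1) * y - q * \<epsilon> * x) * (q + \<epsilon> * x) + \<epsilon> * x * y = q * (q - 1)"
      by (simp add: y_def algebra_simps)
    finally show ?thesis by (simp add: mult_ac)
  qed
  ultimately show ?thesis by (simp add: power_profile_deriv_def x_def y_def)
qed

lemma power_profile_le:
  assumes e: "\<epsilon> > 0" and s: "s \<ge> 0" and q: "q > 0"
  shows "0 \<le> power_profile q \<epsilon> s"
    and "power_profile q \<epsilon> s \<le> (q + 1) * ((s + \<epsilon>) / (1 + \<epsilon> * (s + \<epsilon>))) powr (q - 1)"
    and "\<bar>power_profile_deriv q \<epsilon> s\<bar> * s \<le> q * (q + 1) * ((s + \<epsilon>) / (1 + \<epsilon> * (s + \<epsilon>))) powr (q - 1)"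
proof -
  define x where "x = s + \<epsilon>"
  define y where "y = 1 + \<epsilon> * x"
  have x: "x > 0" using e s by (simp add: x_def)
  have y: "y > 0" "y \<ge> 1" using e x by (auto simp: y_def add_pos_pos)
  have 1: "y powr (- q) = (1 / y) * y powr (- (q - 1))" using powr_add[of y "-1" "- (q - 1)"] y
    by (simp add: powr_minus_divide)
  have t: "(x / y) powr (q - 1) = x powr (q - 1) * y powr (- (q - 1))"
    using x y powr_minus_divide[of y "q - 1"] by (simp add: powr_divide)
  have eq: "power_profile q \<epsilon> s = ((q + \<epsilon> * x) / y) * (x / y) powr (q - 1)"
    unfolding power_profile_def x_def[symmetric] y_def[symmetric] t 1 by simp
  have r: "0 \<le> (q + \<epsilon> * x) / y" "(q + \<epsilon> * x) / y \<le> q + 1"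
  proof -
    show "0 \<le> (q + \<epsilon> * x) / y" using q e x y by simp
    have "q + \<epsilon> * x \<le> (q + 1) * y" using q e x by (simp add: y_def algebra_simps)
    then show "(q + \<epsilon> * x) / y \<le> q + 1" using y by (simp add: field_simps)
  qed
  show "0 \<le> power_profile q \<epsilon> s" unfolding eq by (intro mult_nonneg_nonneg r) simp
  show "power_profile q \<epsilon> s \<le> (q + 1) * ((s + \<epsilon>) / (1 + \<epsilon> * (s + \<epsilon>))) powr (q - 1)"
    unfolding eq x_def[symmetric] y_def[symmetric] using r by (intro mult_right_mono) auto
  have 2: "x powr (q - 1) = x * x powr (q - 2)" using powr_add[of x 1 "q - 2"] x by simp
  have "\<bar>power_profile_deriv q \<epsilon> s\<bar> * s = (q * \<bar>q - 1\<bar>) * (s * x powr (q - 2) * y powr (- q - 1))"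
    unfolding power_profile_deriv_def x_def[symmetric] y_def[symmetric] using q by (simp add: abs_mult mult_ac)
  also have "\<dots> \<le> (q * (q + 1)) * (x * x powr (q - 2) * y powr (- (q - 1)))"
  proof -
    have A: "q * \<bar>q - 1\<bar> \<le> q * (q + 1)" using q by (intro mult_left_mono) auto
    have B: "s * x powr (q - 2) \<le> x * x powr (q - 2)" using e by (intro mult_right_mono) (auto simp: x_def)
    have C: "y powr (- q - 1) \<le> y powr (- (q - 1))" using y by (intro powr_mono) auto
    show ?thesis by (intro mult_mono A B C) (use q s x in auto)
  qed
  finally show "\<bar>power_profile_deriv q \<epsilon> s\<bar> * s \<le> q * (q + 1) * ((s + \<epsilon>) / (1 + \<epsilon> * (s + \<epsilon>))) powr (q - 1)"
    unfolding x_def[symmetric] y_def[symmetric] t 2 by simp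
qed

lemma power_profile_radially_convex:
  assumes e: "\<epsilon> > 0" and s: "s \<ge> 0" and q: "q > 1/2"
  shows "0 \<le> power_profile q \<epsilon> s + 2 * s * power_profile_deriv q \<epsilon> s"
proof -
  define x where "x = s + \<epsilon>"
  define y where "y = 1 + \<epsilon> * x"
  have x: "x > 0" "s \<le> x" using e s by (auto simp: x_def)
  have y: "y > 0" "y \<ge> 1" using e x by (auto simp: y_def add_pos_pos)
  have 1: "y powr (- q) = y * y powr (- q - 1)" using powr_add[of y 1 "- q - 1"] y by simp
  have 2: "x powr (q - 1) = x * x powr (q - 2)" using powr_add[of x 1 "q - 2"] x by simp
  have eq: "power_profile q \<epsilon> s + 2 * s * power_profile_deriv q \<epsilon> s
      = x powr (q - 2) * y powr (- q - 1) * (x * y * (q + \<epsilon> * x) + 2 * s * q * (q - 1))"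
    unfolding power_profile_def power_profile_deriv_def x_def[symmetric] y_def[symmetric] 1 2
    by (simp add: algebra_simps)
  have "s * 1 * q \<le> x * y * (q + \<epsilon> * x)" using x y s q e by (intro mult_mono) auto
  moreover have "0 \<le> s * q * (2 * q - 1)" using s q by simp
  ultimately have "0 \<le> x * y * (q + \<epsilon> * x) + 2 * s * q * (q - 1)" by (simp add: algebra_simps)
  then show ?thesis unfolding eq by simp
qed

lemma profile_power_profile:
  assumes e: "\<epsilon> > 0" and q: "q > 1/2"
  obtains M where "profile (power_profile q \<epsilon>) (power_profile_deriv q \<epsilon>) M"
proof -
  define K where "K = (\<epsilon> / (1 + \<epsilon> * \<epsilon>)) powr (q - 1) + (1 / \<epsilon>) powr (q - 1)"
  have K: "((s + \<epsilon>) / (1 + \<epsilon> * (s + \<epsilon>))) powr (q - 1) \<le> K" if s: "s \<ge> 0" for s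
  proof -
    have pos: "1 + \<epsilon> * (s + \<epsilon>) > 0" "1 + \<epsilon> * \<epsilon> > 0" using e s by (auto intro!: add_pos_nonneg)
    have l: "\<epsilon> / (1 + \<epsilon> * \<epsilon>) \<le> (s + \<epsilon>) / (1 + \<epsilon> * (s + \<epsilon>))" and u: "(s + \<epsilon>) / (1 + \<epsilon> * (s + \<epsilon>)) \<le> 1 / \<epsilon>"
      using e s pos by (simp_all add: field_simps)
    have p: "0 < \<epsilon> / (1 + \<epsilon> * \<epsilon>)" using e pos by simp
    show ?thesis
    proof (cases "q \<ge> 1")
      case True
      then have "((s + \<epsilon>) / (1 + \<epsilon> * (s + \<epsilon>))) powr (q - 1) \<le> (1 / \<epsilon>) powr (q - 1)"
        using u l p by (intro powr_mono2) auto
      then show ?thesis by (simp add: K_def add_increasing)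
    next
      case False
      then have "((s + \<epsilon>) / (1 + \<epsilon> * (s + \<epsilon>))) powr (q - 1) \<le> (\<epsilon> / (1 + \<epsilon> * \<epsilon>)) powr (q - 1)"
        using l p by (intro powr_mono2') auto
      then show ?thesis by (simp add: K_def add_increasing2)
    qed
  qed
  have K0: "K \<ge> 0" by (simp add: K_def)
  show ?thesis
  proof (rule that[of "(q + 1) * (q + 1) * K"])
    have q0: "q > 0" using q by simp
    have cont: "continuous_on {0..} (power_profile_deriv q \<epsilon>)"
      unfolding power_profile_deriv_def[abs_def] using e
      by (intro continuous_intros) (auto simp: add_nonneg_eq_0_iff intro!: less_imp_neq[symmetric] add_pos_nonneg)
    show "profile (power_profile q \<epsilon>) (power_profile_deriv q \<epsilon>) ((q + 1) * (q + 1) * K)"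
      unfolding profile_def
    proof (intro conjI allI impI cont)
      fix s :: real assume s: "s \<ge> 0"
      show "(power_profile q \<epsilon> has_real_derivative power_profile_deriv q \<epsilon> s) (at s)"
        by (rule power_profile_DERIV[OF e s])
      show "0 \<le> power_profile q \<epsilon> s" by (rule power_profile_le(1)[OF e s q0])
      have "power_profile q \<epsilon> s \<le> (q + 1) * K"
        by (rule order_trans[OF power_profile_le(2)[OF e s q0] mult_left_mono[OF K[OF s]]]) (use q0 in simp)
      also have "\<dots> \<le> (q + 1) * (q + 1) * K" using q0 K0 by (intro mult_right_mono) auto
      finally show "power_profile q \<epsilon> s \<le> (q + 1) * (q + 1) * K" .
      have "\<bar>power_profile_deriv q \<epsilon> s\<bar> * s \<le> q * (q + 1) * K"
        by (rule order_trans[OF power_profile_le(3)[OF e s q0] mult_left_mono[OF K[OF s]]]) (use q0 in simp)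
      also have "\<dots> \<le> (q + 1) * (q + 1) * K" using q0 K0 by (intro mult_right_mono) auto
      finally show "\<bar>power_profile_deriv q \<epsilon> s\<bar> * s \<le> (q + 1) * (q + 1) * K" .
      show "0 \<le> power_profile q \<epsilon> s + 2 * s * power_profile_deriv q \<epsilon> s"
        by (rule power_profile_radially_convex[OF e s q])
    qed
  qed
qed

lemma primitive_power_primitive:
  assumes e: "\<epsilon> > 0"
  shows "primitive (power_primitive q \<epsilon>) (power_profile q \<epsilon>)"
  unfolding primitive_def using power_primitive_DERIV[OF e] by (simp add: power_primitive_def)

lemma power_primitive_nonneg:
  assumes e: "\<epsilon> > 0" and q: "q > 0" and s: "s \<ge> 0"
  shows "0 \<le> power_primitive q \<epsilon> s"
proof -
  have "power_primitive q \<epsilon> 0 \<le> power_primitive q \<epsilon> s"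
    by (rule DERIV_nonneg_imp_nondecreasing[OF s])
      (use power_primitive_DERIV[OF e] power_profile_le(1)[OF e _ q] in blast)
  then show ?thesis by (simp add: power_primitive_def)
qed

text \<open>The upper bound is uniform in \<open>\<epsilon>\<close> and integrable for functions in both \<open>L\<^sup>2\<close> and \<open>L\<^sup>p\<close>, where
  \<open>p = 2 q\<close>. It is obtained by comparing derivatives.\<close>

lemma power_primitive_le:
  assumes e: "\<epsilon> > 0" "\<epsilon> \<le> 1" and q: "q > 0" and s: "s \<ge> 0"
  shows "power_primitive q \<epsilon> s \<le> (q + 1) * 2 powr \<bar>q - 1\<bar> * (s powr q / q + s)"
proof -
  let ?C = "(q + 1) * 2 powr \<bar>q - 1\<bar>"
  have bound: "power_profile q \<epsilon> s \<le> ?C * (s powr (q - 1) + 1)" if s: "s > 0" for s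
  proof -
    let ?t = "(s + \<epsilon>) / (1 + \<epsilon> * (s + \<epsilon>))"
    have pos: "1 + \<epsilon> * (s + \<epsilon>) > 0" using e s by (auto intro!: add_pos_nonneg)
    have t: "?t > 0" using e s pos by simp
    have "?t powr (q - 1) \<le> 2 powr \<bar>q - 1\<bar> * (s powr (q - 1) + 1)"
    proof (cases "q \<ge> 1")
      case True
      have "?t \<le> (s + \<epsilon>) / 1" using e s by (intro divide_left_mono) (auto intro!: mult_pos_pos pos)
      then have "?t \<le> s + 1" using e by simp
      then have "?t powr (q - 1) \<le> (s + 1) powr (q - 1)" using t True by (intro powr_mono2) auto
      also have "\<dots> \<le> 2 powr (q - 1) * (s powr (q - 1) + 1 powr (q - 1))"
        using s True by (intro powr_add_le) auto
      finally show ?thesis using True by simp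
    next
      case False
      have "1 / ?t = 1 / (s + \<epsilon>) + \<epsilon>" using e s pos by (simp add: field_simps)
      also have "\<dots> \<le> 1 / s + 1" using e s by (intro add_mono divide_left_mono) auto
      finally have le: "1 / ?t \<le> 1 / s + 1" .
      have t': "1 / ?t \<ge> 0" using t by (simp only: zero_le_divide_1_iff less_imp_le)
      have "?t powr (q - 1) = (1 / ?t) powr (1 - q)" using reciprocal_powr[OF t, of "1 - q"] by simp
      also have "\<dots> \<le> (1 / s + 1) powr (1 - q)" by (rule powr_mono2[OF _ t' le]) (use False in simp)
      also have "\<dots> \<le> 2 powr (1 - q) * ((1 / s) powr (1 - q) + 1 powr (1 - q))"
        using s False by (intro powr_add_le) auto
      also have "(1 / s) powr (1 - q) = s powr (q - 1)" using reciprocal_powr[OF s, of "1 - q"] by simp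
      finally show ?thesis using False by simp
    qed
    then have "(q + 1) * ?t powr (q - 1) \<le> (q + 1) * (2 powr \<bar>q - 1\<bar> * (s powr (q - 1) + 1))"
      using q by (intro mult_left_mono) auto
    then show ?thesis using power_profile_le(2)[OF e(1) less_imp_le[OF s] q] by (simp add: mult_ac)
  qed
  let ?H = "\<lambda>s. ?C * (s powr q / q + s) - power_primitive q \<epsilon> s"
  have "?H 0 \<le> ?H s"
  proof (rule DERIV_nonneg_imp_increasing_open[OF s])
    fix r assume r: "0 < r" "r < s"
    have "(?H has_real_derivative ?C * (q * r powr (q - 1) / q + 1) - power_profile q \<epsilon> r) (at r)"
      using r q by (intro DERIV_diff DERIV_cmult DERIV_add DERIV_cdivide has_real_derivative_powr DERIV_ident
          power_primitive_DERIV[OF e(1)]) auto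
    moreover have "0 \<le> ?C * (q * r powr (q - 1) / q + 1) - power_profile q \<epsilon> r"
      using bound[OF r(1)] q by simp
    ultimately show "\<exists>y. (?H has_real_derivative y) (at r) \<and> 0 \<le> y" by blast
  next
    have c1: "continuous_on {0..s} (power_primitive q \<epsilon>)"
      using power_primitive_DERIV[OF e(1)] by (auto intro!: continuous_at_imp_continuous_on DERIV_isCont)
    have c2: "continuous_on {0..s} (\<lambda>s. s powr q)"
      using q by (intro continuous_on_powr' continuous_intros) auto
    show "continuous_on {0..s} ?H"
      by (intro continuous_on_diff continuous_on_mult continuous_on_add continuous_on_divide
          continuous_on_const continuous_on_id c1 c2) (use q in simp)
  qed
  then show ?thesis using q by (simp add: power_primitive_def)
qed

lemma power_primitive_tendsto:
  assumes q: "q > 0" and s: "s \<ge> 0"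
  shows "(\<lambda>n. power_primitive q (1 / real (Suc n)) s) \<longlonglongrightarrow> s powr q"
proof -
  have e: "(\<lambda>n. 1 / real (Suc n)) \<longlonglongrightarrow> 0" by (rule LIMSEQ_Suc[OF lim_1_over_n])
  have "(\<lambda>n. power_primitive q (1 / real (Suc n)) s)
      \<longlonglongrightarrow> (s + 0) powr q * (1 + 0 * (s + 0)) powr (1 - q) - 0 powr q * (1 + 0 * 0) powr (1 - q)"
    unfolding power_primitive_def
    by (intro tendsto_diff tendsto_mult tendsto_powr' tendsto_add tendsto_const e) (use q s in auto)
  then show ?thesis by simp
qed

lemma norm_square_powr: "((norm z)\<^sup>2) powr (p / 2) = norm z powr p"
proof -
  have "((norm z)\<^sup>2) powr (p / 2) = (norm z powr 2) powr (p / 2)" by simp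
  then show ?thesis by (simp only: powr_powr) simp
qed

context schroedinger_semigroup
begin

text \<open>On the initial value the limit \<open>\<epsilon> \<rightarrow> 0\<close> is taken by dominated convergence, on \<open>T(t) f\<close> by Fatou's
  lemma, which also shows that \<open>T(t) f\<close> belongs to \<open>L\<^sup>p\<close>.\<close>

lemma Lp_contractive:
  assumes p: "p > 1" and t: "t \<ge> 0" and f2: "f \<in> Lp 2" and fp: "f \<in> Lp p"
  shows "T t f \<in> Lp p" "Lp_norm p (T t f) \<le> Lp_norm p f"
proof -
  define q where "q = p / 2"
  have q: "q > 1/2" "q > 0" using p by (auto simp: q_def)
  let ?e = "\<lambda>n. 1 / real (Suc n)"
  let ?F = "\<lambda>n. power_primitive q (?e n)"
  have e: "?e n > 0" "?e n \<le> 1" for n by auto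
  have Tf: "T t f \<in> Lp 2" by (rule T_L2[OF t f2])
  note [measurable] = Lp_measurable[OF Tf] Lp_measurable[OF f2]
  have F: "primitive (?F n) (power_profile q (?e n))" for n by (rule primitive_power_primitive[OF e(1)])
  have prof: "\<exists>M. profile (power_profile q (?e n)) (power_profile_deriv q (?e n)) M" for n
    using profile_power_profile[OF e(1) q(1)] by metis
  have int: "integrable lebesgue (\<lambda>x. ?F n ((norm (u x))\<^sup>2))" if "u \<in> Lp 2" for n and u :: "real^'d \<Rightarrow> complex^'m"
    using prof[of n] energy_integrable[OF _ F that] by blast
  have dec: "energy (?F n) (T t f) \<le> energy (?F n) f" for n
    using prof[of n] energy_decreasing[OF _ F f2 t] by blast
  have lim: "(\<lambda>n. ?F n ((norm z)\<^sup>2)) \<longlonglongrightarrow> norm z powr p" for z :: "complex^'m"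
    using power_primitive_tendsto[OF q(2), of "(norm z)\<^sup>2"] by (simp add: q_def norm_square_powr)
  have "(\<lambda>n. energy (?F n) f) \<longlonglongrightarrow> (LINT x|lebesgue. norm (f x) powr p)"
    unfolding energy_def
  proof (rule integral_dominated_convergence)
    let ?C = "(q + 1) * 2 powr \<bar>q - 1\<bar>"
    show "integrable lebesgue (\<lambda>x. ?C * (norm (f x) powr p / q + (norm (f x))\<^sup>2))"
      using Lp_integrable[OF fp] L2_integrable[OF f2] by simp
    show "AE x in lebesgue. norm (?F n ((norm (f x))\<^sup>2)) \<le> ?C * (norm (f x) powr p / q + (norm (f x))\<^sup>2)" for n
    proof (rule AE_I2)
      fix x
      have "0 \<le> ?F n ((norm (f x))\<^sup>2)" by (rule power_primitive_nonneg[OF e(1) q(2)]) simp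
      moreover have "?F n ((norm (f x))\<^sup>2) \<le> ?C * (((norm (f x))\<^sup>2) powr q / q + (norm (f x))\<^sup>2)"
        by (rule power_primitive_le[OF e q(2)]) simp
      ultimately show "norm (?F n ((norm (f x))\<^sup>2)) \<le> ?C * (norm (f x) powr p / q + (norm (f x))\<^sup>2)"
        by (simp add: q_def norm_square_powr)
    qed
    show "(\<lambda>x. ?F n ((norm (f x))\<^sup>2)) \<in> borel_measurable lebesgue" for n
      using int[OF f2] by (rule borel_measurable_integrable)
    show "AE x in lebesgue. (\<lambda>n. ?F n ((norm (f x))\<^sup>2)) \<longlonglongrightarrow> norm (f x) powr p" using lim by simp
  qed measurable
  then have limE: "(\<lambda>n. ennreal (energy (?F n) f)) \<longlonglongrightarrow> ennreal (LINT x|lebesgue. norm (f x) powr p)"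
    by (rule tendsto_ennrealI)
  have "(\<integral>\<^sup>+x. ennreal (norm (T t f x) powr p) \<partial>lebesgue)
      = (\<integral>\<^sup>+x. liminf (\<lambda>n. ennreal (?F n ((norm (T t f x))\<^sup>2))) \<partial>lebesgue)"
    using lim_imp_Liminf[OF sequentially_bot tendsto_ennrealI[OF lim]] by simp
  also have "\<dots> \<le> liminf (\<lambda>n. \<integral>\<^sup>+x. ennreal (?F n ((norm (T t f x))\<^sup>2)) \<partial>lebesgue)"
    by (rule nn_integral_liminf) (use borel_measurable_integrable[OF int[OF Tf]] in measurable)
  also have "\<dots> \<le> liminf (\<lambda>n. ennreal (energy (?F n) f))"
  proof (rule Liminf_mono[OF always_eventually], rule allI)
    fix n
    have "(\<integral>\<^sup>+x. ennreal (?F n ((norm (T t f x))\<^sup>2)) \<partial>lebesgue) = ennreal (energy (?F n) (T t f))"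
      unfolding energy_def
      by (rule nn_integral_eq_integral[OF int[OF Tf]]) (intro AE_I2 power_primitive_nonneg[OF e(1) q(2)], simp)
    also have "\<dots> \<le> ennreal (energy (?F n) f)" using dec by (rule ennreal_leI)
    finally show "(\<integral>\<^sup>+x. ennreal (?F n ((norm (T t f x))\<^sup>2)) \<partial>lebesgue) \<le> ennreal (energy (?F n) f)" .
  qed
  also have "\<dots> = ennreal (LINT x|lebesgue. norm (f x) powr p)"
    by (rule lim_imp_Liminf[OF sequentially_bot limE])
  finally have le: "(\<integral>\<^sup>+x. ennreal (norm (T t f x) powr p) \<partial>lebesgue) \<le> ennreal (LINT x|lebesgue. norm (f x) powr p)" .
  have i: "integrable lebesgue (\<lambda>x. norm (T t f x) powr p)"
    by (intro integrableI_bounded) (use le in \<open>auto simp: le_less_trans\<close>)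
  then show "T t f \<in> Lp p" using Lp_measurable[OF Tf] by (simp add: Lp_def)
  have "(LINT x|lebesgue. norm (T t f x) powr p) \<le> (LINT x|lebesgue. norm (f x) powr p)"
    using le nn_integral_eq_integral[OF i] by (simp add: ennreal_le_iff integral_nonneg_AE)
  then show "Lp_norm p (T t f) \<le> Lp_norm p f"
    using p by (simp add: Lp_norm_le_iff Lp_norm_powr)
qed

end

section \<open>Riemann sums of semigroup orbits\<close>

lemma Lp_eq_AE_if_close:
  fixes f g :: "real^'d::finite \<Rightarrow> complex^'m::finite"
  assumes "f \<in> Lp p" "g \<in> Lp p" "p > 0" "C \<ge> 0"
    and "\<And>e. e > 0 \<Longrightarrow> Lp_norm p (\<lambda>x. f x - g x) \<le> e * C"
  shows "AE x in lebesgue. f x = g x"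
proof -
  have "Lp_norm p (\<lambda>x. f x - g x) \<le> 0" using assms(4,5) by (rule nonpos_if_le_all_eps)
  then have "Lp_norm p (\<lambda>x. f x - g x) = 0" by (simp add: order_antisym)
  then show ?thesis using Lp_norm_eq_0_iff[OF Lp_diff[OF assms(1,2,3)] assms(3)] by simp
qed

context contraction_semigroup
begin

lemma euler_step_norm:
  assumes fg: "(f, g) \<in> generator 2 T" and s: "s \<ge> 0" and h: "h \<ge> 0"
  shows "Lp_norm 2 (\<lambda>x. T (s + h) f x - T s f x - h *\<^sub>R T (s + h) g x) \<le> euler_error f g h"
proof -
  have f: "f \<in> Lp 2" and g: "g \<in> Lp 2" using fg by (auto simp: generator_def)
  let ?e = "\<lambda>x. T h f x - f x - h *\<^sub>R T h g x"
  have L: "T h f \<in> Lp 2" "T h g \<in> Lp 2" using T_L2 h f g by auto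
  have d1: "(\<lambda>x. T h f x - f x) \<in> Lp 2" using L f by (intro Lp_diff) auto
  have d2: "(\<lambda>x. h *\<^sub>R T h g x) \<in> Lp 2" using L by (intro Lp_scaleR)
  have e: "?e \<in> Lp 2" by (rule Lp_diff[OF d1 d2]) simp
  note B = T_bounded[OF s]
  have "AE x in lebesgue. T s ?e x = T (s + h) f x - T s f x - h *\<^sub>R T (s + h) g x"
    using bounded_operator_diff[OF B d1 d2] bounded_operator_diff[OF B L(1) f]
      bounded_operator_scaleR[OF B L(2), of h] T_add[OF s h f] T_add[OF s h g]
    by eventually_elim simp
  then have "Lp_norm 2 (\<lambda>x. T (s + h) f x - T s f x - h *\<^sub>R T (s + h) g x) = Lp_norm 2 (T s ?e)"
    by (intro Lp_norm_cong_AE[symmetric] Lp_measurable[OF T_L2[OF s e]])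
  also have "\<dots> \<le> euler_error f g h" unfolding euler_error_def by (rule T_norm[OF s e])
  finally show ?thesis .
qed

text \<open>Summing the Euler errors compares the Riemann sums of \<open>\<integral>\<^sub>0\<^sup>t T(s) g ds\<close> with \<open>T(t) f - f\<close>, so that no
  integral of a function with values in \<open>L\<^sup>2\<close> is involved.\<close>

lemma riemann_sum_error:
  assumes fg: "(f, g) \<in> generator 2 T" and h: "h \<ge> 0"
  shows "Lp_norm 2 (\<lambda>x. (\<Sum>k<n. h *\<^sub>R T (real (Suc k) * h) g x) - (T (real n * h) f x - f x))
    \<le> real n * euler_error f g h"
proof (induction n)
  case 0
  have f: "f \<in> Lp 2" using fg by (auto simp: generator_def)
  have "Lp_norm 2 (\<lambda>x. - (T 0 f x - f x)) = Lp_norm 2 (\<lambda>x::real^'d. 0::complex^'m)"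
    using T_zero[OF f] by (intro Lp_norm_cong_AE Lp_measurable[of _ 2] Lp_minus Lp_diff T_L2 f) auto
  then show ?case by simp
next
  case (Suc n)
  have f: "f \<in> Lp 2" and g: "g \<in> Lp 2" using fg by (auto simp: generator_def)
  have nh: "real k * h \<ge> 0" for k using h by simp
  have S: "(\<lambda>x. \<Sum>k<n. h *\<^sub>R T (real (Suc k) * h) g x) \<in> Lp 2"
    by (intro Lp_sum(1) Lp_scaleR T_L2[OF nh g]) simp_all
  let ?A = "\<lambda>x. (\<Sum>k<n. h *\<^sub>R T (real (Suc k) * h) g x) - (T (real n * h) f x - f x)"
  let ?B = "\<lambda>x. T (real n * h + h) f x - T (real n * h) f x - h *\<^sub>R T (real n * h + h) g x"
  have eq: "real (Suc n) * h = real n * h + h" by (simp add: distrib_right)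
  have A: "?A \<in> Lp 2" using S T_L2[OF nh f] f by (intro Lp_diff) auto
  have nh': "real n * h + h \<ge> 0" using nh[of "Suc n"] eq by simp
  have B: "?B \<in> Lp 2" using T_L2[OF nh f] T_L2[OF nh' f] T_L2[OF nh' g] by (intro Lp_diff Lp_scaleR) auto
  have "Lp_norm 2 (\<lambda>x. (\<Sum>k<Suc n. h *\<^sub>R T (real (Suc k) * h) g x) - (T (real (Suc n) * h) f x - f x))
      = Lp_norm 2 (\<lambda>x. ?A x - ?B x)"
    by (simp only: eq sum.lessThan_Suc) (simp add: algebra_simps)
  also have "\<dots> \<le> Lp_norm 2 ?A + Lp_norm 2 ?B" using A B by (intro Lp_norm_diff_le) auto
  also have "\<dots> \<le> real n * euler_error f g h + euler_error f g h"
    by (intro add_mono Suc.IH euler_step_norm fg nh h)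
  finally show ?case by (simp add: distrib_right)
qed

end

section \<open>Generator and extension in the Lebesgue spaces\<close>

context schroedinger_semigroup
begin

lemma Lp_T_diff:
  assumes p: "p > 1" and t: "t \<ge> 0" and f: "f \<in> Lp 2" "f \<in> Lp p" and g: "g \<in> Lp 2" "g \<in> Lp p"
  shows "Lp_norm p (\<lambda>x. T t f x - T t g x) \<le> Lp_norm p (\<lambda>x. f x - g x)"
proof -
  have d: "(\<lambda>x. f x - g x) \<in> Lp 2" "(\<lambda>x. f x - g x) \<in> Lp p" using f g p by (auto intro!: Lp_diff)
  have "Lp_norm p (\<lambda>x. T t f x - T t g x) = Lp_norm p (T t (\<lambda>y. f y - g y))"
    by (rule Lp_norm_cong_AE[symmetric])
      (use bounded_operator_diff[OF T_bounded[OF t] f(1) g(1)] Lp_measurable[OF T_L2[OF t d(1)]] in auto)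
  then show ?thesis using Lp_contractive(2)[OF p t d] by simp
qed

text \<open>A Riemann sum of \<open>\<integral>\<^sub>0\<^sup>h T(s) A u ds\<close> has norm at most \<open>h \<parallel>A u\<parallel>\<^sub>q\<close> by contractivity in
  \<open>L\<^sup>q\<close>, and converges to \<open>T(h) u - u\<close> in \<open>L\<^sup>2\<close>; Fatou's lemma carries the bound to the limit.\<close>

lemma Lp_increment:
  assumes q: "q > 1" and u: "u \<in> Cc_infty" and h: "h > 0"
  shows "(\<lambda>x. T h u x - u x) \<in> Lp q"
    and "Lp_norm q (\<lambda>x. T h u x - u x) \<le> h * Lp_norm q (A_classical u)"
proof -
  let ?g = "A_classical u"
  have fg: "(u, ?g) \<in> generator 2 T" using Cc_infty_op_A[OF u] T_generator by simp
  have u2: "u \<in> Lp 2" by (rule Cc_infty_L2[OF u])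
  have g2: "?g \<in> Lp 2" and gq: "?g \<in> Lp q" using A_classical_Lp[OF u] q by auto
  let ?h = "\<lambda>n. h / real (Suc n)"
  let ?S = "\<lambda>n x. \<Sum>k<Suc n. ?h n *\<^sub>R T (real (Suc k) * ?h n) ?g x"
  have t: "real (Suc k) * ?h n \<ge> 0" for k n using h by simp
  have S2: "?S n \<in> Lp 2" for n using T_L2[OF t g2] by (intro Lp_sum(1) Lp_scaleR) auto
  have Sq: "?S n \<in> Lp q" for n
    using Lp_contractive(1)[OF q t g2 gq] q by (intro Lp_sum(1) Lp_scaleR) auto
  have Sn: "Lp_norm q (?S n) \<le> h * Lp_norm q ?g" for n
  proof -
    have "Lp_norm q (?S n) \<le> (\<Sum>k<Suc n. Lp_norm q (\<lambda>x. ?h n *\<^sub>R T (real (Suc k) * ?h n) ?g x))"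
      using Lp_contractive(1)[OF q t g2 gq] q by (intro Lp_sum(2) Lp_scaleR) auto
    also have "\<dots> \<le> (\<Sum>k<Suc n. ?h n * Lp_norm q ?g)"
    proof (rule sum_mono)
      fix k
      have "Lp_norm q (\<lambda>x. ?h n *\<^sub>R T (real (Suc k) * ?h n) ?g x) = \<bar>?h n\<bar> * Lp_norm q (T (real (Suc k) * ?h n) ?g)"
        using q by (intro Lp_norm_scaleR) simp
      also have "\<dots> \<le> ?h n * Lp_norm q ?g"
      proof -
        have "\<bar>?h n\<bar> = ?h n" using h by simp
        then show ?thesis using Lp_contractive(2)[OF q t g2 gq, of k n] h by (simp only:) (intro mult_left_mono, auto)
      qed
      finally show "Lp_norm q (\<lambda>x. ?h n *\<^sub>R T (real (Suc k) * ?h n) ?g x) \<le> ?h n * Lp_norm q ?g" .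
    qed
    also have "\<dots> = real (Suc n) * (?h n * Lp_norm q ?g)" by (simp only: sum_constant card_lessThan)
    also have "\<dots> = h * Lp_norm q ?g" by simp
    finally show ?thesis .
  qed
  have L: "(\<lambda>x. T h u x - u x) \<in> Lp 2" using T_L2[of h u] h u2 by (intro Lp_diff) auto
  have lim: "(\<lambda>n. Lp_norm 2 (\<lambda>x. ?S n x - (T h u x - u x))) \<longlonglongrightarrow> 0"
  proof (rule Lim_null_comparison[OF always_eventually euler_error_steps[OF fg h]], rule allI)
    fix n
    have hn: "?h n \<ge> 0" and hh: "real (Suc n) * ?h n = h" using h by auto
    show "norm (Lp_norm 2 (\<lambda>x. ?S n x - (T h u x - u x))) \<le> real (Suc n) * euler_error u ?g (?h n)"
      using riemann_sum_error[OF fg hn, of "Suc n"] unfolding hh by simp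
  qed
  show "(\<lambda>x. T h u x - u x) \<in> Lp q" "Lp_norm q (\<lambda>x. T h u x - u x) \<le> h * Lp_norm q ?g"
    using Lp_fatou[OF Sq S2 L _ _ _ Sn lim] q h by auto
qed

text \<open>The difference quotients converge in \<open>L\<^sup>2\<close> and are bounded in \<open>L\<^sup>q\<close>, with \<open>p\<close> between \<open>2\<close> and \<open>q\<close>.\<close>

lemma Lp_generator_test_function:
  assumes p: "p > 1" and u: "u \<in> Cc_infty"
  shows "((\<lambda>h. Lp_norm p (\<lambda>x. (1 / h) *\<^sub>R (T h u x - u x) - A_classical u x)) \<longlongrightarrow> 0) (at_right 0)"
proof -
  let ?g = "A_classical u"
  have fg: "(u, ?g) \<in> generator 2 T" using Cc_infty_op_A[OF u] T_generator by simp
  obtain q where q: "1 < q"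
    "\<And>\<delta>. \<delta> > 0 \<Longrightarrow> \<exists>K\<ge>0. \<forall>r\<ge>0. r powr p \<le> K * r powr 2 + \<delta> * r powr q"
    using powr_interpolation[OF p] by blast
  have u2: "u \<in> Lp 2" by (rule Cc_infty_L2[OF u])
  have g2: "?g \<in> Lp 2" and gq: "?g \<in> Lp q" using A_classical_Lp[OF u] q by auto
  show ?thesis
  proof (rule Lp_interpolated_convergence[OF q(2)])
    show "\<forall>\<^sub>F h in at_right 0. (\<lambda>x. (1 / h) *\<^sub>R (T h u x - u x) - ?g x) \<in> Lp 2 \<inter> Lp q
        \<and> Lp_norm q (\<lambda>x. (1 / h) *\<^sub>R (T h u x - u x) - ?g x) \<le> 2 * Lp_norm q ?g"
      unfolding eventually_at_right_field
    proof (intro exI[of _ 1] conjI allI impI)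
      fix h :: real assume h: "0 < h" "h < 1"
      have a: "(\<lambda>x. (1 / h) *\<^sub>R (T h u x - u x)) \<in> Lp q"
        by (rule Lp_scaleR[OF Lp_increment(1)[OF q(1) u h(1)]])
      have b: "(\<lambda>x. (1 / h) *\<^sub>R (T h u x - u x)) \<in> Lp 2"
        using T_L2[of h u] h u2 by (intro Lp_scaleR Lp_diff) auto
      show "(\<lambda>x. (1 / h) *\<^sub>R (T h u x - u x) - ?g x) \<in> Lp 2 \<inter> Lp q"
        using Lp_diff[OF b g2] Lp_diff[OF a gq] q by simp
      have "Lp_norm q (\<lambda>x. (1 / h) *\<^sub>R (T h u x - u x)) = \<bar>1 / h\<bar> * Lp_norm q (\<lambda>x. T h u x - u x)"
        using q by (intro Lp_norm_scaleR) simp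
      also have "\<dots> \<le> Lp_norm q ?g"
        using Lp_increment(2)[OF q(1) u h(1)] h by (simp add: field_simps)
      finally show "Lp_norm q (\<lambda>x. (1 / h) *\<^sub>R (T h u x - u x) - ?g x) \<le> 2 * Lp_norm q ?g"
        using Lp_norm_diff_le[OF a gq] q by simp
    qed simp
    show "((\<lambda>h. Lp_norm 2 (\<lambda>x. (1 / h) *\<^sub>R (T h u x - u x) - ?g x)) \<longlongrightarrow> 0) (at_right 0)"
      using fg by (simp add: generator_def)
  qed (use p q in auto)
qed

text \<open>As \<open>T(t)\<close> is a contraction for the norm of \<open>L\<^sup>p\<close>, its extension \<open>g\<close> at \<open>f\<close> satisfies these
  inequalities, and by density they determine \<open>g\<close>. All properties of the extension follow from
  them without reference to an approximating sequence.\<close>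

definition extension_value :: "real \<Rightarrow> real \<Rightarrow> (real^'d \<Rightarrow> complex^'m) \<Rightarrow> (real^'d \<Rightarrow> complex^'m) \<Rightarrow> bool" where
  "extension_value p t f g \<longleftrightarrow> g \<in> Lp p \<and>
    (\<forall>h\<in>Lp 2 \<inter> Lp p. Lp_norm p (\<lambda>x. T t h x - g x) \<le> Lp_norm p (\<lambda>x. h x - f x))"

definition extension :: "real \<Rightarrow> real \<Rightarrow> (real^'d \<Rightarrow> complex^'m) \<Rightarrow> (real^'d \<Rightarrow> complex^'m)" where
  "extension p t f = (SOME g. extension_value p t f g)"

text \<open>Approximants that lie in all Lebesgue spaces at once, as required for interpolation.\<close>

lemma all_exponents_dense:
  assumes p: "p > 1" and f: "f \<in> Lp p" and e: "e > 0"
  obtains h where "\<And>q. q > 0 \<Longrightarrow> h \<in> Lp q" "Lp_norm p (\<lambda>x. h x - f x) < e"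
proof -
  obtain h R where h: "continuous_on UNIV h" "\<forall>x. norm x > R \<longrightarrow> h x = 0" "Lp_norm p (\<lambda>x. f x - h x) < e"
    using continuous_compact_dense[OF f _ e] p by auto
  show ?thesis
    using that[of h] continuous_compact_Lp[OF h(1,2)] h(3) by (simp add: Lp_norm_minus_commute[of p h])
qed

lemma extension_exists:
  assumes p: "p > 1" and t: "t \<ge> 0" and f: "f \<in> Lp p"
  shows "\<exists>g. extension_value p t f g"
proof -
  have "\<exists>h. h \<in> Lp 2 \<and> h \<in> Lp p \<and> Lp_norm p (\<lambda>x. h x - f x) < (1/2) ^ n / 2" for n :: nat
  proof -
    have e: "(1/2::real) ^ n / 2 > 0" by simp
    obtain h where h: "\<And>q. q > 0 \<Longrightarrow> h \<in> Lp q" "Lp_norm p (\<lambda>x. h x - f x) < (1/2) ^ n / 2"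
      using all_exponents_dense[OF p f e] by blast
    then show ?thesis using p by (intro exI[of _ h]) auto
  qed
  then obtain h where h: "\<And>n. h n \<in> Lp 2" "\<And>n. h n \<in> Lp p"
      "\<And>n. Lp_norm p (\<lambda>x. h n x - f x) < (1/2) ^ n / 2" by metis
  have p1: "p \<ge> 1" using p by simp
  have Th: "T t (h n) \<in> Lp p" for n by (rule Lp_contractive(1)[OF p t h(1,2)])
  have fast: "Lp_norm p (\<lambda>x. T t (h (Suc n)) x - T t (h n) x) \<le> (1/2) ^ n" for n
  proof -
    have "Lp_norm p (\<lambda>x. T t (h (Suc n)) x - T t (h n) x) \<le> Lp_norm p (\<lambda>x. h (Suc n) x - h n x)"
      by (rule Lp_T_diff[OF p t h(1,2) h(1,2)])
    also have "\<dots> \<le> Lp_norm p (\<lambda>x. h (Suc n) x - f x) + Lp_norm p (\<lambda>x. f x - h n x)"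
      using h f p1 by (intro Lp_norm_triangle_diff)
    also have "\<dots> \<le> (1/2) ^ n"
    proof -
      have "(1/2::real) ^ Suc n / 2 \<le> (1/2) ^ n / 2" by simp
      then show ?thesis
        using h(3)[of "Suc n"] h(3)[of n] Lp_norm_minus_commute[of p f "h n"] by linarith
    qed
    finally show ?thesis .
  qed
  obtain g where g: "g \<in> Lp p" "(\<lambda>n. Lp_norm p (\<lambda>x. T t (h n) x - g x)) \<longlonglongrightarrow> 0"
    using Lp_complete[of "\<lambda>n. T t (h n)", OF Th p1 fast] by blast
  have hf: "(\<lambda>n. Lp_norm p (\<lambda>x. h n x - f x)) \<longlonglongrightarrow> 0"
  proof (rule Lim_null_comparison[OF always_eventually], rule allI)
    show "norm (Lp_norm p (\<lambda>x. h n x - f x)) \<le> (1/2) ^ n / 2" for n using h(3)[of n] by simp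
    show "(\<lambda>n. (1/2) ^ n / 2) \<longlonglongrightarrow> (0::real)"
      by (intro tendsto_divide_zero LIMSEQ_power_zero) auto
  qed
  have "Lp_norm p (\<lambda>x. T t k x - g x) \<le> Lp_norm p (\<lambda>x. k x - f x)" if k: "k \<in> Lp 2" "k \<in> Lp p" for k
  proof (rule LIMSEQ_le_const)
    show "(\<lambda>n. Lp_norm p (\<lambda>x. k x - f x) + Lp_norm p (\<lambda>x. h n x - f x) + Lp_norm p (\<lambda>x. T t (h n) x - g x))
        \<longlonglongrightarrow> Lp_norm p (\<lambda>x. k x - f x)"
      using tendsto_add[OF tendsto_add[OF tendsto_const hf] g(2)] by simp
    have "Lp_norm p (\<lambda>x. T t k x - g x)
        \<le> Lp_norm p (\<lambda>x. k x - f x) + Lp_norm p (\<lambda>x. h n x - f x) + Lp_norm p (\<lambda>x. T t (h n) x - g x)" for n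
    proof -
      have "Lp_norm p (\<lambda>x. T t k x - g x)
          \<le> Lp_norm p (\<lambda>x. T t k x - T t (h n) x) + Lp_norm p (\<lambda>x. T t (h n) x - g x)"
        by (rule Lp_norm_triangle_diff[OF Lp_contractive(1)[OF p t k] Th g(1) p1])
      moreover have "Lp_norm p (\<lambda>x. T t k x - T t (h n) x) \<le> Lp_norm p (\<lambda>x. k x - h n x)"
        by (rule Lp_T_diff[OF p t k h(1,2)])
      moreover have "Lp_norm p (\<lambda>x. k x - h n x) \<le> Lp_norm p (\<lambda>x. k x - f x) + Lp_norm p (\<lambda>x. f x - h n x)"
        by (rule Lp_norm_triangle_diff[OF k(2) f h(2) p1])
      ultimately show ?thesis by (simp add: Lp_norm_minus_commute[of p f "h n"])
    qed
    then show "\<exists>N. \<forall>n\<ge>N. Lp_norm p (\<lambda>x. T t k x - g x)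
        \<le> Lp_norm p (\<lambda>x. k x - f x) + Lp_norm p (\<lambda>x. h n x - f x) + Lp_norm p (\<lambda>x. T t (h n) x - g x)" by blast
  qed
  with g(1) show ?thesis unfolding extension_value_def by blast
qed

lemma extension:
  assumes p: "p > 1" and t: "t \<ge> 0" and f: "f \<in> Lp p"
  shows "extension p t f \<in> Lp p"
    and "h \<in> Lp 2 \<Longrightarrow> h \<in> Lp p \<Longrightarrow> Lp_norm p (\<lambda>x. T t h x - extension p t f x) \<le> Lp_norm p (\<lambda>x. h x - f x)"
proof -
  have "extension_value p t f (extension p t f)"
    unfolding extension_def by (rule someI_ex[OF extension_exists[OF assms]])
  then show "extension p t f \<in> Lp p"
    and "h \<in> Lp 2 \<Longrightarrow> h \<in> Lp p \<Longrightarrow> Lp_norm p (\<lambda>x. T t h x - extension p t f x) \<le> Lp_norm p (\<lambda>x. h x - f x)"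
    unfolding extension_value_def by blast+
qed

lemma extension_extrapolates:
  assumes p: "p > 1"
  shows "extrapolates p T (extension p)"
  unfolding extrapolates_def
proof (intro allI impI ballI)
  fix t :: real and f :: "real^'d \<Rightarrow> complex^'m" assume t: "t \<ge> 0" and "f \<in> Lp 2 \<inter> Lp p"
  then have f: "f \<in> Lp 2" "f \<in> Lp p" by auto
  have "Lp_norm p (\<lambda>x. T t f x - extension p t f x) \<le> 0" using extension(2)[OF p t f(2) f] by simp
  then have "AE x in lebesgue. T t f x = extension p t f x"
    using Lp_eq_AE_if_close[OF Lp_contractive(1)[OF p t f] extension(1)[OF p t f(2)], of 0] p by auto
  then show "AE x in lebesgue. extension p t f x = T t f x" by eventually_elim simp
qed

lemma extension_bounded_operator:
  assumes p: "p > 1" and t: "t \<ge> 0"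
  shows "bounded_operator p (extension p t)"
  unfolding bounded_operator_def
proof (intro conjI ballI allI exI[of _ 1])
  have p1: "p \<ge> 1" "p > 0" using p by auto
  fix f :: "real^'d \<Rightarrow> complex^'m" assume f: "f \<in> Lp p"
  show "extension p t f \<in> Lp p" by (rule extension(1)[OF p t f])
  have z: "Lp_norm p (T t (\<lambda>x. 0)) = 0"
    using Lp_norm_cong_AE[OF Lp_measurable[OF T_L2[OF t Lp_zero]] bounded_operator_zero[OF T_bounded[OF t]]] by simp
  have "Lp_norm p (extension p t f) \<le> Lp_norm p (T t (\<lambda>x. 0)) + Lp_norm p (\<lambda>x. extension p t f x - T t (\<lambda>x. 0) x)"
    using extension(1)[OF p t f] Lp_contractive(1)[OF p t Lp_zero Lp_zero] p1 by (intro Lp_norm_le_add_diff)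
  also have "\<dots> = Lp_norm p (\<lambda>x. T t (\<lambda>x. 0) x - extension p t f x)"
    by (simp add: z Lp_norm_minus_commute[of p "extension p t f"])
  also have "\<dots> \<le> Lp_norm p f" using extension(2)[OF p t f Lp_zero Lp_zero] by (simp add: Lp_norm_minus)
  finally show "Lp_norm p (extension p t f) \<le> 1 * Lp_norm p f" by simp
  fix g :: "real^'d \<Rightarrow> complex^'m" and c :: complex assume g: "g \<in> Lp p"
  have cfg: "(\<lambda>y. c *s f y + g y) \<in> Lp p" by (intro Lp_add Lp_smult f g p1)
  let ?E = "extension p t"
  have Ecfg: "(\<lambda>x. c *s ?E f x + ?E g x) \<in> Lp p" by (intro Lp_add Lp_smult extension(1)[OF p t] f g p1)
  show "AE x in lebesgue. ?E (\<lambda>y. c *s f y + g y) x = c *s ?E f x + ?E g x"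
  proof (rule Lp_eq_AE_if_close[OF extension(1)[OF p t cfg] Ecfg p1(2)])
    show "0 \<le> 2 * (cmod c + 1)" by simp
    fix e :: real assume e: "e > 0"
    obtain h where h: "\<And>q. q > 0 \<Longrightarrow> h \<in> Lp q" "Lp_norm p (\<lambda>x. h x - f x) < e" using all_exponents_dense[OF p f e] by blast
    obtain k where k: "\<And>q. q > 0 \<Longrightarrow> k \<in> Lp q" "Lp_norm p (\<lambda>x. k x - g x) < e" using all_exponents_dense[OF p g e] by blast
    note h2 = h(1)[of 2, simplified] and k2 = k(1)[of 2, simplified] and hp = h(1)[OF p1(2)] and kp = k(1)[OF p1(2)]
    let ?w = "\<lambda>y. c *s h y + k y"
    have w2: "?w \<in> Lp 2" and wp: "?w \<in> Lp p" using p1 by (auto intro!: Lp_add Lp_smult h2 k2 hp kp)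
    have comb: "Lp_norm p (\<lambda>x. (c *s a x + b x) - (c *s a' x + b' x)) \<le> (cmod c + 1) * e"
      if "a \<in> Lp p" "b \<in> Lp p" "a' \<in> Lp p" "b' \<in> Lp p"
        "Lp_norm p (\<lambda>x. a x - a' x) \<le> e" "Lp_norm p (\<lambda>x. b x - b' x) \<le> e" for a b a' b' :: "real^'d \<Rightarrow> complex^'m"
    proof -
      have "Lp_norm p (\<lambda>x. (c *s a x + b x) - (c *s a' x + b' x)) = Lp_norm p (\<lambda>x. c *s (a x - a' x) + (b x - b' x))"
        by (simp add: vector_ssub_ldistrib algebra_simps)
      also have "\<dots> \<le> Lp_norm p (\<lambda>x. c *s (a x - a' x)) + Lp_norm p (\<lambda>x. b x - b' x)"
        by (intro Lp_norm_triangle Lp_smult Lp_diff that p1)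
      also have "\<dots> = cmod c * Lp_norm p (\<lambda>x. a x - a' x) + Lp_norm p (\<lambda>x. b x - b' x)"
        by (simp only: Lp_norm_smult[OF p1(2)])
      also have "\<dots> \<le> cmod c * e + e" using that by (intro add_mono mult_left_mono) auto
      finally show ?thesis by (simp add: distrib_right)
    qed
    have "Lp_norm p (\<lambda>x. ?E (\<lambda>y. c *s f y + g y) x - (c *s ?E f x + ?E g x))
        \<le> Lp_norm p (\<lambda>x. ?E (\<lambda>y. c *s f y + g y) x - T t ?w x) + Lp_norm p (\<lambda>x. T t ?w x - (c *s ?E f x + ?E g x))"
      by (intro Lp_norm_triangle_diff extension(1)[OF p t cfg] Lp_contractive(1)[OF p t w2 wp] Ecfg p1)
    also have "Lp_norm p (\<lambda>x. ?E (\<lambda>y. c *s f y + g y) x - T t ?w x) \<le> (cmod c + 1) * e"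
    proof -
      have "Lp_norm p (\<lambda>x. T t ?w x - ?E (\<lambda>y. c *s f y + g y) x) \<le> Lp_norm p (\<lambda>x. ?w x - (c *s f x + g x))"
        by (rule extension(2)[OF p t cfg w2 wp])
      also have "\<dots> \<le> (cmod c + 1) * e" by (rule comb) (use h(2) k(2) hp kp f g in auto)
      finally show ?thesis by (simp add: Lp_norm_minus_commute[of p "?E (\<lambda>y. c *s f y + g y)"])
    qed
    also have "Lp_norm p (\<lambda>x. T t ?w x - (c *s ?E f x + ?E g x)) \<le> (cmod c + 1) * e"
    proof -
      have "Lp_norm p (\<lambda>x. T t ?w x - (c *s ?E f x + ?E g x))
          = Lp_norm p (\<lambda>x. (c *s T t h x + T t k x) - (c *s ?E f x + ?E g x))"
      proof (rule Lp_norm_cong_AE)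
        show "(\<lambda>x. T t ?w x - (c *s ?E f x + ?E g x)) \<in> borel_measurable lebesgue"
          by (rule Lp_measurable[OF Lp_diff[OF Lp_contractive(1)[OF p t w2 wp] Ecfg p1(2)]])
        show "AE x in lebesgue. T t ?w x - (c *s ?E f x + ?E g x) = (c *s T t h x + T t k x) - (c *s ?E f x + ?E g x)"
          using bounded_operatorD(2)[OF T_bounded[OF t] h2 k2, of c] by eventually_elim simp
      qed
      also have "\<dots> \<le> (cmod c + 1) * e"
      proof (rule comb)
        show "Lp_norm p (\<lambda>x. T t h x - ?E f x) \<le> e" using extension(2)[OF p t f h2 hp] h(2) by simp
        show "Lp_norm p (\<lambda>x. T t k x - ?E g x) \<le> e" using extension(2)[OF p t g k2 kp] k(2) by simp
      qed (use Lp_contractive(1)[OF p t h2 hp] Lp_contractive(1)[OF p t k2 kp] extension(1)[OF p t] f g in auto)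
      finally show ?thesis .
    qed
    finally show "Lp_norm p (\<lambda>x. ?E (\<lambda>y. c *s f y + g y) x - (c *s ?E f x + ?E g x)) \<le> e * (2 * (cmod c + 1))"
      by (simp add: algebra_simps)
  qed
qed

text \<open>On the dense set of functions that lie in all Lebesgue spaces, \<open>T(t) h \<rightarrow> h\<close> in \<open>L\<^sup>2\<close> and
  \<open>\<parallel>T(t) h - h\<parallel>\<^sub>q \<le> 2 \<parallel>h\<parallel>\<^sub>q\<close>; interpolate. The extension is a contraction, so this suffices.\<close>

lemma extension_continuous:
  assumes p: "p > 1" and f: "f \<in> Lp p"
  shows "((\<lambda>t. Lp_norm p (\<lambda>x. extension p t f x - f x)) \<longlongrightarrow> 0) (at_right 0)"
proof (rule tendstoI)
  have p1: "p \<ge> 1" "p > 0" using p by auto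
  fix e :: real assume e: "e > 0"
  then have "e / 3 > 0" by simp
  then obtain h where h: "\<And>q. q > 0 \<Longrightarrow> h \<in> Lp q" "Lp_norm p (\<lambda>x. h x - f x) < e / 3"
    using all_exponents_dense[OF p f] by blast
  obtain q where q: "1 < q"
    "\<And>\<delta>. \<delta> > 0 \<Longrightarrow> \<exists>K\<ge>0. \<forall>r\<ge>0. r powr p \<le> K * r powr 2 + \<delta> * r powr q"
    using powr_interpolation[OF p] by blast
  have h2: "h \<in> Lp 2" and hp: "h \<in> Lp p" and hq: "h \<in> Lp q" using h(1) p q by auto
  have "((\<lambda>t. Lp_norm p (\<lambda>x. T t h x - h x)) \<longlongrightarrow> 0) (at_right 0)"
  proof (rule Lp_interpolated_convergence[OF q(2) _ _ _ T_tendsto[OF h2]])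
    show "\<forall>\<^sub>F t in at_right 0. (\<lambda>x. T t h x - h x) \<in> Lp 2 \<inter> Lp q \<and> Lp_norm q (\<lambda>x. T t h x - h x) \<le> 2 * Lp_norm q h"
      unfolding eventually_at_right_field
    proof (intro exI[of _ 1] conjI allI impI)
      fix t :: real assume "0 < t" "t < 1"
      then have t: "t \<ge> 0" by simp
      note Tq = Lp_contractive[OF q(1) t h2 hq]
      show "(\<lambda>x. T t h x - h x) \<in> Lp 2 \<inter> Lp q"
        using Lp_diff[OF T_L2[OF t h2] h2] Lp_diff[OF Tq(1) hq] q by simp
      show "Lp_norm q (\<lambda>x. T t h x - h x) \<le> 2 * Lp_norm q h"
        using Lp_norm_diff_le[OF Tq(1) hq] Tq(2) q by simp
    qed simp
  qed (use p q in auto)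
  then have "\<forall>\<^sub>F t in at_right 0. Lp_norm p (\<lambda>x. T t h x - h x) < e / 3"
    using e by (intro order_tendstoD) auto
  moreover have "\<forall>\<^sub>F t::real in at_right 0. t > 0" by (simp add: eventually_at_right_less)
  ultimately show "\<forall>\<^sub>F t in at_right 0. dist (Lp_norm p (\<lambda>x. extension p t f x - f x)) 0 < e"
  proof eventually_elim
    case (elim t)
    then have t: "t \<ge> 0" by simp
    note Th = Lp_contractive(1)[OF p t h2 hp]
    have "Lp_norm p (\<lambda>x. extension p t f x - f x)
        \<le> Lp_norm p (\<lambda>x. extension p t f x - T t h x) + Lp_norm p (\<lambda>x. T t h x - f x)"
      by (intro Lp_norm_triangle_diff extension(1)[OF p t f] Th f p1)
    also have "Lp_norm p (\<lambda>x. T t h x - f x) \<le> Lp_norm p (\<lambda>x. T t h x - h x) + Lp_norm p (\<lambda>x. h x - f x)"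
      by (intro Lp_norm_triangle_diff Th hp f p1)
    also have "Lp_norm p (\<lambda>x. extension p t f x - T t h x) \<le> Lp_norm p (\<lambda>x. h x - f x)"
      using extension(2)[OF p t f h2 hp] by (simp add: Lp_norm_minus_commute[of p "extension p t f"])
    finally show ?case using elim h(2) by (simp add: dist_real_def)
  qed
qed

lemma extension_C0_semigroup:
  assumes p: "p > 1"
  shows "C0_semigroup p (extension p)"
  unfolding C0_semigroup_def
proof (intro conjI allI impI ballI extension_bounded_operator[OF p] extension_continuous[OF p])
  have p1: "p \<ge> 1" "p > 0" using p by auto
  fix f :: "real^'d \<Rightarrow> complex^'m" assume f: "f \<in> Lp p"
  show "AE x in lebesgue. extension p 0 f x = f x"
  proof (rule Lp_eq_AE_if_close[OF extension(1)[OF p order_refl f] f p1(2)])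
    fix e :: real assume "e > 0"
    then obtain h where h: "\<And>q. q > 0 \<Longrightarrow> h \<in> Lp q" "Lp_norm p (\<lambda>x. h x - f x) < e"
      using all_exponents_dense[OF p f] by blast
    have h2: "h \<in> Lp 2" and hp: "h \<in> Lp p" using h(1) p by auto
    note Th = Lp_contractive(1)[OF p order_refl h2 hp]
    have "Lp_norm p (\<lambda>x. extension p 0 f x - f x)
        \<le> Lp_norm p (\<lambda>x. extension p 0 f x - T 0 h x) + Lp_norm p (\<lambda>x. T 0 h x - f x)"
      by (intro Lp_norm_triangle_diff extension(1)[OF p order_refl f] Th f p1)
    also have "Lp_norm p (\<lambda>x. extension p 0 f x - T 0 h x) \<le> Lp_norm p (\<lambda>x. h x - f x)"
      using extension(2)[OF p order_refl f h2 hp] by (simp add: Lp_norm_minus_commute[of p "extension p 0 f"])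
    also have "Lp_norm p (\<lambda>x. T 0 h x - f x) = Lp_norm p (\<lambda>x. h x - f x)"
      using T_zero[OF h2] by (intro Lp_norm_cong_AE Lp_measurable[OF Lp_diff[OF Th f p1(2)]]) auto
    finally show "Lp_norm p (\<lambda>x. extension p 0 f x - f x) \<le> e * 2" using h(2) by simp
  qed simp
  fix s t :: real assume s: "s \<ge> 0" and t: "t \<ge> 0"
  have st: "s + t \<ge> 0" using s t by simp
  let ?E = "extension p"
  have Et: "?E t f \<in> Lp p" by (rule extension(1)[OF p t f])
  show "AE x in lebesgue. ?E (s + t) f x = ?E s (?E t f) x"
  proof (rule Lp_eq_AE_if_close[OF extension(1)[OF p st f] extension(1)[OF p s Et] p1(2)])
    fix e :: real assume "e > 0"
    then obtain h where h: "\<And>q. q > 0 \<Longrightarrow> h \<in> Lp q" "Lp_norm p (\<lambda>x. h x - f x) < e"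
      using all_exponents_dense[OF p f] by blast
    have h2: "h \<in> Lp 2" and hp: "h \<in> Lp p" using h(1) p by auto
    note Th = T_L2[OF t h2] Lp_contractive(1)[OF p t h2 hp]
    note Tst = Lp_contractive(1)[OF p st h2 hp]
    have "Lp_norm p (\<lambda>x. ?E (s + t) f x - ?E s (?E t f) x)
        \<le> Lp_norm p (\<lambda>x. ?E (s + t) f x - T (s + t) h x) + Lp_norm p (\<lambda>x. T (s + t) h x - ?E s (?E t f) x)"
      by (intro Lp_norm_triangle_diff extension(1)[OF p st f] Tst extension(1)[OF p s Et] p1)
    also have "Lp_norm p (\<lambda>x. ?E (s + t) f x - T (s + t) h x) \<le> Lp_norm p (\<lambda>x. h x - f x)"
      using extension(2)[OF p st f h2 hp] by (simp add: Lp_norm_minus_commute[of p "?E (s + t) f"])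
    also have "Lp_norm p (\<lambda>x. T (s + t) h x - ?E s (?E t f) x) = Lp_norm p (\<lambda>x. T s (T t h) x - ?E s (?E t f) x)"
      using T_add[OF s t h2]
      by (intro Lp_norm_cong_AE Lp_measurable[OF Lp_diff[OF Tst extension(1)[OF p s Et] p1(2)]]) auto
    also have "\<dots> \<le> Lp_norm p (\<lambda>x. T t h x - ?E t f x)" by (rule extension(2)[OF p s Et Th])
    also have "\<dots> \<le> Lp_norm p (\<lambda>x. h x - f x)" by (rule extension(2)[OF p t f h2 hp])
    finally show "Lp_norm p (\<lambda>x. ?E (s + t) f x - ?E s (?E t f) x) \<le> e * 2" using h(2) by simp
  qed simp
qed

lemma generator_extrapolated:
  assumes p: "p > 1" and ex: "extrapolates p T Tp" and u: "u \<in> Cc_infty"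
  shows "(u, A_classical u) \<in> generator p Tp"
proof -
  have p0: "p > 0" using p by simp
  have u2: "u \<in> Lp 2" and up: "u \<in> Lp p" using Cc_infty_Lp[OF u] p by auto
  have g: "A_classical u \<in> Lp p" by (rule A_classical_Lp[OF u p0])
  have eq: "Lp_norm p (\<lambda>x. (1 / h) *\<^sub>R (T h u x - u x) - A_classical u x)
      = Lp_norm p (\<lambda>x. (1 / h) *\<^sub>R (Tp h u x - u x) - A_classical u x)" if h: "h > 0" for h
  proof (rule Lp_norm_cong_AE)
    have h0: "h \<ge> 0" using h by simp
    show "(\<lambda>x. (1 / h) *\<^sub>R (T h u x - u x) - A_classical u x) \<in> borel_measurable lebesgue"
      by (rule Lp_measurable[OF Lp_diff[OF Lp_scaleR[OF Lp_diff[OF Lp_contractive(1)[OF p h0 u2 up] up p0]] g p0]])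
    have "AE x in lebesgue. Tp h u x = T h u x" using ex h0 u2 up unfolding extrapolates_def by blast
    then show "AE x in lebesgue. (1 / h) *\<^sub>R (T h u x - u x) - A_classical u x
        = (1 / h) *\<^sub>R (Tp h u x - u x) - A_classical u x" by eventually_elim simp
  qed
  have "((\<lambda>h. Lp_norm p (\<lambda>x. (1 / h) *\<^sub>R (Tp h u x - u x) - A_classical u x)) \<longlongrightarrow> 0) (at_right 0)"
  proof (rule Lim_transform_eventually[OF Lp_generator_test_function[OF p u]])
    show "\<forall>\<^sub>F h in at_right 0. Lp_norm p (\<lambda>x. (1 / h) *\<^sub>R (T h u x - u x) - A_classical u x)
        = Lp_norm p (\<lambda>x. (1 / h) *\<^sub>R (Tp h u x - u x) - A_classical u x)"
      unfolding eventually_at_right_field using eq by (intro exI[of _ 1]) auto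
  qed
  then show ?thesis using up g by (simp add: generator_def)
qed

end

lemma generator_unique:
  fixes S :: "real \<Rightarrow> (real^'d::finite \<Rightarrow> complex^'m::finite) \<Rightarrow> (real^'d \<Rightarrow> complex^'m)"
  assumes S: "C0_semigroup p S" and p: "p \<ge> 1"
    and g: "(f, g) \<in> generator p S" and g': "(f, g') \<in> generator p S"
  shows "AE x in lebesgue. g x = g' x"
proof -
  have p0: "p > 0" using p by simp
  have L: "f \<in> Lp p" "g \<in> Lp p" "g' \<in> Lp p"
    and l: "((\<lambda>h. Lp_norm p (\<lambda>x. (1 / h) *\<^sub>R (S h f x - f x) - g x)) \<longlongrightarrow> 0) (at_right 0)"
    and l': "((\<lambda>h. Lp_norm p (\<lambda>x. (1 / h) *\<^sub>R (S h f x - f x) - g' x)) \<longlongrightarrow> 0) (at_right 0)"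
    using g g' by (auto simp: generator_def)
  have le: "Lp_norm p (\<lambda>x. g x - g' x) \<le> Lp_norm p (\<lambda>x. (1 / h) *\<^sub>R (S h f x - f x) - g x)
      + Lp_norm p (\<lambda>x. (1 / h) *\<^sub>R (S h f x - f x) - g' x)" if h: "h > 0" for h
  proof -
    have "S h f \<in> Lp p" using S h L by (auto simp: C0_semigroup_def bounded_operator_def)
    then have "(\<lambda>x. (1 / h) *\<^sub>R (S h f x - f x)) \<in> Lp p" using L p0 by (intro Lp_scaleR Lp_diff)
    from Lp_norm_triangle_diff[OF L(2) this L(3) p] show ?thesis
      by (simp add: Lp_norm_minus_commute[of p g])
  qed
  have "Lp_norm p (\<lambda>x. g x - g' x) \<le> 0"
  proof (rule tendsto_le[OF _ _ tendsto_const])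
    show "((\<lambda>h. Lp_norm p (\<lambda>x. (1 / h) *\<^sub>R (S h f x - f x) - g x)
      + Lp_norm p (\<lambda>x. (1 / h) *\<^sub>R (S h f x - f x) - g' x)) \<longlongrightarrow> 0) (at_right 0)"
      using tendsto_add[OF l l'] by simp
    show "\<forall>\<^sub>F h in at_right 0. Lp_norm p (\<lambda>x. g x - g' x) \<le> Lp_norm p (\<lambda>x. (1 / h) *\<^sub>R (S h f x - f x) - g x)
      + Lp_norm p (\<lambda>x. (1 / h) *\<^sub>R (S h f x - f x) - g' x)"
      unfolding eventually_at_right_field using le by (intro exI[of _ 1]) auto
  qed simp
  then show ?thesis using Lp_eq_AE_if_close[OF L(2,3) p0, of 0] by auto
qed

lemma distr_of_cong_AE:
  fixes g g' :: "real^'d::finite \<Rightarrow> complex^'m::finite"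
  assumes "g \<in> borel_measurable lebesgue" "AE x in lebesgue. g x = g' x"
  shows "distr_eq (distr_of g) (distr_of g')"
  unfolding distr_eq_def distr_of_def
proof
  fix \<phi> :: "real^'d \<Rightarrow> real" assume "\<phi> \<in> Cc_infty"
  then have [measurable]: "\<phi> \<in> borel_measurable lebesgue"
    by (intro continuous_measurable_lebesgue C1c_continuous Cc_infty_C1c)
  note [measurable] = assms(1) borel_measurable_AE[OF assms]
  show "(LINT x|lebesgue. \<phi> x *\<^sub>R g x) = (LINT x|lebesgue. \<phi> x *\<^sub>R g' x)"
    by (rule integral_cong_AE) (use assms(2) in auto)
qed

theorem theorem4p3:
  fixes Q :: "real^'d::finite \<Rightarrow> real^'d^'d"
    and V :: "real^'d \<Rightarrow> real^'m^'m::finite"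
    and \<eta>1 \<eta>2 p :: real
    and T :: "real \<Rightarrow> (real^'d \<Rightarrow> complex^'m) \<Rightarrow> (real^'d \<Rightarrow> complex^'m)"
  assumes Q_sym: "\<And>x i j. Q x $ i $ j = Q x $ j $ i"
    and Q_C1: "\<And>i j. bounded_C1 (\<lambda>x. Q x $ i $ j)"
    and eta_pos: "\<eta>1 > 0" "\<eta>2 > 0"
    and Q_elliptic: "\<And>x \<xi>. \<eta>1 * (norm \<xi>)\<^sup>2 \<le> (Q x *v \<xi>) \<bullet> \<xi> \<and> (Q x *v \<xi>) \<bullet> \<xi> \<le> \<eta>2 * (norm \<xi>)\<^sup>2"
    and V_Linf_loc: "\<And>i j. Linf_loc (\<lambda>x. V x $ i $ j)"
    and V_accretive: "\<And>x \<xi>. Re (\<Sum>i\<in>UNIV. (cmatrix (V x) *v \<xi>) $ i * cnj (\<xi> $ i)) \<ge> 0"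
    and T_semigroup: "C0_semigroup 2 T" "contractions 2 T"
    and T_generator: "generator 2 T = op_A Q V"
    and p: "1 < p"
  shows "(\<exists>Tp. C0_semigroup p Tp \<and> extrapolates p T Tp) \<and>
    (\<forall>Tp. C0_semigroup p Tp \<and> extrapolates p T Tp \<longrightarrow>
       Cc_infty \<subseteq> Domain (generator p Tp) \<and>
       (\<forall>u\<in>Cc_infty. \<forall>g. (u, g) \<in> generator p Tp \<longrightarrow> distr_eq (distr_of g) (calA Q V u)))"
proof -
  have Q_nonneg: "0 \<le> (Q x *v \<xi>) \<bullet> \<xi>" for x \<xi>
  proof -
    have "0 \<le> \<eta>1 * (norm \<xi>)\<^sup>2" using eta_pos by simp
    then show ?thesis using Q_elliptic[of \<xi> x] by linarith
  qed
  interpret schroedinger_semigroup Q V T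
    by unfold_locales
      (use Q_C1 Q_nonneg V_Linf_loc V_accretive T_semigroup T_generator in \<open>auto simp: cmatrix_inner\<close>)
  show ?thesis
  proof (intro conjI exI[of _ "extension p"] allI impI subsetI ballI extension_C0_semigroup[OF p]
      extension_extrapolates[OF p])
    fix Tp and u :: "real^'d \<Rightarrow> complex^'m"
    assume Tp: "C0_semigroup p Tp \<and> extrapolates p T Tp" and u: "u \<in> Cc_infty"
    have gen: "(u, A_classical u) \<in> generator p Tp"
      using generator_extrapolated[OF p _ u] Tp by blast
    then show "u \<in> Domain (generator p Tp)" by blast
    fix g assume "(u, g) \<in> generator p Tp"
    then have ae: "AE x in lebesgue. g x = A_classical u x" and g: "g \<in> Lp p"
      using generator_unique[OF conjunct1[OF Tp] less_imp_le[OF p] _ gen] by (auto simp: generator_def)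
    show "distr_eq (distr_of g) (calA Q V u)"
      using distr_of_cong_AE[OF Lp_measurable[OF g] ae] calA_classical[OF u]
      unfolding distr_eq_def by simp
  qed
qed

end
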